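(* Let $\boldsymbol{s}=(s,s_L,s_U)$ be a scaling triple with $R_0=\infty$ and associated constant $c_s$, and let $Z$ be an additive process on $\mathbb{R}^d$ with a bounded triplet $(a(t),0,\Lambda_t)_{t\ge0}$. Assume that there exist a Lévy measure $\nu$ on $\mathbb{R}^d$ and positive constants $N_\nu$ and $c$ such that for every $t\ge0$ and every nonnegative Borel measurable function $f$ on $\mathbb{R}^d$, $$\int_{\mathbb{R}^d}f(y)\Lambda_t(dy)\ge\int_{\mathbb{R}^d}f(y)\nu(dy),$$ $$\inf_{r\in(0,\infty),\,|\xi|=c}s(r)\int_{|y|\le N_\nu}(1-\cos(y\cdot\xi))\,\nu(r\,dy)>0,$$ and $$\sup_{r\in(0,\infty)}\Big[s(r)\int_{\mathbb{R}^d}(1\wedge|r^{-1}y|^2)\nu(dy)\Big]=\sup_{r\in(0,\infty)}\Big[s(r)\int_{\mathbb{R}^d}(1\wedge|y|^2)\nu(r\,dy)\Big]<\infty.$$ Then: (1) for every $T\in(0,\infty)$ and every $\varphi\in\mathcal{S}(\mathbb{R}^d)$ with $\mathcal{F}[\varphi]\in C_c^\infty(B_{c_s}\setminus B_{c_s^{-1}})$ there exist positive constants $N_0,N_1$ such that $$\int_{\mathbb{R}^d}\big|\mathbb{E}[\varphi(x+r^{-1}Z_t)]\big|\,dx\le N_0e^{-\frac{N_1t}{s(r)}}\qquad\forall(r,t)\in(0,1)\times[0,T];$$ (2) the symmetric Lévy measure $\mu(dy)=\frac12(\nu(dy)+\nu(-dy))$ satisfies $\sup_{0<r<\infty}s(r)\int_{\mathbb{R}^d}(1\wedge|r^{-1}y|^2)\mu(dy)<\infty$,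 and consequently for every $\varphi\in\mathcal{S}(\mathbb{R}^d)$ with $\mathcal{F}[\varphi]\in C_c^\infty(B_{c_s}\setminus B_{c_s^{-1}})$ there exists $N_2>0$ with $\|\psi^\mu(r^{-1}D)\varphi\|_{L_1(\mathbb{R}^d)}\le N_2/s(r)$ for all $r\in(0,1)$.
   Context: $B_r=\{x\in\mathbb{R}^d:|x|<r\}$; $\mathcal{F}[f](\xi)=(2\pi)^{-d/2}\int e^{-i\xi\cdot x}f(x)dx$ and $\mathcal{F}^{-1}$ is its inverse. A Lévy measure is a nonnegative Borel measure $\nu$ on $\mathbb{R}^d$ with $\nu(\{0\})=0$, $\int(1\wedge|y|^2)\nu(dy)<\infty$. $\nu(r\,dy)$ denotes the measure $A\mapsto\nu(rA)$, i.e. $\int f(y)\nu(r\,dy)=\int f(y/r)\nu(dy)$. $\psi^\mu(\xi)=\int(e^{iy\cdot\xi}-1-iy\cdot\xi1_{|y|\le1})\mu(dy)$ and $\psi^\mu(r^{-1}D)\varphi=\mathcal{F}^{-1}[\psi^\mu(r^{-1}\cdot)\mathcal{F}[\varphi]]$. Additive processes: fix a complete probability space with a filtration $(\mathcal{F}_t)$ satisfying the usual conditions; processes are adapted, $\mathbb{R}^d$-valued, start at $0$. $Z$ is an additive process with a bounded triplet $(a(t),0,\Lambda_t)_{t\ge0}$ if $Z_t-Z_s$ is independent of $\mathcal{F}_s$ for $t>s\ge0$; $a:[0,\infty)\to\mathbb{R}^d$ is Borel; $(\Lambda_t)$ is a measurable family of Lévy measures on $\mathbb{R}^d$ ($t\mapsto\int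 f\,d\Lambda_t$ is measurable for every integrable $f$); $\mathbb{E}[e^{i\xi\cdot(Z_t-Z_s)}]=\exp(\int_s^t\Psi_Z(r,\xi)dr)$ for $0\le s\le t$ with $\Psi_Z(r,\xi)=ia(r)\cdot\xi+\int(e^{iy\cdot\xi}-1-iy\cdot\xi1_{|y|\le1})\Lambda_r(dy)$; and $a$ and $t\mapsto\int(1\wedge|y|^2)\Lambda_t(dy)$ belong to $L_\infty([0,T])$ for each $T<\infty$. Scaling triple with $R_0=\infty$: $s,s_L,s_U:(0,\infty)\to(0,\infty)$ are measurable, $s_L,s_U$ are non-decreasing with limit $0$ at $0$ and $\infty$ at $\infty$, and $s_L(R/r)\le s(R)/s(r)\le s_U(R/r)$ for all $0<r\le R<\infty$. $m_s=\min\{m\in\mathbb{N}:s_L(2^m)>1\}$, $c_s=2^{m_s}$. *)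

theory Defs
  imports "HOL-Probability.Probability"
begin

section \<open>Scaling triples\<close>

text \<open>Only the values on \<open>(0,\<infinity>)\<close> matter; this is the case \<open>R\<^sub>0 = \<infinity>\<close>.\<close>

definition scaling_triple :: "(real \<Rightarrow> real) \<Rightarrow> (real \<Rightarrow> real) \<Rightarrow> (real \<Rightarrow> real) \<Rightarrow> bool" where
  "scaling_triple s sL sU \<longleftrightarrow>
     (\<forall>g\<in>{s, sL, sU}. (\<forall>r>0. 0 < g r) \<and> g \<in> borel_measurable (restrict_space borel {0<..})) \<and>
     (\<forall>g\<in>{sL, sU}. mono_on {0<..} g \<and> (g \<longlongrightarrow> 0) (at_right 0) \<and> filterlim g at_top at_top) \<and>
     (\<forall>r R. 0 < r \<and> r \<le> R \<longrightarrow> sL (R / r) \<le> s R / s r \<and> s R / s r \<le> sU (R / r))"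

text \<open>In a scaling triple \<open>sL 1 \<le> s 1 / s 1 = 1\<close>, so starting the naturals at 0 or at 1
  gives the same minimum.\<close>

definition scaling_exponent :: "(real \<Rightarrow> real) \<Rightarrow> nat" where
  "scaling_exponent sL = (LEAST m. sL (2 ^ m) > 1)"

definition scaling_const :: "(real \<Rightarrow> real) \<Rightarrow> real" where
  "scaling_const sL = 2 ^ scaling_exponent sL"


section \<open>Schwartz functions and the Fourier transform\<close>

fun iterated_partial :: "'a::euclidean_space list \<Rightarrow> ('a \<Rightarrow> complex) \<Rightarrow> 'a \<Rightarrow> complex" where
  "iterated_partial [] f = f"
| "iterated_partial (b # bs) f = (\<lambda>x. frechet_derivative (iterated_partial bs f) (at x) b)"

text \<open>A list over \<open>Basis\<close> plays the role of a multi-index. Differentiability of every iterated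
  partial derivative makes all of them exist and be continuous, which is \<open>C\<^sup>\<infinity>\<close>.\<close>

definition smooth_fun :: "('a::euclidean_space \<Rightarrow> complex) \<Rightarrow> bool" where
  "smooth_fun f \<longleftrightarrow> (\<forall>bs\<in>lists Basis. \<forall>x. iterated_partial bs f differentiable (at x))"

definition schwartz :: "('a::euclidean_space \<Rightarrow> complex) set" where
  "schwartz = {f. smooth_fun f \<and>
     (\<forall>k. \<forall>bs\<in>lists Basis. bounded (range (\<lambda>x. norm x ^ k * norm (iterated_partial bs f x))))}"

text \<open>Smooth functions on the whole space whose (closed) support is a compact subset of \<open>U\<close>;
  \<open>U\<close> need not be open.\<close>

definition smooth_compact_support :: "'a::euclidean_space set \<Rightarrow> ('a \<Rightarrow> complex) set" where
  "smooth_compact_support U =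
     {f. smooth_fun f \<and> compact (closure {x. f x \<noteq> 0}) \<and> closure {x. f x \<noteq> 0} \<subseteq> U}"

definition fourier :: "('a::euclidean_space \<Rightarrow> complex) \<Rightarrow> 'a \<Rightarrow> complex" where
  "fourier f \<xi> = complex_of_real ((2 * pi) powr (- real DIM('a) / 2)) *
     (LINT x|lborel. exp (- (\<i> * complex_of_real (\<xi> \<bullet> x))) * f x)"

definition inv_fourier :: "('a::euclidean_space \<Rightarrow> complex) \<Rightarrow> 'a \<Rightarrow> complex" where
  "inv_fourier g x = complex_of_real ((2 * pi) powr (- real DIM('a) / 2)) *
     (LINT \<xi>|lborel. exp (\<i> * complex_of_real (\<xi> \<bullet> x)) * g \<xi>)"


section \<open>Levy measures\<close>

definition levy_measure :: "'a::euclidean_space measure \<Rightarrow> bool" where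
  "levy_measure \<nu> \<longleftrightarrow> sets \<nu> = sets borel \<and> emeasure \<nu> {0} = 0 \<and>
     (\<integral>\<^sup>+ y. ennreal (min 1 ((norm y)\<^sup>2)) \<partial>\<nu>) < \<infinity>"

text \<open>The measure \<open>\<nu>(r dy)\<close>, that is \<open>A \<mapsto> \<nu>(rA)\<close>.\<close>

definition dilated :: "real \<Rightarrow> 'a::euclidean_space measure \<Rightarrow> 'a measure" where
  "dilated r \<nu> = distr \<nu> borel (\<lambda>y. y /\<^sub>R r)"

lemma emeasure_dilated:
  assumes "sets \<nu> = sets borel" "0 < r" "A \<in> sets borel"
  shows "emeasure (dilated r \<nu>) A = emeasure \<nu> ((\<lambda>y. r *\<^sub>R y) ` A)"
proof -
  have sp: "space \<nu> = UNIV"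
    using sets_eq_imp_space_eq[OF assms(1)] by simp
  have "(\<lambda>y. y /\<^sub>R r) \<in> measurable \<nu> borel"
    using assms(1) by (simp add: measurable_cong_sets[OF assms(1) refl])
  moreover have "(\<lambda>y. y /\<^sub>R r) -` A = (\<lambda>y. r *\<^sub>R y) ` A"
    using assms(2) by (force simp: image_iff intro: bexI[where x = "_ /\<^sub>R r"])
  ultimately show ?thesis
    using assms(3) by (simp add: dilated_def emeasure_distr sp)
qed

lemma SUP_nn_integral_dilated:
  assumes "sets \<nu> = sets borel"
  shows "(SUP r\<in>{0<..}. ennreal (s r) * (\<integral>\<^sup>+ y. ennreal (min 1 ((norm (y /\<^sub>R r))\<^sup>2)) \<partial>\<nu>)) =
         (SUP r\<in>{0<..}. ennreal (s r) * (\<integral>\<^sup>+ y. ennreal (min 1 ((norm y)\<^sup>2)) \<partial>dilated r \<nu>))"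
proof (intro SUP_cong refl)
  fix r :: real
  have "(\<lambda>y. y /\<^sub>R r) \<in> measurable \<nu> borel"
    using assms by (simp add: measurable_cong_sets[OF assms refl])
  then show "ennreal (s r) * (\<integral>\<^sup>+ y. ennreal (min 1 ((norm (y /\<^sub>R r))\<^sup>2)) \<partial>\<nu>) =
        ennreal (s r) * (\<integral>\<^sup>+ y. ennreal (min 1 ((norm y)\<^sup>2)) \<partial>dilated r \<nu>)"
    unfolding dilated_def by (subst nn_integral_distr) auto
qed

definition symmetrized :: "'a::euclidean_space measure \<Rightarrow> 'a measure" where
  "symmetrized \<nu> =
     measure_of UNIV (sets borel) (\<lambda>A. (emeasure \<nu> A + emeasure \<nu> (uminus ` A)) / 2)"

lemma sets_symmetrized [simp]: "sets (symmetrized \<nu>) = sets borel"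
  unfolding symmetrized_def
  using sigma_algebra.sets_measure_of_eq[OF sets.sigma_algebra_axioms[of borel]] by simp

lemma emeasure_symmetrized:
  fixes \<nu> :: "'a::euclidean_space measure"
  assumes "sets \<nu> = sets borel" "A \<in> sets borel"
  shows "emeasure (symmetrized \<nu>) A = (emeasure \<nu> A + emeasure \<nu> (uminus ` A)) / 2"
proof -
  have sp: "space \<nu> = UNIV"
    using sets_eq_imp_space_eq[OF assms(1)] by simp
  have m: "uminus \<in> measurable \<nu> borel"
    using assms(1) by (simp add: measurable_cong_sets[OF assms(1) refl])
  have vim: "uminus -` B = uminus ` B" for B :: "'a set"
    by (force simp: image_iff intro: bexI[where x = "- _"])
  have refl': "emeasure \<nu> (uminus ` B) = emeasure (distr \<nu> borel uminus) B" if "B \<in> sets borel" for B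
    using that m by (simp add: emeasure_distr sp vim)
  show ?thesis
  proof (rule emeasure_measure_of[OF symmetrized_def])
    show "countably_additive (sets (symmetrized \<nu>))
        (\<lambda>A. (emeasure \<nu> A + emeasure \<nu> (uminus ` A)) / 2)"
    proof (rule countably_additiveI)
      fix B :: "nat \<Rightarrow> 'a set"
      assume B: "range B \<subseteq> sets (symmetrized \<nu>)" "disjoint_family B"
      then have B': "range B \<subseteq> sets borel" "\<And>i. B i \<in> sets borel"
        by auto
      have "(\<Sum>i. (emeasure \<nu> (B i) + emeasure \<nu> (uminus ` B i)) / 2) =
            (\<Sum>i. emeasure \<nu> (B i) + emeasure (distr \<nu> borel uminus) (B i)) / 2"
        using B' by (simp add: refl' divide_ennreal_def)
      also have "\<dots> = ((\<Sum>i. emeasure \<nu> (B i)) + (\<Sum>i. emeasure (distr \<nu> borel uminus) (B i))) / 2"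
        by (subst suminf_add[symmetric]) auto
      also have "\<dots> = (emeasure \<nu> (\<Union>i. B i) + emeasure (distr \<nu> borel uminus) (\<Union>i. B i)) / 2"
        using B B' assms(1) by (simp add: suminf_emeasure)
      also have "\<dots> = (emeasure \<nu> (\<Union>i. B i) + emeasure \<nu> (uminus ` (\<Union>i. B i))) / 2"
        using B' by (subst refl') auto
      finally show "(\<Sum>i. (emeasure \<nu> (B i) + emeasure \<nu> (uminus ` B i)) / 2) =
          (emeasure \<nu> (\<Union>i. B i) + emeasure \<nu> (uminus ` (\<Union>i. B i))) / 2" .
    qed
  qed (use assms in \<open>auto simp: positive_def\<close>)
qed

definition levy_symbol :: "'a::euclidean_space measure \<Rightarrow> 'a \<Rightarrow> complex" where
  "levy_symbol \<mu> \<xi> =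
     (LINT y|\<mu>. exp (\<i> * complex_of_real (y \<bullet> \<xi>)) - 1
        - \<i> * complex_of_real (y \<bullet> \<xi>) * indicator {y. norm y \<le> 1} y)"

text \<open>The operator \<open>\<psi>\<^sup>\<mu>(r\<^sup>-\<^sup>1 D)\<close>.\<close>

definition levy_operator :: "'a::euclidean_space measure \<Rightarrow> real \<Rightarrow> ('a \<Rightarrow> complex) \<Rightarrow> 'a \<Rightarrow> complex" where
  "levy_operator \<mu> r \<phi> = inv_fourier (\<lambda>\<xi>. levy_symbol \<mu> (\<xi> /\<^sub>R r) * fourier \<phi> \<xi>)"


section \<open>Additive processes\<close>

text \<open>Time ranges over \<open>[0,\<infinity>)\<close>: nothing is required of \<open>F t\<close>, \<open>Z t\<close>, \<open>a t\<close>, \<open>\<Lambda> t\<close>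
  for negative \<open>t\<close>.\<close>

definition usual_filtration :: "'w measure \<Rightarrow> (real \<Rightarrow> 'w measure) \<Rightarrow> bool" where
  "usual_filtration M F \<longleftrightarrow>
     (\<forall>t\<ge>0. subalgebra M (F t)) \<and>
     (\<forall>u t. 0 \<le> u \<and> u \<le> t \<longrightarrow> sets (F u) \<subseteq> sets (F t)) \<and>
     null_sets M \<subseteq> sets (F 0) \<and>
     (\<forall>t\<ge>0. sets (F t) = (\<Inter>u\<in>{t<..}. sets (F u)))"

definition measurable_levy_family :: "(real \<Rightarrow> 'a::euclidean_space measure) \<Rightarrow> bool" where
  "measurable_levy_family \<Lambda> \<longleftrightarrow>
     (\<forall>t\<ge>0. levy_measure (\<Lambda> t)) \<and>
     (\<forall>f :: 'a \<Rightarrow> real. (\<forall>t\<ge>0. integrable (\<Lambda> t) f) \<longrightarrow>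
        (\<lambda>t. LINT y|\<Lambda> t. f y) \<in> borel_measurable (restrict_space borel {0..}))"

definition bounded_triplet :: "(real \<Rightarrow> 'a::euclidean_space) \<Rightarrow> (real \<Rightarrow> 'a measure) \<Rightarrow> bool" where
  "bounded_triplet a \<Lambda> \<longleftrightarrow>
     a \<in> borel_measurable (restrict_space borel {0..}) \<and>
     measurable_levy_family \<Lambda> \<and>
     (\<forall>T>0. \<exists>K. (AE t in lborel. t \<in> {0..T} \<longrightarrow> norm (a t) \<le> K) \<and>
        (AE t in lborel. t \<in> {0..T} \<longrightarrow>
           (\<integral>\<^sup>+ y. ennreal (min 1 ((norm y)\<^sup>2)) \<partial>\<Lambda> t) \<le> ennreal K))"

definition additive_symbol ::
  "(real \<Rightarrow> 'a::euclidean_space) \<Rightarrow> (real \<Rightarrow> 'a measure) \<Rightarrow> real \<Rightarrow> 'a \<Rightarrow> complex" where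
  "additive_symbol a \<Lambda> t \<xi> = \<i> * complex_of_real (a t \<bullet> \<xi>) + levy_symbol (\<Lambda> t) \<xi>"

definition additive_process ::
  "'w measure \<Rightarrow> (real \<Rightarrow> 'w measure) \<Rightarrow> (real \<Rightarrow> 'w \<Rightarrow> 'a::euclidean_space) \<Rightarrow>
   (real \<Rightarrow> 'a) \<Rightarrow> (real \<Rightarrow> 'a measure) \<Rightarrow> bool" where
  "additive_process M F Z a \<Lambda> \<longleftrightarrow>
     prob_space M \<and> complete_measure M \<and> usual_filtration M F \<and>
     (\<forall>t\<ge>0. Z t \<in> borel_measurable (F t)) \<and>
     (AE \<omega> in M. Z 0 \<omega> = 0) \<and>
     (\<forall>u t. 0 \<le> u \<and> u < t \<longrightarrow>
        prob_space.indep_set M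
          (sets (vimage_algebra (space M) (\<lambda>\<omega>. Z t \<omega> - Z u \<omega>) borel)) (sets (F u))) \<and>
     bounded_triplet a \<Lambda> \<and>
     (\<forall>u t \<xi>. 0 \<le> u \<and> u \<le> t \<longrightarrow>
        (LINT \<omega>|M. exp (\<i> * complex_of_real (\<xi> \<bullet> (Z t \<omega> - Z u \<omega>)))) =
        exp (LINT r:{u..t}|lborel. additive_symbol a \<Lambda> r \<xi>))"

end

theory Submission
  imports Defs
begin

text \<open>
  A function \<open>h\<close> on the frequency side has norm at most \<open>B\<close> if
  \<open>|\<integral> h g| \<le> B sup |\<integral> e\<^sup>i\<^sup>x\<^sup>\<xi> g(\<xi>) d\<xi>|\<close> for all integrable \<open>g\<close>. In this dual form,
  characters have norm \<open>1\<close>, norms are submultiplicative and pass to pointwise limits and to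
  parameter integrals; so \<open>exp\<close> of a function of norm \<open>B\<close> has norm at most \<open>exp B\<close>, and
  no convolution or derivative of a symbol is ever needed. Gaussian summation turns the norm
  of an integrable \<open>h\<close> into a bound on the \<open>L\<^sub>1\<close> norm of its inverse Fourier transform.

  The characteristic function of \<open>Z\<^sub>t / r\<close> is \<open>exp (t \<psi>)\<close> times a remainder, where \<open>\<psi>\<close> is the
  symbol of the jumps of \<open>\<nu>(r dy)\<close> of size at most \<open>N\<close>. The remainder has norm at most \<open>1\<close>:
  it is a limit of characters times \<open>exp (\<integral> (e\<^sup>i\<^sup>y\<^sup>\<xi> - 1) \<theta>(dy))\<close> with \<open>\<theta>\<close> finite and nonnegative.
  Cut \<open>F[\<phi>]\<close> by a partition of unity into pieces living on boxes of side \<open>\<delta>\<close>.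
  Near a centre \<open>\<xi>\<^sub>0\<close> one can replace \<open>\<psi> - \<psi>(\<xi>\<^sub>0)\<close> by a function of norm \<open>O(\<delta> / s(r))\<close>,
  while \<open>Re \<psi>(\<xi>\<^sub>0) \<le> - c / s(r)\<close>. Choosing \<open>\<delta>\<close> small gives the exponential decay. The same local
  replacement, with one box containing the support of \<open>F[\<phi>]\<close>, bounds the operator in (2).
\<close>

section \<open>A dual form of the Fourier--Stieltjes norm\<close>

text \<open>Gain and loss scale alike. Over a box of side \<delta> the symbol varies by O(\<delta> /
  s(r)), by the upper bound on \<nu>, while the lower bound yields a rate of order 1 / s(r). Hence
  \<delta> and the number of boxes depend on neither r nor t; half of the rate pays for the
  variation and the other half survives in the result, with constants that do not even involve T.
  Jumps that are to produce decay must be bounded: replacing z . (\<xi> -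
  \<open>\<xi>\<^sub>0\<close>) by a function of norm O(\<delta> |z|) costs a factor exp (O(\<delta>
  |z|)). The large jumps, whose symbol may have no smoothness at all, stay in the remainder, where
  positivity alone is used. The small jumps there may have infinite mass, which is why the remainder
  is treated as a limit of cut-offs near the origin. All that the argument asks of a cut-off
  function is an integrable Fourier transform. Piecewise linear hats have one, given by an explicit
  formula, and they build both the partition of unity and the bounded substitute for a linear
  function.\<close>

abbreviation trig_integral :: "('a::euclidean_space \<Rightarrow> complex) \<Rightarrow> 'a \<Rightarrow> complex" where
  "trig_integral g x \<equiv> LINT \<xi>|lborel. iexp (x \<bullet> \<xi>) * g \<xi>"

text \<open>If \<open>h\<close> is the Fourier-Stieltjes transform of a finite complex measure, the
  total variation of that measure is such a \<open>B\<close>. The pointwise clause makes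
  \<open>h \<xi> * g \<xi>\<close> integrable and supplies majorants; duality by itself controls
  \<open>h\<close> only almost everywhere.\<close>

definition fs_bounded :: "('a::euclidean_space \<Rightarrow> complex) \<Rightarrow> real \<Rightarrow> bool" where
  "fs_bounded h B \<longleftrightarrow> h \<in> borel_measurable borel \<and> (\<forall>\<xi>. norm (h \<xi>) \<le> B) \<and>
     (\<forall>g S. integrable lborel g \<longrightarrow>
        (\<forall>x. norm (trig_integral g x) \<le> S) \<longrightarrow>
        norm (LBINT \<xi>. h \<xi> * g \<xi>) \<le> B * S)"

lemma fs_boundedI:
  assumes "h \<in> borel_measurable borel" "\<And>\<xi>. norm (h \<xi>) \<le> B"
    and "\<And>g S. integrable lborel g \<Longrightarrow> 0 \<le> S \<Longrightarrow>
        (\<And>x. norm (trig_integral g x) \<le> S) \<Longrightarrow>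
        norm (LBINT \<xi>. h \<xi> * g \<xi>) \<le> B * S"
  shows "fs_bounded h B"
  unfolding fs_bounded_def using assms order_trans[OF norm_ge_zero] by blast

lemma fs_boundedD:
  assumes "fs_bounded h B"
  shows "h \<in> borel_measurable borel" "norm (h \<xi>) \<le> B" "0 \<le> B"
    and "integrable lborel g \<Longrightarrow>
        (\<And>x. norm (trig_integral g x) \<le> S) \<Longrightarrow>
        norm (LBINT \<xi>. h \<xi> * g \<xi>) \<le> B * S"
  using assms order_trans[OF norm_ge_zero] unfolding fs_bounded_def by blast+

text \<open>A function that is not integrable has integral 0 by convention, and the right-hand side
  is nonnegative; so only the majorant has to be checked in applications.\<close>

lemma norm_integral_le_integral:
  fixes f :: "'b \<Rightarrow> 'c::{banach, second_countable_topology}"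
  assumes "integrable M g" "\<And>x. norm (f x) \<le> g x"
  shows "norm (LINT x|M. f x) \<le> (LINT x|M. g x)"
proof (cases "integrable M f")
  case True
  then show ?thesis
    using assms by (intro order_trans[OF integral_norm_bound integral_mono]) auto
next
  case False
  moreover have "0 \<le> (LINT x|M. g x)"
    using order_trans[OF norm_ge_zero assms(2)] by (intro integral_nonneg_AE) auto
  ultimately show ?thesis by (simp add: not_integrable_integral_eq)
qed

lemma integrable_bounded_mult:
  fixes h g :: "'b \<Rightarrow> complex"
  assumes "integrable M g" "h \<in> borel_measurable M" "\<And>x. norm (h x) \<le> B"
  shows "integrable M (\<lambda>x. h x * g x)"
proof (rule Bochner_Integration.integrable_bound)
  show "integrable M (\<lambda>x. B * norm (g x))" using assms by simp
  show "AE x in M. norm (h x * g x) \<le> norm (B * norm (g x))"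
  proof (rule AE_I2)
    fix x
    have "norm (h x) * norm (g x) \<le> B * norm (g x)"
      by (intro mult_right_mono assms) simp
    then show "norm (h x * g x) \<le> norm (B * norm (g x))"
      by (simp add: norm_mult)
  qed
qed (use assms in measurable)

lemma fs_bounded_integrable:
  assumes "fs_bounded h B" "integrable lborel g"
  shows "integrable lborel (\<lambda>\<xi>. h \<xi> * g \<xi>)"
  using integrable_bounded_mult[OF assms(2) _ fs_boundedD(2)[OF assms(1)]] fs_boundedD(1)[OF assms(1)]
  by simp

lemma fs_bounded_mono: "fs_bounded h B \<Longrightarrow> B \<le> B' \<Longrightarrow> fs_bounded h B'"
  unfolding fs_bounded_def
  by (meson mult_right_mono norm_ge_zero order_trans)

lemma fs_bounded_0: "0 \<le> B \<Longrightarrow> fs_bounded (\<lambda>_. 0) B"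
  by (rule fs_boundedI) auto

lemma fs_bounded_char: "fs_bounded (\<lambda>\<xi>. iexp (y \<bullet> \<xi>)) 1"
  by (rule fs_boundedI) auto

lemma fs_bounded_const: "fs_bounded (\<lambda>_. c) (norm c)"
proof (rule fs_boundedI)
  fix g :: "'a \<Rightarrow> complex" and S
  assume "\<And>x. norm (trig_integral g x) \<le> S"
  from this[of 0] show "norm (LBINT \<xi>. c * g \<xi>) \<le> norm c * S"
    by (simp add: norm_mult mult_left_mono)
qed auto

lemma fs_bounded_add:
  assumes "fs_bounded h B" "fs_bounded k C"
  shows "fs_bounded (\<lambda>\<xi>. h \<xi> + k \<xi>) (B + C)"
proof (rule fs_boundedI)
  note [measurable] = fs_boundedD(1)[OF assms(1)] fs_boundedD(1)[OF assms(2)]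
  show "(\<lambda>\<xi>. h \<xi> + k \<xi>) \<in> borel_measurable borel" by measurable
  show "norm (h \<xi> + k \<xi>) \<le> B + C" for \<xi>
    by (intro norm_triangle_mono fs_boundedD assms)
  fix g :: "'a \<Rightarrow> complex" and S
  assume g: "integrable lborel g"
    and S: "\<And>x. norm (trig_integral g x) \<le> S"
  have "(LBINT \<xi>. (h \<xi> + k \<xi>) * g \<xi>) = (LBINT \<xi>. h \<xi> * g \<xi>) + (LBINT \<xi>. k \<xi> * g \<xi>)"
    unfolding distrib_right
    by (intro Bochner_Integration.integral_add fs_bounded_integrable[OF assms(1) g]
        fs_bounded_integrable[OF assms(2) g])
  also have "norm \<dots> \<le> B * S + C * S"
    by (intro norm_triangle_mono fs_boundedD(4)[OF _ g] assms S)
  finally show "norm (LBINT \<xi>. (h \<xi> + k \<xi>) * g \<xi>) \<le> (B + C) * S"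
    by (simp add: distrib_right)
qed

text \<open>For fixed \<open>x\<close>, the test function \<open>e\<^sup>i\<^sup>x\<^sup>\<xi> g\<close> has the same bound \<open>S\<close>, its transform
  being a translate; hence \<open>k g\<close> has the bound \<open>C S\<close>.\<close>

lemma fs_bounded_mult:
  assumes "fs_bounded h B" "fs_bounded k C"
  shows "fs_bounded (\<lambda>\<xi>. h \<xi> * k \<xi>) (B * C)"
proof (rule fs_boundedI)
  note [measurable] = fs_boundedD(1)[OF assms(1)] fs_boundedD(1)[OF assms(2)]
  show "(\<lambda>\<xi>. h \<xi> * k \<xi>) \<in> borel_measurable borel" by measurable
  show "norm (h \<xi> * k \<xi>) \<le> B * C" for \<xi>
    unfolding norm_mult by (intro mult_mono fs_boundedD[OF assms(1)] fs_boundedD[OF assms(2)]) simp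
  fix g :: "'a \<Rightarrow> complex" and S
  assume g: "integrable lborel g"
    and S: "\<And>x. norm (trig_integral g x) \<le> S"
  have kg: "integrable lborel (\<lambda>\<xi>. k \<xi> * g \<xi>)"
    by (rule fs_bounded_integrable[OF assms(2) g])
  have "norm (LBINT \<xi>. iexp (x \<bullet> \<xi>) * (k \<xi> * g \<xi>)) \<le> C * S" for x
  proof -
    have "norm (LBINT \<xi>. k \<xi> * (iexp (x \<bullet> \<xi>) * g \<xi>)) \<le> C * S"
    proof (intro fs_boundedD(4)[OF assms(2)])
      show "integrable lborel (\<lambda>\<xi>. iexp (x \<bullet> \<xi>) * g \<xi>)"
        by (rule integrable_bounded_mult[OF g, where B = 1]) auto
      show "norm (LBINT \<xi>. iexp (x' \<bullet> \<xi>) *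
          (iexp (x \<bullet> \<xi>) * g \<xi>)) \<le> S" for x'
        using S[of "x' + x"] by (simp add: inner_add_left exp_add distrib_left mult.assoc)
    qed
    then show ?thesis by (simp add: mult.left_commute)
  qed
  from fs_boundedD(4)[OF assms(1) kg this]
  show "norm (LBINT \<xi>. h \<xi> * k \<xi> * g \<xi>) \<le> B * C * S"
    by (simp add: mult.assoc)
qed

lemma fs_bounded_cmult:
  assumes "fs_bounded h B" "norm c \<le> C"
  shows "fs_bounded (\<lambda>\<xi>. c * h \<xi>) (C * B)"
  using fs_bounded_mono[OF fs_bounded_mult[OF fs_bounded_const assms(1)] mult_right_mono[OF assms(2)]]
    fs_boundedD(3)[OF assms(1)] by blast

lemma fs_bounded_sum:
  assumes "\<And>i. i \<in> I \<Longrightarrow> fs_bounded (h i) (B i)"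
  shows "fs_bounded (\<lambda>\<xi>. \<Sum>i\<in>I. h i \<xi>) (\<Sum>i\<in>I. B i)"
  using assms by (induction I rule: infinite_finite_induct) (auto intro: fs_bounded_0 fs_bounded_add)

lemma fs_bounded_prod:
  assumes "\<And>i. i \<in> I \<Longrightarrow> fs_bounded (h i) (B i)"
  shows "fs_bounded (\<lambda>\<xi>. \<Prod>i\<in>I. h i \<xi>) (\<Prod>i\<in>I. B i)"
  using assms fs_bounded_const[of 1]
  by (induction I rule: infinite_finite_induct) (auto intro!: fs_bounded_mult)

lemma fs_bounded_power: "fs_bounded h B \<Longrightarrow> fs_bounded (\<lambda>\<xi>. h \<xi> ^ n) (B ^ n)"
  using fs_bounded_prod[of "{..<n}" "\<lambda>_. h" "\<lambda>_. B"] by simp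

text \<open>Pointwise convergence is enough because the common bound makes
  \<open>B * norm (g \<xi>)\<close> a majorant for dominated convergence.\<close>

lemma fs_bounded_limit:
  assumes h: "\<And>n. fs_bounded (h n) B" and lim: "\<And>\<xi>. (\<lambda>n. h n \<xi>) \<longlonglongrightarrow> k \<xi>"
  shows "fs_bounded k B"
proof (rule fs_boundedI)
  note [measurable] = fs_boundedD(1)[OF h]
  show [measurable]: "k \<in> borel_measurable borel"
    by (rule borel_measurable_LIMSEQ_metric[OF fs_boundedD(1)[OF h] lim])
  show bd: "norm (k \<xi>) \<le> B" for \<xi>
    by (rule LIMSEQ_le_const2[OF tendsto_norm[OF lim]]) (auto intro: fs_boundedD[OF h])
  fix g :: "'a \<Rightarrow> complex" and S
  assume g: "integrable lborel g"
    and S: "\<And>x. norm (trig_integral g x) \<le> S"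
  have "(\<lambda>n. LINT \<xi>|lborel. h n \<xi> * g \<xi>) \<longlonglongrightarrow> (LBINT \<xi>. k \<xi> * g \<xi>)"
  proof (rule integral_dominated_convergence[where w = "\<lambda>\<xi>. B * norm (g \<xi>)"])
    show "AE x in lborel. (\<lambda>n. h n x * g x) \<longlonglongrightarrow> k x * g x"
      by (intro AE_I2 tendsto_mult lim tendsto_const)
    show "AE x in lborel. norm (h n x * g x) \<le> B * norm (g x)" for n
      by (intro AE_I2) (auto simp: norm_mult intro!: mult_right_mono fs_boundedD[OF h])
  qed (use g in auto)
  then show "norm (LBINT \<xi>. k \<xi> * g \<xi>) \<le> B * S"
    by (rule LIMSEQ_le_const2[OF tendsto_norm]) (auto intro!: fs_boundedD(4)[OF h g] S)
qed

text \<open>For j = 1 and j = 2 the sums are the entire functions (exp z - 1) / z and (exp z - 1 -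
  z) / z^2. Through them one or two factors \<open>h\<close> can be split off, so that the norms of
  exp h - 1 and exp h - 1 - h become small with that of \<open>h\<close>; the shift \<open>j\<close>
  only lowers the coefficients and keeps the bound \<open>exp B\<close>.\<close>

lemma summable_exp_tail:
  fixes z :: "'b::{real_normed_algebra_1,banach}"
  shows "summable (\<lambda>n. z ^ n /\<^sub>R fact (n + j))"
proof (rule summable_comparison_test[OF _ summable_norm_exp[of z]], intro exI allI impI)
  fix n
  have "(inverse (fact (n + j)) :: real) \<le> inverse (fact n)"
    by (intro le_imp_inverse_le fact_mono) auto
  then show "norm (z ^ n /\<^sub>R fact (n + j)) \<le> norm (z ^ n /\<^sub>R fact n)"
    by (auto intro!: mult_right_mono)
qed

lemma fs_bounded_exp_tail:
  assumes "fs_bounded h B"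
  shows "fs_bounded (\<lambda>\<xi>. \<Sum>n. h \<xi> ^ n /\<^sub>R fact (n + j)) (exp B)"
proof (rule fs_bounded_limit)
  fix N
  have "fs_bounded (\<lambda>\<xi>. \<Sum>n<N. (1 / fact (n + j)) * h \<xi> ^ n) (\<Sum>n<N. (1 / fact n) * B ^ n)"
    by (intro fs_bounded_sum fs_bounded_cmult fs_bounded_power assms)
      (auto simp: norm_divide divide_simps intro: fact_mono)
  moreover have "(\<Sum>n<N. (1 / fact n) * B ^ n) \<le> exp B"
    using sum_le_suminf[OF summable_exp_generic[of B], of "{..<N}"] fs_boundedD(3)[OF assms]
    by (simp add: exp_def divide_inverse)
  ultimately show "fs_bounded (\<lambda>\<xi>. \<Sum>n<N. h \<xi> ^ n /\<^sub>R fact (n + j)) (exp B)"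
    by (auto intro: fs_bounded_mono simp: scaleR_conv_of_real divide_inverse)
next
  show "(\<lambda>N. \<Sum>n<N. h \<xi> ^ n /\<^sub>R fact (n + j)) \<longlonglongrightarrow> (\<Sum>n. h \<xi> ^ n /\<^sub>R fact (n + j))" for \<xi>
    by (rule summable_LIMSEQ[OF summable_exp_tail])
qed

lemma fs_bounded_exp:
  assumes "fs_bounded h B"
  shows "fs_bounded (\<lambda>\<xi>. exp (h \<xi>)) (exp B)"
  using fs_bounded_exp_tail[OF assms, of 0] by (simp add: exp_def)

lemma fs_bounded_exp_minus_1:
  assumes "fs_bounded h B"
  shows "fs_bounded (\<lambda>\<xi>. exp (h \<xi>) - 1) (B * exp B)"
proof -
  have "exp (h \<xi>) - 1 = h \<xi> * (\<Sum>n. h \<xi> ^ n /\<^sub>R fact (n + 1))" for \<xi>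
    using exp_first_term[of "h \<xi>"] suminf_mult[OF summable_exp_tail, of "h \<xi>" 1 "h \<xi>"] by simp
  then show ?thesis
    using fs_bounded_mult[OF assms fs_bounded_exp_tail[OF assms, of 1]] by simp
qed

lemma fs_bounded_exp_minus_2:
  assumes "fs_bounded h B"
  shows "fs_bounded (\<lambda>\<xi>. exp (h \<xi>) - 1 - h \<xi>) (B\<^sup>2 * exp B)"
proof -
  have "exp (h \<xi>) - 1 - h \<xi> = h \<xi> ^ 2 * (\<Sum>n. h \<xi> ^ n /\<^sub>R fact (n + 2))" for \<xi>
    using exp_first_two_terms[of "h \<xi>"] suminf_mult[OF summable_exp_tail, of "h \<xi> ^ 2" 2 "h \<xi>"]
    by (simp add: power_add power2_eq_square mult_ac)
  then show ?thesis
    using fs_bounded_mult[OF fs_bounded_power[OF assms, of 2] fs_bounded_exp_tail[OF assms, of 2]] by simp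
qed

section \<open>Fubini's theorem and integration over a parameter\<close>

lemma Fubini_product_bound:
  fixes F :: "'b \<Rightarrow> 'c \<Rightarrow> 'd::{banach, second_countable_topology}" and B :: "'b \<Rightarrow> real"
  assumes "sigma_finite_measure M1" "sigma_finite_measure M2"
    and F: "(\<lambda>(y, x). F y x) \<in> borel_measurable (M1 \<Otimes>\<^sub>M M2)"
    and B: "integrable M1 B" and G: "integrable M2 G"
    and bd: "\<And>y x. norm (F y x) \<le> B y * G x"
  shows "(LINT x|M2. LINT y|M1. F y x) = (LINT y|M1. LINT x|M2. F y x)"
proof -
  interpret M1: sigma_finite_measure M1 by fact
  interpret M2: sigma_finite_measure M2 by fact
  interpret P: pair_sigma_finite M1 M2 ..
  have "integrable (M1 \<Otimes>\<^sub>M M2) (\<lambda>(y, x). B y * G x)"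
  proof (rule P.Fubini_integrable)
    show "integrable M1 (\<lambda>y. LINT x|M2. norm (case (y, x) of (y, x) \<Rightarrow> B y * G x))"
      using B G by (simp add: abs_mult)
  qed (use B G in auto)
  then have "integrable (M1 \<Otimes>\<^sub>M M2) (\<lambda>(y, x). F y x)"
    by (rule Bochner_Integration.integrable_bound)
      (use bd F in \<open>auto intro!: AE_I2 intro: order_trans[OF _ abs_ge_self]\<close>)
  then show ?thesis by (rule P.Fubini_integral)
qed

text \<open>Minkowski's integral inequality for this norm: Fubini lets each \<open>h y\<close> be
  tested against \<open>g\<close> separately. It is used for superpositions of characters, for
  integrals over jumps and for integrals over time.\<close>

lemma fs_bounded_parameter:
  fixes h :: "'b \<Rightarrow> 'a::euclidean_space \<Rightarrow> complex"
  assumes sf: "sigma_finite_measure \<Theta>"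
    and h: "\<And>y. fs_bounded (h y) (B y)"
    and meas: "(\<lambda>(y, \<xi>). h y \<xi>) \<in> borel_measurable (\<Theta> \<Otimes>\<^sub>M borel)"
    and B: "integrable \<Theta> B"
  shows "fs_bounded (\<lambda>\<xi>. LINT y|\<Theta>. h y \<xi>) (LINT y|\<Theta>. B y)"
proof (rule fs_boundedI)
  interpret \<Theta>: sigma_finite_measure \<Theta> by fact
  have meas2: "(\<lambda>(y, \<xi>). h y \<xi>) \<in> borel_measurable (\<Theta> \<Otimes>\<^sub>M lborel)"
    using meas by (simp add: measurable_cong_sets[OF sets_pair_measure_cong[OF refl sets_lborel]])
  have "(\<lambda>(\<xi>, y). h y \<xi>) \<in> borel_measurable (borel \<Otimes>\<^sub>M \<Theta>)"
    using measurable_compose[OF measurable_pair_swap' meas] by (simp add: case_prod_beta')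
  then show "(\<lambda>\<xi>. LINT y|\<Theta>. h y \<xi>) \<in> borel_measurable borel"
    by (rule \<Theta>.borel_measurable_lebesgue_integral)
  show "norm (LINT y|\<Theta>. h y \<xi>) \<le> (LINT y|\<Theta>. B y)" for \<xi>
    by (intro norm_integral_le_integral B fs_boundedD(2) h)
  fix g :: "'a \<Rightarrow> complex" and S
  assume g: "integrable lborel g" and S0: "0 \<le> S"
    and S: "\<And>x. norm (trig_integral g x) \<le> S"
  note [measurable] = meas2 borel_measurable_integrable[OF g]
  have m: "(\<lambda>(y, \<xi>). h y \<xi> * g \<xi>) \<in> borel_measurable (\<Theta> \<Otimes>\<^sub>M lborel)"
    using meas2 by (auto simp: case_prod_beta')
  have "(LBINT \<xi>. (LINT y|\<Theta>. h y \<xi>) * g \<xi>) = (LBINT \<xi>. (LINT y|\<Theta>. h y \<xi> * g \<xi>))"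
    by simp
  also have "\<dots> = (LINT y|\<Theta>. (LBINT \<xi>. h y \<xi> * g \<xi>))"
    using fs_boundedD(3)[OF h]
    by (intro Fubini_product_bound[where G = "\<lambda>\<xi>. norm (g \<xi>)", OF sf sigma_finite_lborel m B])
      (auto simp: norm_mult g intro!: mult_mono fs_boundedD(2)[OF h])
  also have "norm \<dots> \<le> (LINT y|\<Theta>. B y * S)"
    using B by (intro norm_integral_le_integral fs_boundedD(4)[OF h g] S) auto
  finally show "norm (LBINT \<xi>. (LINT y|\<Theta>. h y \<xi>) * g \<xi>) \<le> (LINT y|\<Theta>. B y) * S"
    by simp
qed

section \<open>The Gaussian on a Euclidean space\<close>

interpretation lborel_product: product_sigma_finite "\<lambda>_. lborel :: real measure"
  by standard

lemma lborel_integral_prod: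
  fixes f :: "'a::euclidean_space \<Rightarrow> real \<Rightarrow> complex"
  assumes f: "\<And>b. b \<in> Basis \<Longrightarrow> integrable lborel (f b)"
  shows integrable_lborel_prod: "integrable lborel (\<lambda>x. \<Prod>b\<in>Basis. f b (x \<bullet> b))"
    and integral_lborel_prod:
      "(LBINT x. (\<Prod>b\<in>Basis. f b (x \<bullet> b))) = (\<Prod>b\<in>Basis. (LBINT x. f b x))"
proof -
  have [measurable]: "f b \<in> borel_measurable borel" if "b \<in> Basis" for b
    using borel_measurable_integrable[OF f[OF that]] by simp
  have eq: "(\<Prod>b\<in>Basis. f b ((\<Sum>c\<in>Basis. x c *\<^sub>R c) \<bullet> b)) = (\<Prod>b\<in>Basis. f b (x b))" for x
    by (intro prod.cong refl) simp
  have m1: "(\<lambda>x. \<Sum>c\<in>Basis. x c *\<^sub>R c) \<in> measurable (\<Pi>\<^sub>M b\<in>Basis. lborel) (borel :: 'a measure)"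
    by measurable
  have m2: "(\<lambda>x. \<Prod>b\<in>Basis. f b (x \<bullet> b)) \<in> borel_measurable borel"
    by measurable
  have "integrable (distr (\<Pi>\<^sub>M b\<in>Basis. lborel) borel (\<lambda>f. \<Sum>b\<in>Basis. f b *\<^sub>R b)) (\<lambda>x. \<Prod>b\<in>Basis. f b (x \<bullet> b))"
    unfolding integrable_distr_eq[OF m1 m2] eq
    by (intro lborel_product.product_integrable_prod f) auto
  then show "integrable lborel (\<lambda>x. \<Prod>b\<in>Basis. f b (x \<bullet> b))"
    by (rule iffD2[OF arg_cong[OF lborel_eq, of "\<lambda>M. integrable M _"]])
  have "(LBINT x. (\<Prod>b\<in>Basis. f b (x \<bullet> b))) =
    (LINT x|distr (\<Pi>\<^sub>M b\<in>Basis. lborel) borel (\<lambda>f. \<Sum>b\<in>Basis. f b *\<^sub>R b). (\<Prod>b\<in>Basis. f b (x \<bullet> b)))"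
    by (rule arg_cong[OF lborel_eq, of "\<lambda>M. integral\<^sup>L M _"])
  also have "\<dots> = (\<Prod>b\<in>Basis. (LBINT x. f b x))"
    unfolding integral_distr[OF m1 m2] eq
    by (intro lborel_product.product_integral_prod f) auto
  finally show "(LBINT x. (\<Prod>b\<in>Basis. f b (x \<bullet> b))) = (\<Prod>b\<in>Basis. (LBINT x. f b x))" .
qed

section \<open>Affine changes of variables and the Gaussian\<close>

lemma integrable_lborel_affine:
  fixes f :: "'a::euclidean_space \<Rightarrow> 'b::{banach, second_countable_topology}"
  assumes f: "integrable lborel f" and c: "c \<noteq> 0"
  shows "integrable lborel (\<lambda>x. f (t + c *\<^sub>R x))"
proof -
  have [measurable]: "f \<in> borel_measurable borel" using borel_measurable_integrable[OF f] by simp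
  have "integrable (density (distr lborel borel (\<lambda>x. t + c *\<^sub>R x)) (\<lambda>_. \<bar>c\<bar> ^ DIM('a))) f"
    by (rule iffD1[OF arg_cong[OF lborel_affine[OF c], of "\<lambda>M. integrable M f"] f])
  then have "integrable lborel (\<lambda>x. \<bar>c\<bar> ^ DIM('a) *\<^sub>R f (t + c *\<^sub>R x))"
    by (simp add: integrable_density integrable_distr_eq)
  from integrable_scaleR_right[OF this, of "inverse (\<bar>c\<bar> ^ DIM('a))"] show ?thesis
    using c by simp
qed

lemma integral_lborel_affine:
  fixes f :: "'a::euclidean_space \<Rightarrow> 'b::{banach, second_countable_topology}"
  assumes f: "f \<in> borel_measurable borel" and c: "c \<noteq> 0"
  shows "(LBINT x. f x) = \<bar>c\<bar> ^ DIM('a) *\<^sub>R (LBINT x. f (t + c *\<^sub>R x))"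
proof -
  note [measurable] = f
  have "(LBINT x. f x) = (LINT x|density (distr lborel borel (\<lambda>x. t + c *\<^sub>R x)) (\<lambda>_. \<bar>c\<bar> ^ DIM('a)). f x)"
    by (rule arg_cong[OF lborel_affine[OF c], of "\<lambda>M. integral\<^sup>L M f"])
  then show ?thesis
    by (simp add: integral_density integral_distr)
qed

text \<open>Left unnormalised so that its value at 0 is 1, as befits a damping factor; the
  normalising constant appears as \<open>gauss_mass\<close>.\<close>

definition gauss :: "'a::euclidean_space \<Rightarrow> real" where
  "gauss x = exp (- (norm x)\<^sup>2 / 2)"

lemma gauss_bounds [simp]: "0 \<le> gauss x" "\<bar>gauss x\<bar> \<le> 1"
  by (auto simp: gauss_def)

lemma gauss_measurable [measurable]: "gauss \<in> borel_measurable borel"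
  unfolding gauss_def[abs_def] by measurable

lemma gauss_prod: "complex_of_real (gauss x) = (\<Prod>b\<in>Basis. complex_of_real (exp (- (x \<bullet> b)\<^sup>2 / 2)))"
proof -
  have "gauss x = exp (\<Sum>b\<in>Basis. - (x \<bullet> b)\<^sup>2 / 2)"
    unfolding gauss_def power2_norm_eq_inner euclidean_inner[of x x]
    by (simp add: sum_negf sum_divide_distrib power2_eq_square)
  also have "\<dots> = (\<Prod>b\<in>Basis. exp (- (x \<bullet> b)\<^sup>2 / 2))"
    by (rule exp_sum) simp
  finally show ?thesis by simp
qed

text \<open>Up to the factor sqrt (2 pi) this is the characteristic function of the standard normal
  distribution.\<close>

lemma gauss_fourier_1:
  shows "integrable lborel (\<lambda>x::real. iexp (t * x) * complex_of_real (exp (- x\<^sup>2 / 2)))"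
    and "(LBINT x. iexp (t * x) * complex_of_real (exp (- x\<^sup>2 / 2))) =
      complex_of_real (sqrt (2 * pi) * exp (- t\<^sup>2 / 2))"
proof -
  have eq: "std_normal_density x = exp (- x\<^sup>2 / 2) / sqrt (2 * pi)" for x
    by (simp add: normal_density_def)
  have "integrable lborel (\<lambda>x. complex_of_real (sqrt (2 * pi) * std_normal_density x))"
    by simp
  then have i: "integrable lborel (\<lambda>x::real. complex_of_real (exp (- x\<^sup>2 / 2)))"
    by (simp add: eq)
  show "integrable lborel (\<lambda>x::real. iexp (t * x) * complex_of_real (exp (- x\<^sup>2 / 2)))"
    by (rule integrable_bounded_mult[OF i, where B = 1]) auto
  have "complex_of_real (exp (- t\<^sup>2 / 2)) = (LINT x|density lborel std_normal_density. iexp (t * x))"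
    using char_std_normal_distribution unfolding char_def by metis
  also have "\<dots> = (LBINT x. std_normal_density x *\<^sub>R iexp (t * x))"
    by (subst integral_density) (auto simp: normal_density_nonneg)
  also have "\<dots> = (LBINT x. (iexp (t * x) * complex_of_real (exp (- x\<^sup>2 / 2))) / complex_of_real (sqrt (2 * pi)))"
    by (simp add: eq scaleR_conv_of_real mult.commute)
  also have "\<dots> = (LBINT x. iexp (t * x) * complex_of_real (exp (- x\<^sup>2 / 2))) / complex_of_real (sqrt (2 * pi))"
    by (rule integral_divide_zero)
  finally show "(LBINT x. iexp (t * x) * complex_of_real (exp (- x\<^sup>2 / 2))) =
      complex_of_real (sqrt (2 * pi) * exp (- t\<^sup>2 / 2))"
    unfolding of_real_mult by (subst (asm) nonzero_eq_divide_eq) (simp_all only: mult.commute, simp_all)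
qed

lemma exp_i_inner:
  "iexp (y \<bullet> x) = (\<Prod>b\<in>Basis. iexp ((y \<bullet> b) * (x \<bullet> b)))"
  by (subst euclidean_inner) (simp add: exp_sum sum_distrib_left)

abbreviation gauss_mass :: "'a::euclidean_space itself \<Rightarrow> real" where
  "gauss_mass _ \<equiv> sqrt (2 * pi) ^ DIM('a)"

lemma gauss_fourier:
  fixes y :: "'a::euclidean_space"
  shows integrable_exp_gauss: "integrable lborel (\<lambda>x. iexp (y \<bullet> x) * complex_of_real (gauss x))"
    and integral_exp_gauss: "(LBINT x. iexp (y \<bullet> x) * complex_of_real (gauss x)) =
      complex_of_real (gauss_mass TYPE('a) * gauss y)"
proof -
  have eq: "iexp (y \<bullet> x) * complex_of_real (gauss x) =
    (\<Prod>b\<in>Basis. iexp ((y \<bullet> b) * (x \<bullet> b)) * complex_of_real (exp (- (x \<bullet> b)\<^sup>2 / 2)))" for x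
    unfolding exp_i_inner gauss_prod prod.distrib ..
  show "integrable lborel (\<lambda>x. iexp (y \<bullet> x) * complex_of_real (gauss x))"
    unfolding eq by (rule integrable_lborel_prod[OF gauss_fourier_1(1)])
  show "(LBINT x. iexp (y \<bullet> x) * complex_of_real (gauss x)) =
      complex_of_real (gauss_mass TYPE('a) * gauss y)"
    unfolding eq integral_lborel_prod[OF gauss_fourier_1(1)] gauss_fourier_1(2)
    by (simp add: prod.distrib gauss_prod)
qed

lemma integrable_gauss [simp]: "integrable lborel (gauss :: 'a::euclidean_space \<Rightarrow> real)"
  and integral_gauss: "(LBINT x. gauss (x::'a::euclidean_space)) = gauss_mass TYPE('a)"
proof -
  have "integrable lborel (\<lambda>x::'a. complex_of_real (gauss x))"
    using integrable_exp_gauss[of "0::'a"] by simp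
  then show "integrable lborel (gauss :: 'a \<Rightarrow> real)"
    by (simp only: complex_of_real_integrable_eq)
  have "complex_of_real (LBINT x. gauss (x::'a)) = complex_of_real (gauss_mass TYPE('a))"
    using integral_exp_gauss[of "0::'a"] by (simp add: gauss_def)
  then show "(LBINT x. gauss (x::'a)) = gauss_mass TYPE('a)"
    by (simp only: of_real_eq_iff)
qed

section \<open>Fourier inversion and the norm bound\<close>

lemma integral_exp_gauss_scaled:
  fixes v :: "'a::euclidean_space"
  assumes "0 < c"
  shows "(LBINT \<xi>. iexp (v \<bullet> \<xi>) * complex_of_real (gauss (\<xi> /\<^sub>R c))) =
    complex_of_real (c ^ DIM('a) * gauss_mass TYPE('a) * gauss (c *\<^sub>R v))"
proof -
  have "(LBINT \<xi>. iexp (v \<bullet> \<xi>) * complex_of_real (gauss (\<xi> /\<^sub>R c))) =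
     \<bar>c\<bar> ^ DIM('a) *\<^sub>R (LBINT \<xi>. iexp (v \<bullet> (0 + c *\<^sub>R \<xi>)) * complex_of_real (gauss ((0 + c *\<^sub>R \<xi>) /\<^sub>R c)))"
    by (rule integral_lborel_affine) (use assms in auto)
  also have "\<dots> = c ^ DIM('a) *\<^sub>R (LBINT \<xi>. iexp ((c *\<^sub>R v) \<bullet> \<xi>) * complex_of_real (gauss \<xi>))"
    using assms by simp
  finally show ?thesis
    unfolding integral_exp_gauss by (simp add: scaleR_conv_of_real)
qed

lemma integrable_gauss_affine:
  fixes v :: "'a::euclidean_space"
  shows "c \<noteq> 0 \<Longrightarrow> integrable lborel (\<lambda>x. gauss (v + c *\<^sub>R x))"
  by (rule integrable_lborel_affine[OF integrable_gauss])

lemma integrable_exp_mult: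
  assumes "integrable lborel (g :: 'a::euclidean_space \<Rightarrow> complex)"
  shows "integrable lborel (\<lambda>x. iexp (v \<bullet> x) * g x)"
  by (rule integrable_bounded_mult[OF assms, where B = 1]) auto

text \<open>Damping a transform by a Gaussian of width \<open>c\<close> amounts to averaging
  \<open>g\<close> with a Gaussian kernel of width of order 1 / c. The parameter \<open>e\<close> is
  a sign: -1 in the inversion theorem, where the inner integral is a Fourier transform, and 1 in the
  norm bound.\<close>

lemma damped_fourier:
  fixes g :: "'a::euclidean_space \<Rightarrow> complex"
  assumes g: "integrable lborel g" and c: "0 < c"
  shows "(LBINT \<xi>. iexp (v \<bullet> \<xi>) *
      (complex_of_real (gauss (\<xi> /\<^sub>R c)) * (LBINT x. iexp ((e *\<^sub>R x) \<bullet> \<xi>) * g x))) =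
    (LBINT x. complex_of_real (c ^ DIM('a) * gauss_mass TYPE('a) * gauss (c *\<^sub>R (v + e *\<^sub>R x))) * g x)"
proof -
  let ?F = "\<lambda>\<xi> x. iexp (v \<bullet> \<xi>) *
      (complex_of_real (gauss (\<xi> /\<^sub>R c)) * (iexp ((e *\<^sub>R x) \<bullet> \<xi>) * g x))"
  note [measurable] = borel_measurable_integrable[OF g]
  have "(LBINT \<xi>. iexp (v \<bullet> \<xi>) *
      (complex_of_real (gauss (\<xi> /\<^sub>R c)) * (LBINT x. iexp ((e *\<^sub>R x) \<bullet> \<xi>) * g x))) =
    (LINT \<xi>|lborel. LINT x|lborel. ?F \<xi> x)"
    by simp
  also have "\<dots> = (LINT x|lborel. LINT \<xi>|lborel. ?F \<xi> x)"
  proof (rule Fubini_product_bound[symmetric, OF sigma_finite_lborel sigma_finite_lborel])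
    show "integrable lborel (\<lambda>\<xi>. gauss (0 + inverse c *\<^sub>R \<xi> :: 'a))"
      using c by (intro integrable_gauss_affine) simp
    show "integrable lborel (\<lambda>x. norm (g x))"
      using g by simp
    show "norm (?F \<xi> x) \<le> gauss (0 + inverse c *\<^sub>R \<xi>) * norm (g x)" for \<xi> x
      by (simp add: norm_mult)
  qed measurable
  also have "\<dots> = (LBINT x. (LBINT \<xi>. iexp ((v + e *\<^sub>R x) \<bullet> \<xi>) * complex_of_real (gauss (\<xi> /\<^sub>R c))) * g x)"
    by (simp add: inner_add_left exp_add distrib_left mult_ac flip: integral_mult_left_zero)
  finally show ?thesis
    unfolding integral_exp_gauss_scaled[OF c] .
qed

lemma gauss_damping_tendsto: "(\<lambda>n. gauss (\<xi> /\<^sub>R real (Suc n))) \<longlonglongrightarrow> 1"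
proof -
  have "(\<lambda>n. gauss (inverse (real (Suc n)) *\<^sub>R \<xi>)) \<longlonglongrightarrow> gauss (0 *\<^sub>R \<xi>)"
    unfolding gauss_def
    by (intro tendsto_intros LIMSEQ_inverse_real_of_nat) simp
  then show ?thesis by (simp add: gauss_def)
qed

lemma gauss_damped_integral_tendsto:
  assumes "integrable lborel (k :: 'a::euclidean_space \<Rightarrow> complex)"
  shows "(\<lambda>n. LINT \<xi>|lborel. complex_of_real (gauss (\<xi> /\<^sub>R real (Suc n))) * k \<xi>) \<longlonglongrightarrow> (LBINT \<xi>. k \<xi>)"
proof (rule integral_dominated_convergence[where w = "\<lambda>\<xi>. norm (k \<xi>)"])
  note [measurable] = borel_measurable_integrable[OF assms]
  have "(\<lambda>n. complex_of_real (gauss (\<xi> /\<^sub>R real (Suc n))) * k \<xi>) \<longlonglongrightarrow> complex_of_real 1 * k \<xi>" for \<xi>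
    by (intro tendsto_intros gauss_damping_tendsto)
  then show "AE \<xi> in lborel. (\<lambda>n. complex_of_real (gauss (\<xi> /\<^sub>R real (Suc n))) * k \<xi>) \<longlonglongrightarrow> k \<xi>"
    by simp
  show "AE \<xi> in lborel. norm (complex_of_real (gauss (\<xi> /\<^sub>R real (Suc n))) * k \<xi>) \<le> norm (k \<xi>)" for n
    by (auto simp: norm_mult simp del: of_nat_Suc intro!: AE_I2 mult_left_le_one_le order_trans[OF abs_ge_self gauss_bounds(2)])
qed (use assms in auto)

lemma fourier_const:
  "(2 * pi) powr (- real DIM('a) / 2) = inverse (gauss_mass TYPE('a::euclidean_space))"
proof -
  have "gauss_mass TYPE('a) = sqrt (2 * pi) powr real DIM('a)"
    by (subst powr_realpow) auto
  also have "\<dots> = ((2 * pi) powr (1 / 2)) powr real DIM('a)"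
    by (subst powr_half_sqrt) auto
  also have "\<dots> = (2 * pi) powr (real DIM('a) / 2)"
    by (simp add: powr_powr)
  finally show ?thesis
    by (simp add: powr_minus)
qed

lemma fourier_eq:
  fixes f :: "'a::euclidean_space \<Rightarrow> complex"
  shows "fourier f \<xi> = complex_of_real (inverse (gauss_mass TYPE('a))) *
    (LBINT x. iexp (((- 1) *\<^sub>R x) \<bullet> \<xi>) * f x)"
  unfolding fourier_def fourier_const by (simp add: inner_commute)

lemma inv_fourier_eq:
  fixes f :: "'a::euclidean_space \<Rightarrow> complex"
  shows "inv_fourier f x = complex_of_real (inverse (gauss_mass TYPE('a))) *
    (LBINT \<xi>. iexp (x \<bullet> \<xi>) * f \<xi>)"
  unfolding inv_fourier_def fourier_const by (simp add: inner_commute)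

text \<open>Both sides are limits of the damped integrals \<open>?J n\<close>. Dominated convergence
  leads to the inverse transform; on the other hand \<open>?J n\<close> is a Gaussian average of
  \<open>f\<close> around \<open>x\<close> at scale 1 / (n + 1), which tends to \<open>f x\<close>
  since \<open>f\<close> is continuous and bounded.\<close>

theorem fourier_inversion:
  fixes f :: "'a::euclidean_space \<Rightarrow> complex"
  assumes f: "integrable lborel f" and cont: "continuous_on UNIV f" and bdd: "\<And>x. norm (f x) \<le> K"
    and ff: "integrable lborel (fourier f)"
  shows "inv_fourier (fourier f) x = f x"
proof (rule LIMSEQ_unique)
  let ?m = "complex_of_real (gauss_mass TYPE('a))"
  let ?J = "\<lambda>n. inverse ?m * (LBINT \<xi>. complex_of_real (gauss (\<xi> /\<^sub>R real (Suc n))) *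
    (iexp (x \<bullet> \<xi>) * fourier f \<xi>))"
  note [measurable] = borel_measurable_integrable[OF f]
  show "?J \<longlonglongrightarrow> inv_fourier (fourier f) x"
    unfolding inv_fourier_eq of_real_inverse
    by (intro tendsto_mult tendsto_const gauss_damped_integral_tendsto integrable_exp_mult ff)
  have J: "?J n = inverse ?m * (LBINT w. complex_of_real (gauss w) * f (x + (- inverse (real (Suc n))) *\<^sub>R w))" for n
  proof -
    let ?c = "real (Suc n)"
    have "?J n = inverse ?m * inverse ?m * (LBINT \<xi>. iexp (x \<bullet> \<xi>) *
      (complex_of_real (gauss (\<xi> /\<^sub>R ?c)) * (LBINT z. iexp (((- 1) *\<^sub>R z) \<bullet> \<xi>) * f z)))"
      unfolding fourier_eq of_real_inverse by (simp add: mult_ac flip: integral_mult_right_zero)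
    also have "\<dots> = inverse ?m * inverse ?m * (LBINT z. complex_of_real (?c ^ DIM('a) * gauss_mass TYPE('a) * gauss (?c *\<^sub>R (x + (- 1) *\<^sub>R z))) * f z)"
      by (subst damped_fourier[OF f]) auto
    \<comment> \<open>The substitution z = x - w / (n + 1) makes the Gaussian weight independent of
      n and moves n into the argument of \<open>f\<close>.\<close>
    also have "\<dots> = inverse ?m * inverse ?m * (\<bar>- inverse ?c\<bar> ^ DIM('a) *\<^sub>R (LBINT w. complex_of_real (?c ^ DIM('a) * gauss_mass TYPE('a) * gauss (?c *\<^sub>R (x + (- 1) *\<^sub>R (x + (- inverse ?c) *\<^sub>R w)))) * f (x + (- inverse ?c) *\<^sub>R w)))"
      by (subst integral_lborel_affine[where c = "- inverse ?c" and t = x]) auto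
    also have "\<dots> = inverse ?m * inverse ?m * (\<bar>- inverse ?c\<bar> ^ DIM('a) *\<^sub>R ((complex_of_real (?c ^ DIM('a)) * ?m) * (LBINT w. complex_of_real (gauss w) * f (x + (- inverse ?c) *\<^sub>R w))))"
      by (simp add: mult.assoc del: of_nat_Suc)
    finally show ?thesis
      by (simp add: scaleR_conv_of_real field_simps del: of_nat_Suc)
  qed
  have "(\<lambda>n. LINT w|lborel. complex_of_real (gauss w) * f (x + (- inverse (real (Suc n))) *\<^sub>R w)) \<longlonglongrightarrow>
    (LBINT w. complex_of_real (gauss (w::'a)) * f x)"
  proof (rule integral_dominated_convergence[where w = "\<lambda>w::'a. gauss w * K"])
    have "(\<lambda>n. f (x + (- inverse (real (Suc n))) *\<^sub>R w)) \<longlonglongrightarrow> f (x + (- 0) *\<^sub>R w)" for w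
      by (intro continuous_on_tendsto_compose[OF cont] tendsto_intros LIMSEQ_inverse_real_of_nat) auto
    then show "AE w in lborel. (\<lambda>n. complex_of_real (gauss w) * f (x + (- inverse (real (Suc n))) *\<^sub>R w)) \<longlonglongrightarrow> complex_of_real (gauss w) * f x"
      by (intro AE_I2 tendsto_mult tendsto_const) simp
    show "AE w in lborel. norm (complex_of_real (gauss w) * f (x + (- inverse (real (Suc n))) *\<^sub>R w)) \<le> gauss w * K" for n
      by (auto simp: norm_mult intro!: mult_left_mono bdd)
  qed auto
  from tendsto_mult[OF tendsto_const[of "inverse ?m"] this]
  have "?J \<longlonglongrightarrow> inverse ?m * (LBINT w. complex_of_real (gauss (w::'a)) * f x)"
    unfolding J .
  also have "inverse ?m * (LBINT w. complex_of_real (gauss (w::'a)) * f x) = f x"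
    by (simp add: integral_gauss)
  finally show "?J \<longlonglongrightarrow> f x" .
qed

text \<open>Over a ball, the L1 norm of u = \<open>inv_fourier h\<close> is the pairing of u with
  the bounded function \<open>g\<close>, the conjugate sign of u cut to the ball, and hence a
  pairing of \<open>h\<close> with the transform \<open>G\<close> of \<open>g\<close>. As
  \<open>G\<close> need not be integrable, it is damped by Gaussians: the trigonometric integral of
  the damped \<open>G\<close> is a Gaussian average of \<open>g\<close> times (2 pi)^d, so it is at
  most \<open>?m * ?m\<close>. The bound on \<open>h\<close> applies, the damping is removed in the
  limit, and balls exhaust the space.\<close>

theorem fs_bounded_inv_fourier:
  fixes h :: "'a::euclidean_space \<Rightarrow> complex"
  assumes h: "fs_bounded h B" and int: "integrable lborel h"
  shows "(\<integral>\<^sup>+ x. ennreal (norm (inv_fourier h x)) \<partial>lborel) \<le> ennreal (gauss_mass TYPE('a) * B)"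
proof -
  let ?m = "gauss_mass TYPE('a)"
  let ?u = "inv_fourier h"
  note [measurable] = borel_measurable_integrable[OF int]
  have u[measurable]: "?u \<in> borel_measurable borel"
    unfolding inv_fourier_eq[abs_def] by measurable
  have ubd: "norm (?u x) \<le> inverse ?m * (LBINT \<xi>. norm (h \<xi>))" for x
    unfolding inv_fourier_eq norm_mult
    by (intro mult_mono order_trans[OF integral_norm_bound]) (auto simp: norm_mult norm_inverse norm_power)
  have ball: "(\<integral>\<^sup>+ x. ennreal (norm (?u x)) * indicator (ball 0 R) x \<partial>lborel) \<le> ennreal (?m * B)" for R :: real
  proof -
    define g where "g x = cnj (sgn (?u x)) * indicator (ball 0 R) x" for x
    have [measurable]: "cnj \<in> borel_measurable borel"
      by (intro borel_measurable_continuous_onI continuous_intros)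
    have [measurable]: "ball 0 R \<in> sets (borel :: 'a measure)"
      by simp
    have [measurable]: "g \<in> borel_measurable borel"
      unfolding g_def sgn_div_norm by measurable
    have g1: "norm (g x) \<le> 1" for x
      by (auto simp: g_def norm_mult norm_sgn indicator_def)
    have gi: "integrable lborel g"
    proof (rule Bochner_Integration.integrable_bound)
      show "integrable lborel (indicator (ball 0 R) :: 'a \<Rightarrow> real)"
        using emeasure_lborel_ball_finite[of "0::'a" R] by (intro integrable_real_indicator) auto
    qed (auto simp: g_def norm_mult norm_sgn indicator_def)
    have ug: "?u x * g x = complex_of_real (norm (?u x) * indicator (ball 0 R) x)" for x
      by (auto simp: g_def indicator_def sgn_div_norm scaleR_conv_of_real divide_simps complex_norm_square[symmetric] power2_eq_square)
    define G where "G \<xi> = (LBINT x. iexp ((1 *\<^sub>R x) \<bullet> \<xi>) * g x)" for \<xi>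
    have [measurable]: "G \<in> borel_measurable borel" unfolding G_def[abs_def] by measurable
    have Gbd: "norm (G \<xi>) \<le> (LBINT x. norm (g x))" for \<xi>
      unfolding G_def by (intro order_trans[OF integral_norm_bound]) (auto simp: norm_mult)
    have Gh: "integrable lborel (\<lambda>\<xi>. G \<xi> * h \<xi>)"
      by (rule integrable_bounded_mult[OF int _ Gbd]) measurable
    have "(LBINT x. ?u x * g x) = inverse ?m * (LINT x|lborel. LINT \<xi>|lborel. iexp (x \<bullet> \<xi>) * h \<xi> * g x)"
      unfolding inv_fourier_eq mult.assoc[of "complex_of_real (inverse ?m)"]
        integral_mult_right_zero integral_mult_left_zero ..
    also have "(LINT x|lborel. LINT \<xi>|lborel. iexp (x \<bullet> \<xi>) * h \<xi> * g x) =
      (LINT \<xi>|lborel. LINT x|lborel. iexp (x \<bullet> \<xi>) * h \<xi> * g x)"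
      by (rule Fubini_product_bound[OF sigma_finite_lborel sigma_finite_lborel _ integrable_norm[OF int] integrable_norm[OF gi]])
        (auto simp: norm_mult)
    also have "\<dots> = (LINT \<xi>|lborel. LINT x|lborel. iexp ((1 *\<^sub>R x) \<bullet> \<xi>) * g x * h \<xi>)"
      unfolding scaleR_one by (simp only: mult_ac)
    also have "\<dots> = (LBINT \<xi>. G \<xi> * h \<xi>)"
      unfolding G_def integral_mult_left_zero ..
    finally have ugG: "(LBINT x. ?u x * g x) = inverse ?m * (LBINT \<xi>. G \<xi> * h \<xi>)" .
    have "norm (LBINT \<xi>. G \<xi> * h \<xi>) \<le> B * (?m * ?m)"
    proof (rule LIMSEQ_le_const2[OF tendsto_norm[OF gauss_damped_integral_tendsto[OF Gh]]], intro exI allI impI)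
      fix n :: nat
      let ?c = "real (Suc n)"
      have i: "integrable lborel (\<lambda>\<xi>. gauss (0 + inverse ?c *\<^sub>R \<xi> :: 'a))"
        by (rule integrable_gauss_affine) simp
      have "integrable lborel (\<lambda>\<xi>. G \<xi> * complex_of_real (gauss (\<xi> /\<^sub>R ?c)))"
        by (rule integrable_bounded_mult[OF _ _ Gbd]) (use i in auto)
      then have gG: "integrable lborel (\<lambda>\<xi>. complex_of_real (gauss (\<xi> /\<^sub>R ?c)) * G \<xi>)"
        by (simp add: mult.commute)
      have "norm (LBINT \<xi>. iexp (v \<bullet> \<xi>) * (complex_of_real (gauss (\<xi> /\<^sub>R ?c)) * G \<xi>)) \<le> ?m * ?m" for v
      proof -
        have i: "integrable lborel (\<lambda>x. gauss (?c *\<^sub>R v + ?c *\<^sub>R x :: 'a))"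
          by (rule integrable_gauss_affine) simp
        have "norm (LBINT \<xi>. iexp (v \<bullet> \<xi>) * (complex_of_real (gauss (\<xi> /\<^sub>R ?c)) * G \<xi>)) =
          norm (LBINT x. complex_of_real (?c ^ DIM('a) * ?m * gauss (?c *\<^sub>R (v + 1 *\<^sub>R x))) * g x)"
          unfolding G_def by (subst damped_fourier[OF gi]) auto
        also have "\<dots> \<le> (LBINT x. ?c ^ DIM('a) * ?m * gauss (?c *\<^sub>R v + ?c *\<^sub>R x))"
          using i g1 by (intro norm_integral_le_integral) (auto simp: norm_mult scaleR_add_right abs_mult simp del: of_nat_Suc of_real_mult intro!: mult_left_le)
        also have "\<dots> = ?m * (?c ^ DIM('a) * (LBINT x. gauss (?c *\<^sub>R v + ?c *\<^sub>R x :: 'a)))"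
          by simp
        also have "?c ^ DIM('a) * (LBINT x. gauss (?c *\<^sub>R v + ?c *\<^sub>R x :: 'a)) = ?m"
          using integral_lborel_affine[of "gauss :: 'a \<Rightarrow> real" ?c "?c *\<^sub>R v"] integral_gauss[where 'a = 'a] by simp
        finally show ?thesis .
      qed
      from fs_boundedD(4)[OF h gG this]
      show "norm (LBINT \<xi>. complex_of_real (gauss (\<xi> /\<^sub>R ?c)) * (G \<xi> * h \<xi>)) \<le> B * (?m * ?m)"
        by (simp add: mult_ac)
    qed
    then have "norm (LBINT x. ?u x * g x) \<le> inverse ?m * (B * (?m * ?m))"
      unfolding ugG norm_mult by (intro mult_mono) (auto simp: norm_inverse norm_power)
    also have "\<dots> = ?m * B" by simp
    finally have le: "norm (LBINT x. ?u x * g x) \<le> ?m * B" .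
    have uint: "integrable lborel (\<lambda>x. norm (?u x) * indicator (ball 0 R) x)"
    proof -
      have "integrable lborel (\<lambda>x. ?u x * g x)"
        by (rule integrable_bounded_mult[OF gi _ ubd]) measurable
      then show ?thesis unfolding ug by (simp only: complex_of_real_integrable_eq)
    qed
    have "(LBINT x. norm (?u x) * indicator (ball 0 R) x) \<le> ?m * B"
      using le unfolding ug integral_complex_of_real by simp
    then have "ennreal (LBINT x. norm (?u x) * indicator (ball 0 R) x) \<le> ennreal (?m * B)"
      by (rule ennreal_leI)
    then show ?thesis
      by (subst (asm) nn_integral_eq_integral[OF uint, symmetric]) (auto simp: ennreal_mult' ennreal_indicator)
  qed
  have "(\<integral>\<^sup>+ x. ennreal (norm (?u x)) \<partial>lborel) = (\<integral>\<^sup>+ x. (SUP n. ennreal (norm (?u x)) * indicator (ball 0 (real n)) x) \<partial>lborel)"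
  proof (intro nn_integral_cong)
    fix x :: 'a
    obtain n :: nat where "norm x < real n" using reals_Archimedean2 by blast
    then show "ennreal (norm (?u x)) = (SUP n. ennreal (norm (?u x)) * indicator (ball 0 (real n)) x)"
      by (intro antisym SUP_upper2[of n] SUP_least) (auto simp: indicator_def)
  qed
  also have "\<dots> = (SUP n. \<integral>\<^sup>+ x. ennreal (norm (?u x)) * indicator (ball 0 (real n)) x \<partial>lborel)"
    by (rule nn_integral_monotone_convergence_SUP) (auto simp: incseq_def le_fun_def indicator_def)
  also have "\<dots> \<le> ennreal (?m * B)"
    by (intro SUP_least ball)
  finally show ?thesis .
qed

section \<open>Hat functions and a local linear function\<close>

definition hat :: "real \<Rightarrow> real" where
  "hat s = max 0 (1 - \<bar>s\<bar>)"

lemma hat_measurable [measurable]: "hat \<in> borel_measurable borel"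
  unfolding hat_def[abs_def] by measurable

lemma continuous_on_hat: "continuous_on A hat"
  unfolding hat_def[abs_def] by (intro continuous_intros)

lemma hat_le_indicator: "\<bar>hat s\<bar> \<le> indicator {-1..1} s"
  by (auto simp: hat_def indicator_def)

lemma integrable_hat: "integrable lborel (\<lambda>s. complex_of_real (hat s))"
proof (rule Bochner_Integration.integrable_bound)
  show "integrable lborel (indicator {-1..1::real} :: real \<Rightarrow> real)"
    by (intro integrable_real_indicator) auto
qed (auto intro!: AE_I2 order_trans[OF hat_le_indicator])

text \<open>The bare integral is at most 2, and by explicit integration at most 4 / x^2; together
  these give 8 / (1 + x^2). The factor (2 pi)^(-1/2), at most 1/2, turns 8 into 4.\<close>

lemma fourier_hat_bound: "norm (fourier (\<lambda>s. complex_of_real (hat s)) x) \<le> 4 * inverse (1 + x\<^sup>2)"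
proof -
  define T where "T = (LBINT s. iexp (- s * x) * complex_of_real (hat s))"
  have T2: "norm T \<le> 2"
  proof -
    have "norm T \<le> (LBINT s. indicator {-1..1::real} s)"
      unfolding T_def
    proof (rule norm_integral_le_integral)
      show "integrable lborel (indicator {-1..1::real} :: real \<Rightarrow> real)"
        by (intro integrable_real_indicator) auto
    qed (auto simp: norm_mult intro: hat_le_indicator)
    then show ?thesis by simp
  qed
  have Tx: "norm T \<le> 4 / x\<^sup>2" if "x \<noteq> 0"
  proof -
    define \<alpha> where "\<alpha> = - \<i> * complex_of_real x"
    have \<alpha>: "\<alpha> \<noteq> 0" using that by (simp add: \<alpha>_def)
    have e: "iexp (- s * x) = exp (\<alpha> * complex_of_real s)" for s
      by (simp add: \<alpha>_def mult_ac)
    \<comment> \<open>The primitives come from integration by parts on each half of the support.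
      Their boundary terms of order 1 / \<alpha> at 0 cancel in the sum, which leaves a numerator
      bounded by 4 over \<alpha>^2.\<close>
    have F1: "has_bochner_integral lborel (\<lambda>s. indicator {0..1} s *\<^sub>R ((1 - complex_of_real s) * exp (\<alpha> * complex_of_real s)))
       (((1 - complex_of_real 1) * exp (\<alpha> * complex_of_real 1) / \<alpha> + exp (\<alpha> * complex_of_real 1) / \<alpha>\<^sup>2) -
        ((1 - complex_of_real 0) * exp (\<alpha> * complex_of_real 0) / \<alpha> + exp (\<alpha> * complex_of_real 0) / \<alpha>\<^sup>2))"
    proof (intro has_bochner_integral_FTC_Icc
        has_vector_derivative_real_field[where f = "\<lambda>z. (1 - z) * exp (\<alpha> * z) / \<alpha> + exp (\<alpha> * z) / \<alpha>\<^sup>2"])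
      show "((\<lambda>z. (1 - z) * exp (\<alpha> * z) / \<alpha> + exp (\<alpha> * z) / \<alpha>\<^sup>2) has_field_derivative (1 - z) * exp (\<alpha> * z)) (at z)" for z
        using \<alpha> by (auto intro!: derivative_eq_intros simp: power2_eq_square divide_simps)
    qed (auto intro!: continuous_intros)
    have F2: "has_bochner_integral lborel (\<lambda>s. indicator {-1..0} s *\<^sub>R ((1 + complex_of_real s) * exp (\<alpha> * complex_of_real s)))
       (((1 + complex_of_real 0) * exp (\<alpha> * complex_of_real 0) / \<alpha> - exp (\<alpha> * complex_of_real 0) / \<alpha>\<^sup>2) -
        ((1 + complex_of_real (-1)) * exp (\<alpha> * complex_of_real (-1)) / \<alpha> - exp (\<alpha> * complex_of_real (-1)) / \<alpha>\<^sup>2))"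
    proof (intro has_bochner_integral_FTC_Icc
        has_vector_derivative_real_field[where f = "\<lambda>z. (1 + z) * exp (\<alpha> * z) / \<alpha> - exp (\<alpha> * z) / \<alpha>\<^sup>2"])
      show "((\<lambda>z. (1 + z) * exp (\<alpha> * z) / \<alpha> - exp (\<alpha> * z) / \<alpha>\<^sup>2) has_field_derivative (1 + z) * exp (\<alpha> * z)) (at z)" for z
        using \<alpha> by (auto intro!: derivative_eq_intros simp: power2_eq_square divide_simps)
    qed (auto intro!: continuous_intros)
    have "T = (LBINT s. indicator {0..1} s *\<^sub>R ((1 - complex_of_real s) * exp (\<alpha> * complex_of_real s)) +
        indicator {-1..0} s *\<^sub>R ((1 + complex_of_real s) * exp (\<alpha> * complex_of_real s)))"
      unfolding T_def e
    proof (rule integral_cong_AE)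
      \<comment> \<open>At s = 0 both indicators are 1, so the two integrands differ at this one
        point.\<close>
      show "AE s in lborel. exp (\<alpha> * complex_of_real s) * complex_of_real (hat s) =
          indicator {0..1} s *\<^sub>R ((1 - complex_of_real s) * exp (\<alpha> * complex_of_real s)) +
          indicator {-1..0} s *\<^sub>R ((1 + complex_of_real s) * exp (\<alpha> * complex_of_real s))"
        using AE_lborel_singleton[of "0::real"]
        by eventually_elim (auto simp: hat_def indicator_def max_def)
    qed auto
    also have "\<dots> = (exp \<alpha> + exp (- \<alpha>) - 2) / \<alpha>\<^sup>2"
      using has_bochner_integral_integral_eq[OF has_bochner_integral_add[OF F1 F2]] by (simp add: diff_divide_distrib add_divide_distrib)
    also have "norm \<dots> \<le> 4 / x\<^sup>2"
    proof -
      have "norm (exp \<alpha> + exp (- \<alpha>) - 2) \<le> (1 + 1) + 2"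
        by (intro norm_triangle_le_diff norm_triangle_le add_mono) (auto simp: \<alpha>_def norm_exp_eq_Re)
      then show ?thesis by (simp add: norm_divide norm_power \<alpha>_def norm_mult divide_right_mono)
    qed
    finally show ?thesis .
  qed
  have T8: "norm T \<le> 8 * inverse (1 + x\<^sup>2)"
  proof (cases "\<bar>x\<bar> \<le> 1")
    case True
    then have "1 + x\<^sup>2 \<le> 2" by (simp add: abs_square_le_1)
    then have "2 \<le> 8 * inverse (1 + x\<^sup>2)"
      by (simp add: field_simps add_pos_nonneg)
    then show ?thesis using T2 by linarith
  next
    case False
    then have "1 \<le> x\<^sup>2" "x \<noteq> 0" using abs_square_le_1[of x] by auto
    then have "4 / x\<^sup>2 \<le> 8 * inverse (1 + x\<^sup>2)"
      by (simp add: field_simps add_pos_nonneg)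
    then show ?thesis using Tx[OF \<open>x \<noteq> 0\<close>] by linarith
  qed
  have "2 = sqrt 4" by simp
  also have "\<dots> \<le> sqrt (2 * pi)"
    using pi_ge_two by (intro real_sqrt_le_mono) simp
  finally have "inverse (sqrt (2 * pi)) \<le> 1 / 2"
    by (simp add: field_simps)
  then have "inverse (sqrt (2 * pi)) * norm T \<le> 1 / 2 * (8 * inverse (1 + x\<^sup>2))"
    by (intro mult_mono T8) auto
  then show ?thesis
    unfolding fourier_eq T_def by (simp add: norm_mult norm_inverse)
qed

lemma integrable_fourier_hat: "integrable lborel (fourier (\<lambda>s. complex_of_real (hat s)))"
proof (rule Bochner_Integration.integrable_bound)
  have "integrable lborel (\<lambda>x::real. indicator (einterval (- \<infinity>) \<infinity>) x *\<^sub>R inverse (1 + x\<^sup>2))"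
    using integrable_inverse_1_plus_square unfolding set_integrable_def .
  then have "integrable lborel (\<lambda>x::real. inverse (1 + x\<^sup>2))"
    by simp
  then show "integrable lborel (\<lambda>x::real. 4 * inverse (1 + x\<^sup>2))"
    by (rule integrable_mult_right)
  have "(\<lambda>\<xi>. LINT x|lborel. iexp (((- 1) *\<^sub>R x) \<bullet> \<xi>) * complex_of_real (hat x)) \<in> borel_measurable lborel"
    by measurable
  then show "fourier (\<lambda>s. complex_of_real (hat s)) \<in> borel_measurable lborel"
    unfolding fourier_eq[abs_def] by (rule borel_measurable_times[OF borel_measurable_const])
  show "AE x in lborel. norm (fourier (\<lambda>s. complex_of_real (hat s)) x) \<le> norm (4 * inverse (1 + x\<^sup>2))"
  proof (rule AE_I2)
    fix x :: real
    have "0 \<le> 4 * inverse (1 + x\<^sup>2)" by simp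
    with fourier_hat_bound[of x] show "norm (fourier (\<lambda>s. complex_of_real (hat s)) x) \<le> norm (4 * inverse (1 + x\<^sup>2))"
      by (simp only: real_norm_def abs_of_nonneg)
  qed
qed

lemma hat_eq: "complex_of_real (hat s) = inv_fourier (fourier (\<lambda>s. complex_of_real (hat s))) s"
proof (rule fourier_inversion[symmetric, OF integrable_hat _ _ integrable_fourier_hat])
  show "continuous_on UNIV (\<lambda>s. complex_of_real (hat s))"
    by (intro continuous_intros continuous_on_hat)
  show "norm (complex_of_real (hat s)) \<le> 1" for s
    by (simp add: hat_def)
qed

text \<open>By Fourier inversion \<open>hat\<close> is a superposition of characters; this is the
  total mass of the density in that representation.\<close>

definition hat_norm :: real where
  "hat_norm = (LBINT y. norm (inverse (sqrt (2 * pi)) * norm (fourier (\<lambda>s. complex_of_real (hat s)) y)))"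

text \<open>An affine substitution moves the frequency \<open>y\<close> to
  \<open>(y * \<alpha>) *\<^sub>R b\<close> and multiplies the density by a phase, so its mass does
  not change. The bound is therefore the same at every scale, which allows \<delta> to be chosen
  late.\<close>

lemma fs_bounded_hat: "fs_bounded (\<lambda>\<xi>. complex_of_real (hat (\<alpha> * (b \<bullet> \<xi>) + \<beta>))) hat_norm"
proof -
  let ?f = "fourier (\<lambda>s. complex_of_real (hat s))"
  let ?c = "\<lambda>y. complex_of_real (inverse (sqrt (2 * pi))) * iexp (\<beta> * y) * ?f y"
  note [measurable] = borel_measurable_integrable[OF integrable_fourier_hat]
  have eq: "complex_of_real (hat (\<alpha> * (b \<bullet> \<xi>) + \<beta>)) =
    (LBINT y. ?c y * iexp (((y * \<alpha>) *\<^sub>R b) \<bullet> \<xi>))" for \<xi>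
  proof -
    have "complex_of_real (hat (\<alpha> * (b \<bullet> \<xi>) + \<beta>)) = complex_of_real (inverse (sqrt (2 * pi))) *
      (LBINT y. iexp ((\<alpha> * (b \<bullet> \<xi>) + \<beta>) * y) * ?f y)"
      by (subst hat_eq) (simp add: inv_fourier_eq)
    also have "\<dots> = (LBINT y. complex_of_real (inverse (sqrt (2 * pi))) *
      (iexp ((\<alpha> * (b \<bullet> \<xi>) + \<beta>) * y) * ?f y))"
      by (rule integral_mult_right_zero[symmetric])
    also have "\<dots> = (LBINT y. ?c y * iexp (((y * \<alpha>) *\<^sub>R b) \<bullet> \<xi>))"
    proof (intro Bochner_Integration.integral_cong refl)
      fix y
      have "\<i> * complex_of_real ((\<alpha> * (b \<bullet> \<xi>) + \<beta>) * y) =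
        \<i> * complex_of_real (\<beta> * y) + \<i> * complex_of_real (((y * \<alpha>) *\<^sub>R b) \<bullet> \<xi>)"
        by (simp add: algebra_simps)
      then show "complex_of_real (inverse (sqrt (2 * pi))) *
          (iexp ((\<alpha> * (b \<bullet> \<xi>) + \<beta>) * y) * ?f y) =
        ?c y * iexp (((y * \<alpha>) *\<^sub>R b) \<bullet> \<xi>)"
        by (simp only: exp_add mult_ac)
    qed
    finally show ?thesis .
  qed
  show ?thesis
    unfolding eq hat_norm_def
  proof (rule fs_bounded_parameter[OF sigma_finite_lborel])
    fix y
    have "norm (?c y) \<le> norm (inverse (sqrt (2 * pi)) * norm (?f y))"
      by (simp add: norm_mult norm_inverse)
    from fs_bounded_cmult[OF fs_bounded_char this]
    show "fs_bounded (\<lambda>\<xi>. ?c y * iexp (((y * \<alpha>) *\<^sub>R b) \<bullet> \<xi>))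
      (norm (inverse (sqrt (2 * pi)) * norm (?f y)))"
      by (simp only: mult_1_right)
  next
    show "integrable lborel (\<lambda>y. norm (inverse (sqrt (2 * pi)) * norm (?f y)))"
      by (rule integrable_norm[OF integrable_mult_right[OF integrable_norm[OF integrable_fourier_hat]]])
  qed measurable
qed

lemma hat_norm_nonneg: "0 \<le> hat_norm"
  using fs_boundedD(3)[OF fs_bounded_hat] .

lemma hat_eq_0: "1 \<le> \<bar>s\<bar> \<Longrightarrow> hat s = 0"
  by (simp add: hat_def)

lemma sum_hat:
  assumes "\<bar>s\<bar> \<le> real_of_int m"
  shows "(\<Sum>k\<in>{-m..m}. hat (s - real_of_int k)) = 1"
\<comment> \<open>For s = m the neighbour \<lfloor>s\<rfloor> + 1 falls outside the index range.
  Otherwise the hats at \<lfloor>s\<rfloor> and \<lfloor>s\<rfloor> + 1 are both in range, and all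
  others vanish at s.\<close>
proof (cases "s = real_of_int m")
  case True
  have "(\<Sum>k\<in>{-m..m}. hat (s - real_of_int k)) = (\<Sum>k\<in>{m}. hat (s - real_of_int k))"
    using assms True by (intro sum.mono_neutral_right) (auto intro!: hat_eq_0)
  then show ?thesis using True by (simp add: hat_def)
next
  case False
  let ?n = "\<lfloor>s\<rfloor>"
  have "?n < m" "- m \<le> ?n" using assms False by linarith+
  then have "(\<Sum>k\<in>{-m..m}. hat (s - real_of_int k)) = (\<Sum>k\<in>{?n, ?n + 1}. hat (s - real_of_int k))"
  proof (intro sum.mono_neutral_right ballI)
    fix k assume "k \<in> {-m..m} - {?n, ?n + 1}"
    then have "k \<le> ?n - 1 \<or> ?n + 2 \<le> k" by auto
    then have "1 \<le> \<bar>s - real_of_int k\<bar>" by linarith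
    then show "hat (s - real_of_int k) = 0" by (rule hat_eq_0)
  qed auto
  also have "\<dots> = hat (s - real_of_int ?n) + hat (s - real_of_int (?n + 1))"
    by simp
  also have "hat (s - real_of_int ?n) = 1 - (s - real_of_int ?n)"
  proof -
    have "0 \<le> s - real_of_int ?n" "s - real_of_int ?n \<le> 1" by linarith+
    then show ?thesis unfolding hat_def by simp
  qed
  also have "hat (s - real_of_int (?n + 1)) = 1 + (s - real_of_int (?n + 1))"
  proof -
    have "s - real_of_int (?n + 1) \<le> 0" "-1 \<le> s - real_of_int (?n + 1)" by linarith+
    then show ?thesis unfolding hat_def by simp
  qed
  finally show ?thesis by simp
qed

text \<open>A bounded substitute for the linear function z . (\<xi> - \<open>\<xi>\<^sub>0\<close>):
  hat (s - 1) - hat (s + 1) equals s on [-1, 1] and returns to 0 at s = 2 and s = -2. Rescaling it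
  to slope 1 on a cube of half side \<delta> puts the factor \<delta> in front, and this factor is
  the smallness that the whole argument exploits.\<close>

definition local_linear :: "'a::euclidean_space \<Rightarrow> real \<Rightarrow> 'a \<Rightarrow> 'a \<Rightarrow> real" where
  "local_linear \<xi>\<^sub>0 \<delta> z \<xi> = (\<Sum>b\<in>Basis. (z \<bullet> b) * (\<delta> *
     (hat ((\<xi> - \<xi>\<^sub>0) \<bullet> b / \<delta> - 1) - hat ((\<xi> - \<xi>\<^sub>0) \<bullet> b / \<delta> + 1))))"

lemma local_linear_measurable [measurable]:
  "(\<lambda>(z, \<xi>). local_linear \<xi>\<^sub>0 \<delta> z \<xi>) \<in> borel_measurable (borel \<Otimes>\<^sub>M borel)"
  unfolding local_linear_def by measurable

lemma local_linear_eq: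
  assumes "0 < \<delta>" "\<And>b. b \<in> Basis \<Longrightarrow> \<bar>(\<xi> - \<xi>\<^sub>0) \<bullet> b\<bar> \<le> \<delta>"
  shows "local_linear \<xi>\<^sub>0 \<delta> z \<xi> = z \<bullet> (\<xi> - \<xi>\<^sub>0)"
proof -
  have w: "hat (s - 1) - hat (s + 1) = s" if "\<bar>s\<bar> \<le> 1" for s
    using that by (auto simp: hat_def max_def)
  have "local_linear \<xi>\<^sub>0 \<delta> z \<xi> = (\<Sum>b\<in>Basis. (z \<bullet> b) * ((\<xi> - \<xi>\<^sub>0) \<bullet> b))"
    unfolding local_linear_def
  proof (intro sum.cong refl arg_cong2[of _ _ _ _ "(*)"])
    fix b :: 'a assume "b \<in> Basis"
    then have "\<bar>(\<xi> - \<xi>\<^sub>0) \<bullet> b / \<delta>\<bar> \<le> 1" using assms by simp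
    from w[OF this] show "\<delta> * (hat ((\<xi> - \<xi>\<^sub>0) \<bullet> b / \<delta> - 1) - hat ((\<xi> - \<xi>\<^sub>0) \<bullet> b / \<delta> + 1)) = (\<xi> - \<xi>\<^sub>0) \<bullet> b"
      using assms(1) by simp
  qed
  also have "\<dots> = z \<bullet> (\<xi> - \<xi>\<^sub>0)"
    by (rule euclidean_inner[symmetric])
  finally show ?thesis .
qed

lemma fs_bounded_local_linear:
  fixes \<xi>\<^sub>0 z :: "'a::euclidean_space"
  assumes "0 < \<delta>"
  shows "fs_bounded (\<lambda>\<xi>. \<i> * complex_of_real (local_linear \<xi>\<^sub>0 \<delta> z \<xi>)) (2 * hat_norm * real DIM('a) * \<delta> * norm z)"
proof -
  have h: "fs_bounded (\<lambda>\<xi>. complex_of_real (hat ((\<xi> - \<xi>\<^sub>0) \<bullet> b / \<delta> + c))) hat_norm" for b :: 'a and c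
    using fs_bounded_hat[of "1 / \<delta>" b "c - (\<xi>\<^sub>0 \<bullet> b) / \<delta>"]
    by (simp add: inner_diff_left diff_divide_distrib inner_commute algebra_simps)
  have "fs_bounded (\<lambda>\<xi>. \<Sum>b\<in>Basis. (\<i> * complex_of_real ((z \<bullet> b) * \<delta>)) *
     (complex_of_real (hat ((\<xi> - \<xi>\<^sub>0) \<bullet> b / \<delta> + (- 1))) + (- 1) * complex_of_real (hat ((\<xi> - \<xi>\<^sub>0) \<bullet> b / \<delta> + 1))))
     (\<Sum>b\<in>(Basis::'a set). (norm z * \<delta>) * (hat_norm + 1 * hat_norm))"
    using assms by (intro fs_bounded_sum fs_bounded_cmult fs_bounded_add h)
      (auto simp: norm_mult Basis_le_norm mult_right_mono abs_mult)
  then show ?thesis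
    by (simp add: local_linear_def sum_distrib_left mult_ac)
qed

section \<open>Levy measures and Schwartz functions\<close>

abbreviation levy_weight :: "'a::real_normed_vector \<Rightarrow> real" where
  "levy_weight y \<equiv> min 1 ((norm y)\<^sup>2)"

lemma levy_measureD:
  assumes "levy_measure \<nu>"
  shows "sets \<nu> = sets borel" "space \<nu> = UNIV" "emeasure \<nu> {0} = 0"
    "(\<integral>\<^sup>+ y. ennreal (levy_weight y) \<partial>\<nu>) < \<infinity>"
  using assms sets_eq_imp_space_eq[of \<nu> borel] by (auto simp: levy_measure_def)

lemma borel_measurable_sets_eq:
  "sets \<nu> = sets borel \<Longrightarrow> f \<in> borel_measurable borel \<Longrightarrow> f \<in> borel_measurable \<nu>"
  by (simp only: measurable_cong_sets[OF _ refl, of \<nu> borel])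

lemma levy_integrable_min:
  assumes "levy_measure \<nu>"
  shows "integrable \<nu> (\<lambda>y. levy_weight y)"
  using levy_measureD[OF assms]
  by (intro integrableI_nonneg borel_measurable_sets_eq[OF levy_measureD(1)[OF assms]]) auto

lemma levy_integrable:
  fixes f :: "'a::euclidean_space \<Rightarrow> 'b::{banach, second_countable_topology}"
  assumes "levy_measure \<nu>" "f \<in> borel_measurable borel" "\<And>y. norm (f y) \<le> C * levy_weight y"
  shows "integrable \<nu> f"
proof (rule Bochner_Integration.integrable_bound)
  show "integrable \<nu> (\<lambda>y. C * levy_weight y)"
    using levy_integrable_min[OF assms(1)] by (rule integrable_mult_right)
  show "f \<in> borel_measurable \<nu>"
    by (rule borel_measurable_sets_eq[OF levy_measureD(1)[OF assms(1)] assms(2)])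
  show "AE y in \<nu>. norm (f y) \<le> norm (C * levy_weight y)"
    by (rule AE_I2, rule order_trans[OF assms(3)]) simp
qed

lemma indicator_le_min_sq:
  assumes "0 < \<epsilon>"
  shows "indicator {y. \<epsilon> \<le> norm y} (y::'a::real_normed_vector) \<le> inverse (min 1 (\<epsilon>\<^sup>2)) * levy_weight y"
proof (cases "\<epsilon> \<le> norm y")
  case True
  have p: "0 < min 1 (\<epsilon>\<^sup>2)" using assms by simp
  have "min 1 (\<epsilon>\<^sup>2) \<le> levy_weight y"
    using power_mono[OF True, of 2] assms by (auto simp: min_le_iff_disj)
  then have "inverse (min 1 (\<epsilon>\<^sup>2)) * min 1 (\<epsilon>\<^sup>2) \<le> inverse (min 1 (\<epsilon>\<^sup>2)) * levy_weight y"
    using p by (intro mult_left_mono) simp_all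
  then show ?thesis using True p by simp
qed (use assms in simp)

text \<open>The mass is finite off every neighbourhood of the origin, and the origin itself is a
  null set.\<close>

lemma levy_sigma_finite:
  fixes \<nu> :: "'a::euclidean_space measure"
  assumes "levy_measure \<nu>"
  shows "sigma_finite_measure \<nu>"
proof
  note D = levy_measureD[OF assms]
  let ?A = "\<lambda>n. {y::'a. inverse (real (Suc n)) \<le> norm y}"
  have fin: "emeasure \<nu> (?A n) < \<infinity>" for n
  proof -
    have "integrable \<nu> (indicator (?A n) :: 'a \<Rightarrow> real)"
      by (rule levy_integrable[OF assms, where C = "inverse (min 1 ((inverse (real (Suc n)))\<^sup>2))"])
        (use indicator_le_min_sq[of "inverse (real (Suc n))"] in simp_all)
    then show ?thesis using D by (simp add: integrable_indicator_iff)
  qed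
  show "\<exists>A. countable A \<and> A \<subseteq> sets \<nu> \<and> \<Union> A = space \<nu> \<and> (\<forall>a\<in>A. emeasure \<nu> a \<noteq> \<infinity>)"
  proof (intro exI conjI)
    show "countable (insert {0} (range ?A))" by simp
    have "?A n \<in> sets borel" for n by measurable
    moreover have "{0::'a} \<in> sets borel" by simp
    ultimately show "insert {0} (range ?A) \<subseteq> sets \<nu>" unfolding D(1) by blast
    have "y \<in> \<Union> (insert {0} (range ?A))" for y :: 'a
    proof (cases "y = 0")
      case False
      then obtain n where "inverse (real (Suc n)) < norm y"
        using reals_Archimedean[of "norm y"] by auto
      then show ?thesis by (auto intro: less_imp_le)
    qed simp
    then show "\<Union> (insert {0} (range ?A)) = space \<nu>" using D(2) by blast
    show "\<forall>a\<in>insert {0} (range ?A). emeasure \<nu> a \<noteq> \<infinity>" using less_imp_neq[OF fin] D(3) by auto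
  qed
qed

lemma levy_nn_integral_scaled:
  fixes \<nu> :: "'a::euclidean_space measure"
  assumes "levy_measure \<nu>" "0 < r"
  shows "integrable \<nu> (\<lambda>y. levy_weight (y /\<^sub>R r))"
    and "(\<integral>\<^sup>+ y. ennreal (levy_weight (y /\<^sub>R r)) \<partial>\<nu>) = ennreal (LINT y|\<nu>. levy_weight (y /\<^sub>R r))"
proof -
  show i: "integrable \<nu> (\<lambda>y. levy_weight (y /\<^sub>R r))"
  proof (rule levy_integrable[OF assms(1)])
    fix y :: 'a
    have "(norm (y /\<^sub>R r))\<^sup>2 = (inverse r)\<^sup>2 * (norm y)\<^sup>2"
      using assms(2) by (simp add: power_mult_distrib)
    also have "\<dots> \<le> max 1 ((inverse r)\<^sup>2) * (norm y)\<^sup>2"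
      by (intro mult_right_mono) auto
    finally have "levy_weight (y /\<^sub>R r) \<le> max 1 ((inverse r)\<^sup>2) * (norm y)\<^sup>2" "levy_weight (y /\<^sub>R r) \<le> max 1 ((inverse r)\<^sup>2)"
      by auto
    then show "norm (levy_weight (y /\<^sub>R r)) \<le> max 1 ((inverse r)\<^sup>2) * levy_weight y"
      by (auto simp: min_def)
  qed measurable
  show "(\<integral>\<^sup>+ y. ennreal (levy_weight (y /\<^sub>R r)) \<partial>\<nu>) = ennreal (LINT y|\<nu>. levy_weight (y /\<^sub>R r))"
    by (rule nn_integral_eq_integral[OF i]) simp
qed

abbreviation compensated_exp :: "real \<Rightarrow> complex" where
  "compensated_exp x \<equiv> iexp x - 1 - \<i> * complex_of_real x"

lemma norm_exp_i_minus_1: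
  "norm (iexp x - 1) \<le> \<bar>x\<bar>" "norm (iexp x - 1) \<le> 2"
  using iexp_approx1[of x 0] iexp_approx2[of x 0] by simp_all

lemma norm_exp_i_minus_2: "norm (compensated_exp x) \<le> x\<^sup>2"
proof -
  have "norm (compensated_exp x) \<le> x\<^sup>2 / 2"
    using iexp_approx1[of x 1] by (simp add: diff_diff_eq power2_eq_square)
  then show ?thesis using zero_le_power2[of x] by linarith
qed

lemma levy_kernel_bound:
  fixes y \<xi> :: "'a::real_inner"
  shows "norm (iexp (y \<bullet> \<xi>) - 1 - \<i> * complex_of_real (y \<bullet> \<xi>) * indicator {y. norm y \<le> 1} y)
    \<le> (2 + (norm \<xi>)\<^sup>2) * levy_weight y"
proof (cases "norm y \<le> 1")
  case True
  have "\<bar>y \<bullet> \<xi>\<bar>\<^sup>2 \<le> (norm y * norm \<xi>)\<^sup>2"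
    by (intro power_mono Cauchy_Schwarz_ineq2) simp
  then have "(y \<bullet> \<xi>)\<^sup>2 \<le> (norm \<xi>)\<^sup>2 * (norm y)\<^sup>2"
    by (simp add: power_mult_distrib mult.commute)
  also have "\<dots> \<le> (2 + (norm \<xi>)\<^sup>2) * (norm y)\<^sup>2"
    by (intro mult_right_mono) auto
  finally have "(y \<bullet> \<xi>)\<^sup>2 \<le> (2 + (norm \<xi>)\<^sup>2) * levy_weight y"
    using True by (simp add: abs_square_le_1 min_absorb2)
  then show ?thesis
    using norm_exp_i_minus_2[of "y \<bullet> \<xi>"] True by simp
next
  case False
  then have "levy_weight y = 1"
    using one_le_power[of "norm y" 2] by (simp add: min_absorb1)
  then show ?thesis
    using norm_exp_i_minus_1(2)[of "y \<bullet> \<xi>"] False by (simp add: add_increasing2)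
qed

text \<open>Integrability is by comparison with a tensor product of the functions 1 / (1 + t^2). The
  decay bounds of order 0 and 2d suffice for it, d being the dimension, because (1 + t)^d is at most
  2^d (1 + t^d).\<close>

lemma schwartz_imp:
  fixes \<phi> :: "'a::euclidean_space \<Rightarrow> complex"
  assumes "\<phi> \<in> schwartz"
  shows "continuous_on UNIV \<phi>" "\<exists>K. \<forall>x. norm (\<phi> x) \<le> K" "integrable lborel \<phi>"
proof -
  have diff: "\<phi> differentiable (at x)" for x
    using assms unfolding schwartz_def smooth_fun_def by (auto dest!: bspec[of _ _ "[]"])
  show cont: "continuous_on UNIV \<phi>"
    using diff by (simp add: continuous_at_imp_continuous_on differentiable_imp_continuous_within)
  have bd: "\<exists>K. \<forall>x. norm x ^ k * norm (\<phi> x) \<le> K" for k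
  proof -
    have "bounded (range (\<lambda>x. norm x ^ k * norm (\<phi> x)))"
      using assms unfolding schwartz_def by (auto dest!: spec[of _ k] bspec[of _ _ "[]"])
    then show ?thesis by (auto simp: bounded_iff)
  qed
  from bd[of 0] obtain C0 where C0: "\<And>x. norm (\<phi> x) \<le> C0" by auto
  then show "\<exists>K. \<forall>x. norm (\<phi> x) \<le> K" by blast
  let ?d = "DIM('a)"
  from bd[of "2 * ?d"] obtain C1 where C1: "\<And>x. norm x ^ (2 * ?d) * norm (\<phi> x) \<le> C1" by auto
  have one_plus: "(1 + t) ^ ?d \<le> 2 ^ ?d * (1 + t ^ ?d)" if "0 \<le> t" for t :: real
  proof (cases "t \<le> 1")
    case True
    then have "(1 + t) ^ ?d \<le> 2 ^ ?d" using that by (intro power_mono) auto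
    also have "\<dots> \<le> 2 ^ ?d * (1 + t ^ ?d)" using that by simp
    finally show ?thesis .
  next
    case False
    then have "(1 + t) ^ ?d \<le> (2 * t) ^ ?d" by (intro power_mono) auto
    also have "\<dots> \<le> 2 ^ ?d * (1 + t ^ ?d)" by (simp add: power_mult_distrib)
    finally show ?thesis .
  qed
  have le: "norm (\<phi> x) \<le> 2 ^ ?d * (C0 + C1) * (\<Prod>b\<in>Basis. inverse (1 + (x \<bullet> b)\<^sup>2))" for x
  proof -
    have "(\<Prod>b\<in>(Basis::'a set). 1 + (x \<bullet> b)\<^sup>2) \<le> (\<Prod>b\<in>(Basis::'a set). 1 + (norm x)\<^sup>2)"
    proof (intro prod_mono conjI add_left_mono)
      fix b :: 'a assume "b \<in> Basis"
      then have "\<bar>x \<bullet> b\<bar>\<^sup>2 \<le> (norm x)\<^sup>2" by (intro power_mono Basis_le_norm) auto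
      then show "(x \<bullet> b)\<^sup>2 \<le> (norm x)\<^sup>2" by simp
    qed auto
    also have "\<dots> = (1 + (norm x)\<^sup>2) ^ ?d" by simp
    also have "\<dots> \<le> 2 ^ ?d * (1 + norm x ^ (2 * ?d))"
      using one_plus[of "(norm x)\<^sup>2"] by (simp add: power_mult)
    finally have "norm (\<phi> x) * (\<Prod>b\<in>(Basis::'a set). 1 + (x \<bullet> b)\<^sup>2) \<le> norm (\<phi> x) * (2 ^ ?d * (1 + norm x ^ (2 * ?d)))"
      by (intro mult_left_mono) auto
    also have "\<dots> = 2 ^ ?d * (norm (\<phi> x) + norm x ^ (2 * ?d) * norm (\<phi> x))"
      by (simp add: algebra_simps)
    also have "\<dots> \<le> 2 ^ ?d * (C0 + C1)"
      by (intro mult_left_mono add_mono C0 C1) auto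
    finally have "norm (\<phi> x) * (\<Prod>b\<in>(Basis::'a set). 1 + (x \<bullet> b)\<^sup>2) \<le> 2 ^ ?d * (C0 + C1)" .
    moreover have "0 < (\<Prod>b\<in>(Basis::'a set). 1 + (x \<bullet> b)\<^sup>2)"
      by (intro prod_pos) (auto simp: add_pos_nonneg)
    moreover have "(\<Prod>b\<in>(Basis::'a set). inverse (1 + (x \<bullet> b)\<^sup>2)) = inverse (\<Prod>b\<in>(Basis::'a set). 1 + (x \<bullet> b)\<^sup>2)"
      using prod_inversef[of "\<lambda>b. 1 + (x \<bullet> b)\<^sup>2" "Basis :: 'a set"] by (simp add: comp_def)
    ultimately show ?thesis
      by (simp only: pos_le_divide_eq divide_inverse[symmetric])
  qed
  have i1: "integrable lborel (\<lambda>x::real. complex_of_real (inverse (1 + x\<^sup>2)))"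
    unfolding complex_of_real_integrable_eq
    using integrable_inverse_1_plus_square unfolding set_integrable_def by simp
  have i: "integrable lborel (\<lambda>x::'a. \<Prod>b\<in>Basis. complex_of_real (inverse (1 + (x \<bullet> b)\<^sup>2)))"
    by (rule integrable_lborel_prod[OF i1])
  show "integrable lborel \<phi>"
  proof (rule Bochner_Integration.integrable_bound)
    show "integrable lborel (\<lambda>x::'a. complex_of_real (2 ^ ?d * (C0 + C1)) * (\<Prod>b\<in>Basis. complex_of_real (inverse (1 + (x \<bullet> b)\<^sup>2))))"
      by (rule integrable_mult_right[OF i])
    show "\<phi> \<in> borel_measurable lborel"
      using borel_measurable_continuous_onI[OF cont] by simp
    show "AE x in lborel. norm (\<phi> x) \<le> norm (complex_of_real (2 ^ ?d * (C0 + C1)) * (\<Prod>b\<in>Basis. complex_of_real (inverse (1 + (x \<bullet> b)\<^sup>2))))"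
    proof (rule AE_I2)
      fix x :: 'a
      show "norm (\<phi> x) \<le> norm (complex_of_real (2 ^ ?d * (C0 + C1)) * (\<Prod>b\<in>Basis. complex_of_real (inverse (1 + (x \<bullet> b)\<^sup>2))))"
        using order_trans[OF le[of x] abs_ge_self] by (simp only: norm_of_real flip: of_real_prod of_real_mult)
    qed
  qed
qed

lemma fs_bounded_fourier:
  fixes f :: "'a::euclidean_space \<Rightarrow> complex"
  assumes f: "integrable lborel f"
  shows "fs_bounded (fourier f) (inverse (gauss_mass TYPE('a)) * (LBINT x. 1 * norm (f x)))"
  unfolding fourier_eq[abs_def]
proof (intro fs_bounded_cmult)
  note [measurable] = borel_measurable_integrable[OF f]
  have "fs_bounded (\<lambda>\<xi>. LINT x|lborel. f x * iexp (((- 1) *\<^sub>R x) \<bullet> \<xi>)) (LBINT x. norm (f x) * 1)"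
  proof (rule fs_bounded_parameter[OF sigma_finite_lborel])
    show "fs_bounded (\<lambda>\<xi>. f x * iexp (((- 1) *\<^sub>R x) \<bullet> \<xi>)) (norm (f x) * 1)" for x
      by (intro fs_bounded_cmult fs_bounded_char) simp
    show "integrable lborel (\<lambda>x. norm (f x) * 1)" using f by simp
  qed measurable
  then show "fs_bounded (\<lambda>\<xi>. LINT x|lborel. iexp (((- 1) *\<^sub>R x) \<bullet> \<xi>) * f x) (LBINT x. 1 * norm (f x))"
    by (simp only: mult.commute)
qed (simp add: norm_inverse norm_power)

lemma fs_bounded_integrable_support:
  fixes h :: "'a::euclidean_space \<Rightarrow> complex"
  assumes h: "fs_bounded h B" and supp: "\<And>\<xi>. R \<le> norm \<xi> \<Longrightarrow> h \<xi> = 0"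
  shows "integrable lborel h"
proof -
  have "integrable lborel (\<lambda>\<xi>::'a. complex_of_real (indicator (ball 0 R) \<xi>))"
    using emeasure_lborel_ball_finite[of "0::'a" R]
    by (simp add: complex_of_real_integrable_eq integrable_indicator_iff)
  from fs_bounded_integrable[OF h this] show ?thesis
  proof (rule Bochner_Integration.integrable_cong[THEN iffD1, rotated 2])
    show "h \<xi> * complex_of_real (indicator (ball 0 R) \<xi>) = h \<xi>" for \<xi>
      using supp[of \<xi>] by (auto simp: indicator_def)
  qed simp
qed

section \<open>The operator of a symmetric Levy measure\<close>

text \<open>With l = z . (\<xi> - \<open>\<xi>\<^sub>0\<close>) the difference of the compensated
  exponentials at \<xi> and \<open>\<xi>\<^sub>0\<close> is (exp (i z .
  \<open>\<xi>\<^sub>0\<close>) - 1) (exp (i l) - 1) + (exp (i l) - 1 - i l). Both terms are of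
  second order in z, as integration against a Levy measure requires, and at least of first order in
  l. Putting \<open>local_linear\<close> for l extends this to all \<xi> with a bound on the
  norm.\<close>

definition local_kernel :: "'a::euclidean_space \<Rightarrow> real \<Rightarrow> 'a \<Rightarrow> 'a \<Rightarrow> complex" where
  "local_kernel \<xi>\<^sub>0 \<delta> z \<xi> =
     (iexp (z \<bullet> \<xi>\<^sub>0) - 1) * (iexp (local_linear \<xi>\<^sub>0 \<delta> z \<xi>) - 1) +
     (compensated_exp (local_linear \<xi>\<^sub>0 \<delta> z \<xi>))"

lemma local_kernel_measurable [measurable]:
  "(\<lambda>(z, \<xi>). local_kernel \<xi>\<^sub>0 \<delta> z \<xi>) \<in> borel_measurable (borel \<Otimes>\<^sub>M borel)"
  unfolding local_kernel_def case_prod_beta'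
  using local_linear_measurable[of \<xi>\<^sub>0 \<delta>] unfolding case_prod_beta' by measurable

lemma local_kernel_eq:
  assumes "0 < \<delta>" "\<And>b. b \<in> Basis \<Longrightarrow> \<bar>(\<xi> - \<xi>\<^sub>0) \<bullet> b\<bar> \<le> \<delta>"
  shows "local_kernel \<xi>\<^sub>0 \<delta> z \<xi> = (compensated_exp (z \<bullet> \<xi>)) -
    (compensated_exp (z \<bullet> \<xi>\<^sub>0))"
proof -
  have "iexp (z \<bullet> \<xi>) = iexp (z \<bullet> \<xi>\<^sub>0) * iexp (z \<bullet> (\<xi> - \<xi>\<^sub>0))"
    by (simp add: inner_diff_right algebra_simps flip: exp_add)
  moreover have l: "local_linear \<xi>\<^sub>0 \<delta> z \<xi> = z \<bullet> (\<xi> - \<xi>\<^sub>0)"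
    using assms by (intro local_linear_eq)
  ultimately show ?thesis
    unfolding local_kernel_def l by (simp add: inner_diff_right algebra_simps)
qed

lemma fs_bounded_local_kernel:
  fixes \<xi>\<^sub>0 z :: "'a::euclidean_space"
  assumes "0 < \<delta>" and D: "D = 2 * hat_norm * real DIM('a)"
  shows "fs_bounded (local_kernel \<xi>\<^sub>0 \<delta> z) ((norm z)\<^sup>2 * ((norm \<xi>\<^sub>0 * D * \<delta> + (D * \<delta>)\<^sup>2) * exp (D * \<delta> * norm z)))"
proof -
  let ?P = "D * \<delta> * norm z"
  have p: "fs_bounded (\<lambda>\<xi>. \<i> * complex_of_real (local_linear \<xi>\<^sub>0 \<delta> z \<xi>)) ?P"
    using fs_bounded_local_linear[OF assms(1), of \<xi>\<^sub>0 z] by (simp add: D)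
  have "norm (iexp (z \<bullet> \<xi>\<^sub>0) - 1) \<le> norm z * norm \<xi>\<^sub>0"
    by (rule order_trans[OF norm_exp_i_minus_1(1) Cauchy_Schwarz_ineq2])
  from fs_bounded_add[OF fs_bounded_cmult[OF fs_bounded_exp_minus_1[OF p] this] fs_bounded_exp_minus_2[OF p]]
  have "fs_bounded (local_kernel \<xi>\<^sub>0 \<delta> z) (norm z * norm \<xi>\<^sub>0 * (?P * exp ?P) + ?P\<^sup>2 * exp ?P)"
    unfolding local_kernel_def[abs_def] .
  then show ?thesis
    by (simp add: power2_eq_square algebra_simps)
qed

lemma integral_odd:
  fixes f :: "'a::euclidean_space \<Rightarrow> complex"
  assumes sym: "distr \<mu> borel uminus = \<mu>" and sets: "sets \<mu> = sets borel"
    and f: "f \<in> borel_measurable borel" and odd: "\<And>y. f (- y) = - f y"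
  shows "(LINT y|\<mu>. f y) = 0"
proof -
  have m: "uminus \<in> measurable \<mu> borel"
    by (rule borel_measurable_sets_eq[OF sets]) measurable
  have "(LINT y|\<mu>. f y) = (LINT y|distr \<mu> borel uminus. f y)"
    by (simp only: sym)
  also have "\<dots> = (LINT y|\<mu>. f (- y))"
    by (rule integral_distr[OF m f])
  also have "\<dots> = - (LINT y|\<mu>. f y)"
    by (simp only: odd Bochner_Integration.integral_minus)
  finally show ?thesis
    by (simp add: eq_neg_iff_add_eq_0 flip: mult_2)
qed

lemma levy_integrable_scaled:
  fixes f :: "'a::euclidean_space \<Rightarrow> 'b::{banach, second_countable_topology}"
  assumes "levy_measure \<nu>" "0 < r" "f \<in> borel_measurable borel"
    and "\<And>y. norm (f y) \<le> C * levy_weight (y /\<^sub>R r)"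
  shows "integrable \<nu> f"
proof (rule Bochner_Integration.integrable_bound)
  show "integrable \<nu> (\<lambda>y. C * levy_weight (y /\<^sub>R r))"
    using levy_nn_integral_scaled(1)[OF assms(1,2)] by (rule integrable_mult_right)
  show "f \<in> borel_measurable \<nu>"
    by (rule borel_measurable_sets_eq[OF levy_measureD(1)[OF assms(1)] assms(3)])
  show "AE y in \<nu>. norm (f y) \<le> norm (C * levy_weight (y /\<^sub>R r))"
    by (rule AE_I2, rule order_trans[OF assms(4)]) simp
qed

text \<open>Changing the radius at which the compensator is cut off only adds an odd integrand.\<close>

lemma levy_symbol_scaled:
  fixes \<mu> :: "'a::euclidean_space measure"
  assumes levy: "levy_measure \<mu>" and sym: "distr \<mu> borel uminus = \<mu>" and r: "0 < r"
  shows "levy_symbol \<mu> (\<xi> /\<^sub>R r) = (LINT y|\<mu>. iexp ((y /\<^sub>R r) \<bullet> \<xi>) - 1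
     - \<i> * complex_of_real ((y /\<^sub>R r) \<bullet> \<xi>) * indicator {y. norm y \<le> 1} (y /\<^sub>R r))"
    (is "_ = (LINT y|\<mu>. ?k y)")
proof -
  let ?k' = "\<lambda>y. iexp (y \<bullet> (\<xi> /\<^sub>R r)) - 1
     - \<i> * complex_of_real (y \<bullet> (\<xi> /\<^sub>R r)) * indicator {y. norm y \<le> 1} y"
  have m: "{y::'a. norm y \<le> 1} \<in> sets borel" by measurable
  note [measurable] = m
  have k: "integrable \<mu> ?k"
    by (rule levy_integrable_scaled[OF levy r _ levy_kernel_bound]) measurable
  have k': "integrable \<mu> ?k'"
    by (rule levy_integrable[OF levy _ levy_kernel_bound]) measurable
  have "(LINT y|\<mu>. ?k' y) - (LINT y|\<mu>. ?k y) = (LINT y|\<mu>. ?k' y - ?k y)"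
    by (rule Bochner_Integration.integral_diff[OF k' k, symmetric])
  also have "\<dots> = 0"
    by (rule integral_odd[OF sym levy_measureD(1)[OF levy]]) (measurable, simp add: algebra_simps indicator_def)
  finally show ?thesis
    unfolding levy_symbol_def by simp
qed

text \<open>Here \<delta> is the radius of the support and need not be small: a single cube around 0
  is used. The norm of the kernel at \<open>y /\<^sub>R r\<close> is at most a constant times the
  Levy weight, so the integral over jumps is controlled by \<kappa>, which is of order 1 / s(r) in
  the application.\<close>

lemma levy_operator_bound:
  fixes \<mu> :: "'a::euclidean_space measure"
  assumes levy: "levy_measure \<mu>" and sym: "distr \<mu> borel uminus = \<mu>"
    and r: "0 < r" and \<delta>: "0 < \<delta>" and D: "D = 2 * hat_norm * real DIM('a)"
    and \<phi>: "fs_bounded (fourier \<phi>) B" and supp: "\<And>\<xi>. \<delta> \<le> norm \<xi> \<Longrightarrow> fourier \<phi> \<xi> = 0"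
    and \<kappa>: "(LINT y|\<mu>. levy_weight (y /\<^sub>R r)) \<le> \<kappa>"
  shows "(\<integral>\<^sup>+ x. ennreal (norm (levy_operator \<mu> r \<phi> x)) \<partial>lborel) \<le>
    ennreal (gauss_mass TYPE('a) * ((2 + (D * \<delta>)\<^sup>2 * exp (D * \<delta>)) * \<kappa> * B))"
proof -
  define C where "C = 2 + (D * \<delta>)\<^sup>2 * exp (D * \<delta>)"
  have C: "0 \<le> C" by (simp add: C_def)
  \<comment> \<open>Outside the unit ball there is no compensator and the plain difference has norm
    at most 2, the first term of \<open>C\<close>. Inside, the local kernel centred at 0 gives the
    second term, as its product summand vanishes there.\<close>
  define k where "k z \<xi> = (if norm z \<le> 1 then local_kernel 0 \<delta> z \<xi> else iexp (z \<bullet> \<xi>) - 1)" for z \<xi> :: 'a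
  have kb: "fs_bounded (k z) (C * levy_weight z)" for z
  proof (cases "norm z \<le> 1")
    case True
    have "fs_bounded (local_kernel 0 \<delta> z) ((norm z)\<^sup>2 * ((D * \<delta>)\<^sup>2 * exp (D * \<delta> * norm z)))"
      using fs_bounded_local_kernel[OF \<delta> D, of 0 z] by simp
    moreover have "(norm z)\<^sup>2 * ((D * \<delta>)\<^sup>2 * exp (D * \<delta> * norm z)) \<le> (norm z)\<^sup>2 * C"
    proof (intro mult_left_mono)
      have "0 \<le> D * \<delta>" using \<delta> hat_norm_nonneg by (simp add: D)
      from mult_left_le[OF True this] have "exp (D * \<delta> * norm z) \<le> exp (D * \<delta>)"
        by simp
      then have "(D * \<delta>)\<^sup>2 * exp (D * \<delta> * norm z) \<le> (D * \<delta>)\<^sup>2 * exp (D * \<delta>)"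
        by (intro mult_left_mono) auto
      then show "(D * \<delta>)\<^sup>2 * exp (D * \<delta> * norm z) \<le> C" unfolding C_def by simp
    qed simp
    moreover have "levy_weight z = (norm z)\<^sup>2"
      using True by (simp add: min_absorb2 power_le_one)
    ultimately show ?thesis
      using True by (auto simp: k_def[abs_def] mult.commute intro: fs_bounded_mono)
  next
    case False
    have "fs_bounded (\<lambda>\<xi>. iexp (z \<bullet> \<xi>) + (- 1)) (1 + norm (- 1 :: complex))"
      by (intro fs_bounded_add fs_bounded_char fs_bounded_const)
    moreover have "levy_weight z = 1"
      using False one_le_power[of "norm z" 2] by simp
    ultimately show ?thesis
      using False by (auto simp: k_def[abs_def] C_def intro: fs_bounded_mono)
  qed
  have km: "(\<lambda>(z, \<xi>). k z \<xi>) \<in> borel_measurable (borel \<Otimes>\<^sub>M borel)"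
    unfolding k_def case_prod_beta' using local_kernel_measurable[of 0 \<delta>, unfolded case_prod_beta'] by measurable
  define S where "S \<xi> = (LINT y|\<mu>. k (y /\<^sub>R r) \<xi>)" for \<xi>
  have "fs_bounded S (LINT y|\<mu>. C * levy_weight (y /\<^sub>R r))"
    unfolding S_def[abs_def]
  proof (rule fs_bounded_parameter[OF levy_sigma_finite[OF levy] kb])
    have "(\<lambda>(y, \<xi>). (y /\<^sub>R r, \<xi>)) \<in> \<mu> \<Otimes>\<^sub>M borel \<rightarrow>\<^sub>M (borel :: 'a measure) \<Otimes>\<^sub>M (borel :: 'a measure)"
      using levy_measureD(1)[OF levy] by (subst measurable_cong_sets[OF sets_pair_measure_cong[OF levy_measureD(1)[OF levy] refl] refl]) measurable
    from measurable_compose[OF this km] show "(\<lambda>(y, \<xi>). k (y /\<^sub>R r) \<xi>) \<in> borel_measurable (\<mu> \<Otimes>\<^sub>M borel)"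
      by (simp add: case_prod_beta')
    show "integrable \<mu> (\<lambda>y. C * levy_weight (y /\<^sub>R r))"
      by (rule integrable_mult_right[OF levy_nn_integral_scaled(1)[OF levy r]])
  qed
  then have "fs_bounded S (C * \<kappa>)"
    by (rule fs_bounded_mono) (use C \<kappa> in \<open>simp add: mult_left_mono\<close>)
  from fs_bounded_mult[OF this \<phi>] have SB: "fs_bounded (\<lambda>\<xi>. S \<xi> * fourier \<phi> \<xi>) (C * \<kappa> * B)" .
  have eq: "(\<lambda>\<xi>. levy_symbol \<mu> (\<xi> /\<^sub>R r) * fourier \<phi> \<xi>) = (\<lambda>\<xi>. S \<xi> * fourier \<phi> \<xi>)"
  proof
    fix \<xi> :: 'a
    show "levy_symbol \<mu> (\<xi> /\<^sub>R r) * fourier \<phi> \<xi> = S \<xi> * fourier \<phi> \<xi>"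
    proof (cases "\<delta> \<le> norm \<xi>")
      case False
      then have "\<bar>(\<xi> - 0) \<bullet> b\<bar> \<le> \<delta>" if "b \<in> Basis" for b
        using Basis_le_norm[OF that, of \<xi>] by simp
      then have "local_kernel 0 \<delta> z \<xi> = compensated_exp (z \<bullet> \<xi>)" for z
        using local_kernel_eq[OF \<delta>, of \<xi> 0 z] by simp
      then have "k z \<xi> = iexp (z \<bullet> \<xi>) - 1 - \<i> * complex_of_real (z \<bullet> \<xi>) * indicator {y. norm y \<le> 1} z" for z
        by (auto simp: k_def)
      then show ?thesis
        unfolding levy_symbol_scaled[OF levy sym r] S_def by simp
    qed (simp add: supp)
  qed
  have "integrable lborel (\<lambda>\<xi>. S \<xi> * fourier \<phi> \<xi>)"
    by (rule fs_bounded_integrable_support[OF SB, of \<delta>]) (simp add: supp)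
  from fs_bounded_inv_fourier[OF SB this] show ?thesis
    unfolding levy_operator_def eq C_def .
qed

section \<open>Integration against the symmetrized measure\<close>

lemma nn_integral_symmetrized:
  fixes \<nu> :: "'a::euclidean_space measure"
  assumes sets: "sets \<nu> = sets borel" and f: "f \<in> borel_measurable borel"
  shows "(\<integral>\<^sup>+ y. f y \<partial>symmetrized \<nu>) = ((\<integral>\<^sup>+ y. f y \<partial>\<nu>) + (\<integral>\<^sup>+ y. f (- y) \<partial>\<nu>)) / 2"
  using f
proof (induction f rule: borel_measurable_induct)
  case (cong f g)
  then show ?case by (simp add: fun_eq_iff cong: nn_integral_cong)
next
  case (set A)
  have vim: "uminus -` A = uminus ` A"
    by (force simp: image_iff intro: bexI[where x = "- _"])
  have [measurable]: "uminus \<in> measurable \<nu> borel"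
    by (rule borel_measurable_sets_eq[OF sets]) measurable
  have "uminus -` A \<inter> space \<nu> \<in> sets \<nu>" using set by measurable
  then have mA: "uminus ` A \<in> sets \<nu>"
    using sets_eq_imp_space_eq[OF sets] by (simp add: vim)
  have "(\<integral>\<^sup>+ y. indicator A (- y) \<partial>\<nu>) = (\<integral>\<^sup>+ y. indicator (uminus ` A) y \<partial>\<nu>)"
    by (intro nn_integral_cong) (auto simp: indicator_def vim[symmetric])
  then show ?case
    using set mA sets by (simp add: emeasure_symmetrized)
next
  case (mult u c)
  have "(\<lambda>y. u (- y)) \<in> borel_measurable \<nu>" "u \<in> borel_measurable \<nu>"
    "u \<in> borel_measurable (symmetrized \<nu>)"
    by (rule borel_measurable_sets_eq[OF sets] borel_measurable_sets_eq[OF sets_symmetrized], use mult in measurable)+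
  then show ?case
    using mult by (simp add: nn_integral_cmult distrib_left ennreal_times_divide)
next
  case (add u v)
  have "(\<lambda>y. u (- y)) \<in> borel_measurable \<nu>" "u \<in> borel_measurable \<nu>"
    "(\<lambda>y. v (- y)) \<in> borel_measurable \<nu>" "v \<in> borel_measurable \<nu>"
    "u \<in> borel_measurable (symmetrized \<nu>)" "v \<in> borel_measurable (symmetrized \<nu>)"
    by (rule borel_measurable_sets_eq[OF sets] borel_measurable_sets_eq[OF sets_symmetrized], use add in measurable)+
  then show ?case
    using add by (simp add: nn_integral_add divide_ennreal_def algebra_simps)
next
  case (seq U)
  have m: "(\<lambda>y. U i (- y)) \<in> borel_measurable \<nu>" "U i \<in> borel_measurable \<nu>"
    "U i \<in> borel_measurable (symmetrized \<nu>)" for i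
    by (rule borel_measurable_sets_eq[OF sets] borel_measurable_sets_eq[OF sets_symmetrized], use seq in measurable)+
  have inc: "incseq (\<lambda>i y. U i (- y))"
    using seq by (auto simp: incseq_def le_fun_def)
  have SUP_U: "(SUP i. U i) = (\<lambda>y. SUP i. U i y)"
    by (rule ext) (rule SUP_apply)
  have "(\<integral>\<^sup>+ y. (SUP i. U i) y \<partial>symmetrized \<nu>) = (SUP i. \<integral>\<^sup>+ y. U i y \<partial>symmetrized \<nu>)"
    using seq m unfolding SUP_U by (intro nn_integral_monotone_convergence_SUP)
  also have "\<dots> = (SUP i. ((\<integral>\<^sup>+ y. U i y \<partial>\<nu>) + (\<integral>\<^sup>+ y. U i (- y) \<partial>\<nu>)) / 2)"
    using seq by simp
  also have "\<dots> = (SUP i. (\<integral>\<^sup>+ y. U i y \<partial>\<nu>) + (\<integral>\<^sup>+ y. U i (- y) \<partial>\<nu>)) / 2"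
    unfolding divide_ennreal_def by (rule SUP_mult_right_ennreal[symmetric])
  also have "(SUP i. (\<integral>\<^sup>+ y. U i y \<partial>\<nu>) + (\<integral>\<^sup>+ y. U i (- y) \<partial>\<nu>)) =
      (SUP i. \<integral>\<^sup>+ y. U i y \<partial>\<nu>) + (SUP i. \<integral>\<^sup>+ y. U i (- y) \<partial>\<nu>)"
    using seq inc by (intro ennreal_SUP_add incseq_nn_integral) auto
  also have "(SUP i. \<integral>\<^sup>+ y. U i y \<partial>\<nu>) = (\<integral>\<^sup>+ y. (SUP i. U i) y \<partial>\<nu>)"
    using seq m unfolding SUP_U by (intro nn_integral_monotone_convergence_SUP[symmetric])
  also have "(SUP i. \<integral>\<^sup>+ y. U i (- y) \<partial>\<nu>) = (\<integral>\<^sup>+ y. (SUP i. U i) (- y) \<partial>\<nu>)"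
    using inc m unfolding SUP_U by (intro nn_integral_monotone_convergence_SUP[symmetric])
  finally show ?case .
qed

lemma symmetrized_symmetric:
  fixes \<nu> :: "'a::euclidean_space measure"
  assumes "sets \<nu> = sets borel"
  shows "distr (symmetrized \<nu>) borel uminus = symmetrized \<nu>"
proof (rule measure_eqI)
  fix A assume "A \<in> sets (distr (symmetrized \<nu>) borel uminus)"
  then have A: "A \<in> sets borel" by simp
  have vim: "uminus -` A = uminus ` A"
    by (force simp: image_iff intro: bexI[where x = "- _"])
  have um[measurable]: "uminus \<in> measurable borel (borel :: 'a measure)" by measurable
  have "uminus -` A \<inter> space borel \<in> sets borel" using A by measurable
  then have mA: "uminus ` A \<in> sets borel" by (simp add: vim)
  have sp: "space (symmetrized \<nu>) = UNIV"
    using sets_eq_imp_space_eq[OF sets_symmetrized] by simp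
  have "emeasure (distr (symmetrized \<nu>) borel uminus) A = emeasure (symmetrized \<nu>) (uminus -` A \<inter> space (symmetrized \<nu>))"
    by (rule emeasure_distr[OF borel_measurable_sets_eq[OF sets_symmetrized um] A])
  also have "\<dots> = emeasure (symmetrized \<nu>) A"
    using A mA assms by (simp add: vim sp emeasure_symmetrized image_image add.commute)
  finally show "emeasure (distr (symmetrized \<nu>) borel uminus) A = emeasure (symmetrized \<nu>) A" .
qed simp

section \<open>Measures dominating another one\<close>

text \<open>Dilations preserve the norm: substituting r \<xi> for \<xi> turns \<open>g\<close> into
  \<open>g'\<close>, whose trigonometric integral at x is that of \<open>g\<close> at x / r, so the
  same \<open>S\<close> bounds both.\<close>

lemma fs_bounded_scale:
  fixes h :: "'a::euclidean_space \<Rightarrow> complex"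
  assumes h: "fs_bounded h B" and r: "0 < r"
  shows "fs_bounded (\<lambda>\<xi>. h (\<xi> /\<^sub>R r)) B"
proof (rule fs_boundedI)
  note [measurable] = fs_boundedD(1)[OF h]
  show "(\<lambda>\<xi>. h (\<xi> /\<^sub>R r)) \<in> borel_measurable borel" by measurable
  show "norm (h (\<xi> /\<^sub>R r)) \<le> B" for \<xi> by (rule fs_boundedD[OF h])
  fix g :: "'a \<Rightarrow> complex" and S
  assume g: "integrable lborel g"
    and S: "\<And>x. norm (trig_integral g x) \<le> S"
  note [measurable] = borel_measurable_integrable[OF g]
  define g' where "g' \<xi> = complex_of_real (r ^ DIM('a)) * g (0 + r *\<^sub>R \<xi>)" for \<xi>
  have g': "integrable lborel g'"
    unfolding g'_def using r by (intro integrable_mult_right integrable_lborel_affine[OF g]) simp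
  have eq: "(LBINT \<xi>. f \<xi> * g \<xi>) = (LBINT \<xi>. f (r *\<^sub>R \<xi>) * g' \<xi>)"
    if [measurable]: "f \<in> borel_measurable borel" for f :: "'a \<Rightarrow> complex"
  proof -
    have "(LBINT \<xi>. f \<xi> * g \<xi>) = \<bar>r\<bar> ^ DIM('a) *\<^sub>R (LBINT \<xi>. f (0 + r *\<^sub>R \<xi>) * g (0 + r *\<^sub>R \<xi>))"
      by (rule integral_lborel_affine) (use r in auto)
    also have "\<dots> = (LBINT \<xi>. f (r *\<^sub>R \<xi>) * g' \<xi>)"
      using r unfolding g'_def mult.left_commute[of "f _"] integral_mult_right_zero
      by (simp add: scaleR_conv_of_real)
    finally show ?thesis .
  qed
  have S': "norm (LBINT \<xi>. iexp (x \<bullet> \<xi>) * g' \<xi>) \<le> S" for x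
  proof -
    have "(LBINT \<xi>. iexp ((x /\<^sub>R r) \<bullet> \<xi>) * g \<xi>) =
      (LBINT \<xi>. iexp ((x /\<^sub>R r) \<bullet> (r *\<^sub>R \<xi>)) * g' \<xi>)"
      by (rule eq) measurable
    moreover have "(x /\<^sub>R r) \<bullet> (r *\<^sub>R \<xi>) = x \<bullet> \<xi>" for \<xi>
      using r by simp
    ultimately show ?thesis using S[of "x /\<^sub>R r"] by (simp only:)
  qed
  have "(LBINT \<xi>. h (\<xi> /\<^sub>R r) * g \<xi>) = (LBINT \<xi>. h ((r *\<^sub>R \<xi>) /\<^sub>R r) * g' \<xi>)"
    by (rule eq) measurable
  then show "norm (LBINT \<xi>. h (\<xi> /\<^sub>R r) * g \<xi>) \<le> B * S"
    using fs_boundedD(4)[OF h g' S'] r by simp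
qed

text \<open>Rounding \<xi> down to the grid of mesh 1 / (n + 1) leaves countably many values, for
  each of which measurability in \<open>u\<close> suffices; continuity in \<xi> carries this to the
  limit. It is needed because a measurable family of Levy measures only provides measurability in
  time for one integrand at a time.\<close>

lemma caratheodory_measurable:
  fixes F :: "'b \<Rightarrow> 'a::euclidean_space \<Rightarrow> complex"
  assumes meas: "\<And>\<xi>. (\<lambda>u. F u \<xi>) \<in> borel_measurable M"
    and cont: "\<And>u. continuous_on UNIV (F u)"
  shows "(\<lambda>(u, \<xi>). F u \<xi>) \<in> borel_measurable (M \<Otimes>\<^sub>M borel)"
proof -
  define q :: "nat \<Rightarrow> 'a \<Rightarrow> 'a" where
    "q n \<xi> = (\<Sum>b\<in>Basis. (real_of_int \<lfloor>real (Suc n) * (\<xi> \<bullet> b)\<rfloor> / real (Suc n)) *\<^sub>R b)" for n \<xi>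
  have q_meas: "q n \<in> borel_measurable borel" for n
    unfolding q_def[abs_def] by measurable
  have q_count: "countable (range (q n))" for n
  proof -
    have "range (q n) \<subseteq> (\<lambda>k. \<Sum>b\<in>Basis. (real_of_int (k b) / real (Suc n)) *\<^sub>R b) ` (PiE Basis (\<lambda>_. UNIV))"
    proof safe
      fix \<xi>
      show "q n \<xi> \<in> (\<lambda>k. \<Sum>b\<in>Basis. (real_of_int (k b) / real (Suc n)) *\<^sub>R b) ` (PiE Basis (\<lambda>_. UNIV))"
        by (rule image_eqI[where x = "restrict (\<lambda>b. \<lfloor>real (Suc n) * (\<xi> \<bullet> b)\<rfloor>) Basis"]) (auto simp: q_def)
    qed
    moreover have "countable (PiE (Basis :: 'a set) (\<lambda>_. UNIV :: int set))"
      by (intro countable_PiE) auto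
    ultimately show ?thesis
      by (rule countable_subset[OF _ countable_image])
  qed
  have q_lim: "(\<lambda>n. q n \<xi>) \<longlonglongrightarrow> \<xi>" for \<xi>
  proof -
    have "(\<lambda>n. real_of_int \<lfloor>real (Suc n) * x\<rfloor> / real (Suc n)) \<longlonglongrightarrow> x" for x :: real
    proof (rule tendsto_sandwich)
      show "\<forall>\<^sub>F n in sequentially. x - inverse (real (Suc n)) \<le> real_of_int \<lfloor>real (Suc n) * x\<rfloor> / real (Suc n)"
      proof (intro always_eventually allI)
        fix n
        have "real (Suc n) * x - 1 \<le> real_of_int \<lfloor>real (Suc n) * x\<rfloor>" by linarith
        then have "(real (Suc n) * x - 1) / real (Suc n) \<le> real_of_int \<lfloor>real (Suc n) * x\<rfloor> / real (Suc n)"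
          by (intro divide_right_mono) auto
        then show "x - inverse (real (Suc n)) \<le> real_of_int \<lfloor>real (Suc n) * x\<rfloor> / real (Suc n)"
          by (simp add: diff_divide_distrib inverse_eq_divide del: of_nat_Suc)
      qed
      show "\<forall>\<^sub>F n in sequentially. real_of_int \<lfloor>real (Suc n) * x\<rfloor> / real (Suc n) \<le> x"
      proof (intro always_eventually allI)
        fix n
        have "real_of_int \<lfloor>real (Suc n) * x\<rfloor> \<le> real (Suc n) * x" by linarith
        then show "real_of_int \<lfloor>real (Suc n) * x\<rfloor> / real (Suc n) \<le> x"
          by (simp add: pos_divide_le_eq mult.commute del: of_nat_Suc)
      qed
      show "(\<lambda>n. x - inverse (real (Suc n))) \<longlonglongrightarrow> x"
        using tendsto_diff[OF tendsto_const LIMSEQ_inverse_real_of_nat] by simp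
    qed simp
    then have "(\<lambda>n. q n \<xi>) \<longlonglongrightarrow> (\<Sum>b\<in>Basis. (\<xi> \<bullet> b) *\<^sub>R b)"
      unfolding q_def by (intro tendsto_intros)
    then show ?thesis by (simp add: euclidean_representation)
  qed
  show ?thesis
  proof (rule borel_measurable_LIMSEQ_metric)
    show "(\<lambda>x. F (fst x) (q n (snd x))) \<in> borel_measurable (M \<Otimes>\<^sub>M borel)" for n
    proof (rule measurable_compose_countable'[where f = "\<lambda>\<eta> x. F (fst x) \<eta>" and g = "\<lambda>x. q n (snd x)" and I = "range (q n)"])
      show "(\<lambda>x. F (fst x) \<eta>) \<in> borel_measurable (M \<Otimes>\<^sub>M borel)" for \<eta>
        by (rule measurable_compose[OF measurable_fst meas])
      have "(\<lambda>x. q n (snd x)) \<in> borel_measurable (M \<Otimes>\<^sub>M borel)"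
        by (rule measurable_compose[OF measurable_snd q_meas])
      then show "(\<lambda>x. q n (snd x)) \<in> M \<Otimes>\<^sub>M borel \<rightarrow>\<^sub>M count_space (range (q n))"
        by (subst measurable_count_space_eq_countable[OF q_count]) (auto intro: measurable_sets)
    qed (rule q_count)
    show "(\<lambda>n. F (fst x) (q n (snd x))) \<longlonglongrightarrow> (\<lambda>(u, \<xi>). F u \<xi>) x" for x
      unfolding case_prod_beta'
      by (rule continuous_on_tendsto_compose[OF cont q_lim]) auto
  qed
qed

abbreviation weighted_char :: "'a::euclidean_space measure \<Rightarrow> ('a \<Rightarrow> real) \<Rightarrow> 'a \<Rightarrow> complex" where
  "weighted_char P w \<xi> \<equiv> LINT y|P. complex_of_real (w y) * iexp (y \<bullet> \<xi>)"

lemma continuous_on_char_integral: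
  fixes w :: "'a::euclidean_space \<Rightarrow> real"
  assumes sets: "sets P = sets borel" and w: "integrable P w"
  shows "continuous_on UNIV (\<lambda>\<xi>. weighted_char P w \<xi>)"
proof (rule continuous_on_sequentiallyI)
  fix \<xi> :: "nat \<Rightarrow> 'a" and \<xi>' assume lim: "\<xi> \<longlonglongrightarrow> \<xi>'"
  have m: "(\<lambda>y. iexp (y \<bullet> \<xi>)) \<in> borel_measurable P" for \<xi>
    by (rule borel_measurable_sets_eq[OF sets]) measurable
  have wm: "(\<lambda>y. complex_of_real (w y)) \<in> borel_measurable P"
    using borel_measurable_integrable[OF w] by measurable
  show "(\<lambda>n. LINT y|P. complex_of_real (w y) * iexp (y \<bullet> \<xi> n)) \<longlonglongrightarrow>
    (LINT y|P. complex_of_real (w y) * iexp (y \<bullet> \<xi>'))"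
  proof (rule integral_dominated_convergence[where w = "\<lambda>y. \<bar>w y\<bar>"])
    show "AE y in P. (\<lambda>n. complex_of_real (w y) * iexp (y \<bullet> \<xi> n)) \<longlonglongrightarrow>
        complex_of_real (w y) * iexp (y \<bullet> \<xi>')"
      by (intro AE_I2 tendsto_intros lim)
    show "AE y in P. norm (complex_of_real (w y) * iexp (y \<bullet> \<xi> n)) \<le> \<bar>w y\<bar>" for n
      by (simp add: norm_mult)
    show "integrable P (\<lambda>y. \<bar>w y\<bar>)" using w by simp
  qed (intro borel_measurable_times wm m)+
qed

lemma dominated_real_integral:
  fixes f :: "'a::euclidean_space \<Rightarrow> real"
  assumes sets: "sets P = sets borel" "sets Q = sets borel"
    and dom: "\<And>f. f \<in> borel_measurable borel \<Longrightarrow> (\<integral>\<^sup>+ y. f y \<partial>Q) \<le> (\<integral>\<^sup>+ y. f y \<partial>P)"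
    and f: "f \<in> borel_measurable borel" "\<And>y. 0 \<le> f y" and P: "integrable P f"
  shows "integrable Q f" "(LINT y|Q. f y) \<le> (LINT y|P. f y)"
proof -
  have le: "(\<integral>\<^sup>+ y. ennreal (f y) \<partial>Q) \<le> (\<integral>\<^sup>+ y. ennreal (f y) \<partial>P)"
    using f by (intro dom) measurable
  have Pf: "(\<integral>\<^sup>+ y. ennreal (f y) \<partial>P) = ennreal (LINT y|P. f y)"
    using f by (intro nn_integral_eq_integral P) auto
  show Q: "integrable Q f"
    using f le_less_trans[OF le] Pf by (intro integrableI_nonneg borel_measurable_sets_eq[OF sets(2)]) auto
  have "(\<integral>\<^sup>+ y. ennreal (f y) \<partial>Q) = ennreal (LINT y|Q. f y)"
    using f by (intro nn_integral_eq_integral Q) auto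
  then show "(LINT y|Q. f y) \<le> (LINT y|P. f y)"
    using le Pf f by (simp add: ennreal_le_iff integral_nonneg_AE)
qed

text \<open>After rotating the difference of the two integrals onto the positive axis, this is
  the domination of \<open>Q\<close> by \<open>P\<close> applied to the nonnegative function \<open>S - Re (c G)\<close>.\<close>

lemma dominated_complex_integral:
  fixes G :: "'a::euclidean_space \<Rightarrow> complex"
  assumes sets: "sets P = sets borel" "sets Q = sets borel"
    and dom: "\<And>f. f \<in> borel_measurable borel \<Longrightarrow> (\<integral>\<^sup>+ y. f y \<partial>Q) \<le> (\<integral>\<^sup>+ y. f y \<partial>P)"
    and w: "w1 \<in> borel_measurable borel" "w2 \<in> borel_measurable borel" "\<And>y. 0 \<le> w2 y" "\<And>y. w2 y \<le> w1 y"
    and i1: "integrable P w1"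
    and G: "G \<in> borel_measurable borel" "\<And>y. norm (G y) \<le> S"
  shows "norm ((LINT y|P. complex_of_real (w1 y) * G y) - (LINT y|Q. complex_of_real (w2 y) * G y)) \<le>
     ((LINT y|P. w1 y) - (LINT y|Q. w2 y)) * S"
proof -
  note [measurable] = w(1,2) G(1)
  have w1nn: "0 \<le> w1 y" for y
    by (rule order_trans[OF w(3) w(4)])
  have i1Q: "integrable Q w1"
    by (rule dominated_real_integral(1)[OF sets _ w(1) w1nn i1]) (rule dom)
  have i2: "integrable Q w2"
    by (rule Bochner_Integration.integrable_bound[OF i1Q])
      (use w w1nn in \<open>auto intro!: borel_measurable_sets_eq[OF sets(2)]\<close>)
  have G_i: "integrable M (\<lambda>y. complex_of_real (v y) * G y)"
    if "integrable M v" "sets M = sets borel" for M and v :: "'a \<Rightarrow> real"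
  proof -
    have "integrable M (\<lambda>y. G y * complex_of_real (v y))"
      using that by (intro integrable_bounded_mult[where B = S] borel_measurable_sets_eq[OF that(2)] G)
        (simp_all add: complex_of_real_integrable_eq)
    then show ?thesis by (simp only: mult.commute)
  qed
  define v where "v = (LINT y|P. complex_of_real (w1 y) * G y) - (LINT y|Q. complex_of_real (w2 y) * G y)"
  define c where "c = cnj (sgn v)"
  have c1: "norm c \<le> 1" by (simp add: c_def norm_sgn)
  have cv: "c * v = complex_of_real (norm v)"
    by (simp add: c_def sgn_div_norm scaleR_conv_of_real divide_simps)
      (metis complex_norm_square mult.commute of_real_mult power2_eq_square)
  have Re_le: "Re (c * G y) \<le> S" for y
  proof -
    have "Re (c * G y) \<le> norm c * norm (G y)" by (metis complex_Re_le_cmod norm_mult)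
    also have "\<dots> \<le> 1 * S" by (intro mult_mono c1 G) auto
    finally show ?thesis by simp
  qed
  have ReI: "(LINT y|M. u y * Re (c * G y)) = Re (c * (LINT y|M. complex_of_real (u y) * G y))"
    "integrable M (\<lambda>y. u y * Re (c * G y))"
    if "integrable M u" "sets M = sets borel" for M and u :: "'a \<Rightarrow> real"
  proof -
    have i: "integrable M (\<lambda>y. c * (complex_of_real (u y) * G y))"
      by (rule integrable_mult_right[OF G_i[OF that]])
    have eq: "Re (c * (complex_of_real (u y) * G y)) = u y * Re (c * G y)" for y
      by (simp add: algebra_simps)
    show "(LINT y|M. u y * Re (c * G y)) = Re (c * (LINT y|M. complex_of_real (u y) * G y))"
      using integral_Re[OF i] unfolding eq by simp
    show "integrable M (\<lambda>y. u y * Re (c * G y))"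
      using integrable_Re[OF i] unfolding eq .
  qed
  \<comment> \<open>The weight is raised from \<open>w2\<close> to \<open>w1\<close> under
    \<open>Q\<close> first, then \<open>Q\<close> is replaced by \<open>P\<close>; both steps rest
    on the nonnegativity of \<open>S - Re (c * G y)\<close>.\<close>
  have "(LINT y|Q. w2 y * (S - Re (c * G y))) \<le> (LINT y|Q. w1 y * (S - Re (c * G y)))"
    unfolding right_diff_distrib
  proof (intro integral_mono)
    show "w2 y * S - w2 y * Re (c * G y) \<le> w1 y * S - w1 y * Re (c * G y)" for y
      using mult_right_mono[OF w(4)[of y], of "S - Re (c * G y)"] Re_le[of y] by (simp add: right_diff_distrib)
  qed (use ReI(2)[OF i1Q sets(2)] ReI(2)[OF i2 sets(2)] i1Q i2 in auto)
  also have "\<dots> \<le> (LINT y|P. w1 y * (S - Re (c * G y)))"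
  proof (rule dominated_real_integral(2)[OF sets dom])
    show "integrable P (\<lambda>y. w1 y * (S - Re (c * G y)))"
      using ReI(2)[OF i1 sets(1)] i1 by (simp add: right_diff_distrib)
    show "0 \<le> w1 y * (S - Re (c * G y))" for y
      using Re_le[of y] w1nn[of y] by simp
    show "(\<lambda>y. w1 y * (S - Re (c * G y))) \<in> borel_measurable borel" by measurable
  qed
  finally have "(LINT y|Q. w2 y) * S - Re (c * (LINT y|Q. complex_of_real (w2 y) * G y)) \<le>
      (LINT y|P. w1 y) * S - Re (c * (LINT y|P. complex_of_real (w1 y) * G y))"
    using ReI[OF i1 sets(1)] ReI[OF i2 sets(2)] i1 i2 by (simp add: right_diff_distrib)
  then have "Re (c * v) \<le> ((LINT y|P. w1 y) - (LINT y|Q. w2 y)) * S"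
    by (simp add: v_def algebra_simps)
  then show ?thesis
    unfolding cv by (simp add: v_def)
qed

text \<open>This is the transform of w1 P - w2 Q, a nonnegative finite measure, and its norm is its
  mass. The difference measure is never formed: Fubini moves the pairing with \<open>g\<close> to
  the jump side, where the two integrals of \<open>G\<close> can be compared.\<close>

lemma fs_bounded_dominated_char:
  fixes P Q :: "'a::euclidean_space measure"
  assumes sets: "sets P = sets borel" "sets Q = sets borel" and sf: "sigma_finite_measure P" "sigma_finite_measure Q"
    and dom: "\<And>f. f \<in> borel_measurable borel \<Longrightarrow> (\<integral>\<^sup>+ y. f y \<partial>Q) \<le> (\<integral>\<^sup>+ y. f y \<partial>P)"
    and w: "w1 \<in> borel_measurable borel" "w2 \<in> borel_measurable borel" "\<And>y. 0 \<le> w2 y" "\<And>y. w2 y \<le> w1 y"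
    and i1: "integrable P w1" and i2: "integrable Q w2"
  shows "fs_bounded (\<lambda>\<xi>. weighted_char P w1 \<xi> -
      weighted_char Q w2 \<xi>)
    ((LINT y|P. w1 y) - (LINT y|Q. w2 y))"
proof (rule fs_boundedI)
  note dci = dominated_complex_integral[OF sets dom w i1]
  show "(\<lambda>\<xi>. weighted_char P w1 \<xi> -
      weighted_char Q w2 \<xi>) \<in> borel_measurable borel"
    by (intro borel_measurable_continuous_onI continuous_on_diff continuous_on_char_integral sets i1 i2)
  show "norm (weighted_char P w1 \<xi> -
      weighted_char Q w2 \<xi>) \<le> (LINT y|P. w1 y) - (LINT y|Q. w2 y)" for \<xi>
    using dci[of "\<lambda>y. iexp (y \<bullet> \<xi>)" 1] by simp
  fix g :: "'a \<Rightarrow> complex" and S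
  assume g: "integrable lborel g"
    and S: "\<And>x. norm (trig_integral g x) \<le> S"
  define G where "G y = (LBINT \<xi>. iexp (y \<bullet> \<xi>) * g \<xi>)" for y
  note [measurable] = borel_measurable_integrable[OF g] w(1,2)
  have G: "G \<in> borel_measurable borel"
    unfolding G_def[abs_def] by measurable
  have swap: "integrable lborel (\<lambda>\<xi>. weighted_char M v \<xi> * g \<xi>)"
     "(LBINT \<xi>. weighted_char M v \<xi> * g \<xi>) =
      (LINT y|M. complex_of_real (v y) * G y)"
    if M: "sets M = sets borel" "sigma_finite_measure M" and v: "v \<in> borel_measurable borel" "integrable M v"
    for M :: "'a measure" and v
  proof -
    have "continuous_on UNIV (\<lambda>\<xi>. weighted_char M v \<xi>)"
      by (rule continuous_on_char_integral[OF M(1) v(2)])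
    then have [measurable]: "(\<lambda>\<xi>. weighted_char M v \<xi>) \<in> borel_measurable borel"
      by (rule borel_measurable_continuous_onI)
    show "integrable lborel (\<lambda>\<xi>. weighted_char M v \<xi> * g \<xi>)"
      using v by (intro integrable_bounded_mult[OF g, where B = "LINT y|M. \<bar>v y\<bar>"] norm_integral_le_integral)
        (auto simp: norm_mult)
    have m: "(\<lambda>(y, \<xi>). complex_of_real (v y) * iexp (y \<bullet> \<xi>) * g \<xi>) \<in> borel_measurable (borel \<Otimes>\<^sub>M lborel)"
      using v(1) by measurable
    have "(LBINT \<xi>. weighted_char M v \<xi> * g \<xi>) =
      (LINT \<xi>|lborel. LINT y|M. complex_of_real (v y) * iexp (y \<bullet> \<xi>) * g \<xi>)"
      unfolding integral_mult_left_zero ..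
    also have "\<dots> = (LINT y|M. LINT \<xi>|lborel. complex_of_real (v y) * iexp (y \<bullet> \<xi>) * g \<xi>)"
    proof (rule Fubini_product_bound[OF M(2) sigma_finite_lborel])
      show "(\<lambda>(y, \<xi>). complex_of_real (v y) * iexp (y \<bullet> \<xi>) * g \<xi>) \<in> borel_measurable (M \<Otimes>\<^sub>M lborel)"
        using m by (simp only: measurable_cong_sets[OF sets_pair_measure_cong[OF M(1) refl] refl])
      show "integrable M (\<lambda>y. \<bar>v y\<bar>)" "integrable lborel (\<lambda>\<xi>. norm (g \<xi>))"
        using v g by auto
    qed (simp add: norm_mult)
    also have "\<dots> = (LINT y|M. complex_of_real (v y) * G y)"
      unfolding G_def mult.assoc integral_mult_right_zero ..
    finally show "(LBINT \<xi>. weighted_char M v \<xi> * g \<xi>) =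
      (LINT y|M. complex_of_real (v y) * G y)" .
  qed
  note sP = swap[OF sets(1) sf(1) w(1) i1] and sQ = swap[OF sets(2) sf(2) w(2) i2]
  have "norm ((LINT y|P. complex_of_real (w1 y) * G y) - (LINT y|Q. complex_of_real (w2 y) * G y)) \<le>
      ((LINT y|P. w1 y) - (LINT y|Q. w2 y)) * S"
    by (rule dci[OF _ G]) (simp_all add: G_def S)
  then show "norm (LBINT \<xi>. (weighted_char P w1 \<xi> -
      weighted_char Q w2 \<xi>) * g \<xi>)
     \<le> ((LINT y|P. w1 y) - (LINT y|Q. w2 y)) * S"
    unfolding left_diff_distrib Bochner_Integration.integral_diff[OF sP(1) sQ(1)] sP(2) sQ(2)
    by (simp only: left_diff_distrib)
qed

section \<open>Removing the dominated small jumps\<close>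

lemma integrable_on_interval:
  fixes f :: "real \<Rightarrow> 'b::{banach, second_countable_topology}"
  assumes f: "f \<in> borel_measurable borel" and bd: "AE u in lborel. u \<in> {0..t} \<longrightarrow> norm (f u) \<le> C"
  shows "integrable lborel (\<lambda>u. indicator {0..t} u *\<^sub>R f u)"
proof (rule Bochner_Integration.integrable_bound)
  show "integrable lborel (\<lambda>u. indicator {0..t} u * C)"
    by (intro integrable_mult_left integrable_real_indicator) (auto simp: emeasure_lborel_Icc_eq)
  show "(\<lambda>u. indicator {0..t} u *\<^sub>R f u) \<in> borel_measurable lborel"
    using f by measurable
  show "AE u in lborel. norm (indicator {0..t} u *\<^sub>R f u) \<le> norm (indicator {0..t} u * C)"
    using bd
  proof eventually_elim
    case (elim u)
    then show ?case by (cases "u \<in> {0..t}") auto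
  qed
qed

text \<open>The compensator runs over the whole ball of radius \<open>R\<close>, not over the unit
  ball. The discrepancy with the Levy symbol is a drift, which contributes a mere character to the
  remainder.\<close>

definition small_jump_symbol :: "'a::euclidean_space measure \<Rightarrow> real \<Rightarrow> 'a \<Rightarrow> complex" where
  "small_jump_symbol \<nu> R \<xi> = (LINT y|\<nu>. complex_of_real (indicator {y. norm y \<le> R} y) *
     (compensated_exp (y \<bullet> \<xi>)))"

lemma cut_sq_le:
  assumes "0 < R"
  shows "indicator {y. norm y \<le> R} (y::'a::real_normed_vector) * (norm y)\<^sup>2 \<le> max 1 (R\<^sup>2) * levy_weight y"
proof (cases "norm y \<le> R")
  case True
  then have "(norm y)\<^sup>2 \<le> R\<^sup>2" by (intro power_mono) auto
  moreover have "(norm y)\<^sup>2 \<le> max 1 (R\<^sup>2) * (norm y)\<^sup>2"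
    using mult_right_mono[of 1 "max 1 (R\<^sup>2)" "(norm y)\<^sup>2"] by simp
  ultimately show ?thesis using True by (simp add: min_def max_def)
qed simp

lemma small_jump_kernel_bound:
  fixes y \<xi> :: "'a::euclidean_space"
  assumes "0 < R"
  shows "norm (complex_of_real (indicator {y. norm y \<le> R} y) *
     (compensated_exp (y \<bullet> \<xi>))) \<le>
    ((norm \<xi>)\<^sup>2 * max 1 (R\<^sup>2)) * levy_weight y"
proof -
  have "\<bar>y \<bullet> \<xi>\<bar>\<^sup>2 \<le> (norm y * norm \<xi>)\<^sup>2"
    by (intro power_mono Cauchy_Schwarz_ineq2) simp
  then have "norm (compensated_exp (y \<bullet> \<xi>)) \<le> (norm \<xi>)\<^sup>2 * (norm y)\<^sup>2"
    using norm_exp_i_minus_2[of "y \<bullet> \<xi>"] by (simp add: power_mult_distrib mult.commute)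
  then have "indicator {y. norm y \<le> R} y * norm (compensated_exp (y \<bullet> \<xi>)) \<le>
    indicator {y. norm y \<le> R} y * ((norm \<xi>)\<^sup>2 * (norm y)\<^sup>2)"
    by (intro mult_left_mono) auto
  also have "\<dots> = (norm \<xi>)\<^sup>2 * (indicator {y. norm y \<le> R} y * (norm y)\<^sup>2)"
    by (simp only: mult.left_commute)
  also have "\<dots> \<le> (norm \<xi>)\<^sup>2 * (max 1 (R\<^sup>2) * levy_weight y)"
    by (intro mult_left_mono cut_sq_le assms) simp
  finally show ?thesis by (simp add: norm_mult mult.assoc)
qed

text \<open>The data of the process up to time \<open>t\<close>, with \<open>L\<close> and
  \<open>b\<close> continued to all real times so that measurability can be stated on the whole
  line. The bounds by \<open>K\<close> hold for almost every time only.\<close>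

locale dominating_family =
  fixes L :: "real \<Rightarrow> 'a::euclidean_space measure" and b :: "real \<Rightarrow> 'a" and \<nu> :: "'a measure" and t R K :: real
  assumes L: "\<And>u. levy_measure (L u)" and nu: "levy_measure \<nu>"
    and dom: "\<And>u f. f \<in> borel_measurable borel \<Longrightarrow> (\<integral>\<^sup>+ y. f y \<partial>\<nu>) \<le> (\<integral>\<^sup>+ y. f y \<partial>L u)"
    and meas: "\<And>f :: 'a \<Rightarrow> real. (\<And>u. integrable (L u) f) \<Longrightarrow> (\<lambda>u. LINT y|L u. f y) \<in> borel_measurable borel"
    and b: "b \<in> borel_measurable borel"
    and t: "0 \<le> t" and K: "0 \<le> K" and R: "0 < R"
    and bK: "AE u in lborel. u \<in> {0..t} \<longrightarrow> norm (b u) \<le> K"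
    and LK: "AE u in lborel. u \<in> {0..t} \<longrightarrow> (\<integral>\<^sup>+ y. ennreal (levy_weight y) \<partial>L u) \<le> ennreal K"
begin

definition m :: "real \<Rightarrow> real" where
  "m u = (LINT y|L u. levy_weight y)"

lemma mK: "AE u in lborel. u \<in> {0..t} \<longrightarrow> m u \<le> K"
  using LK
proof eventually_elim
  case (elim u)
  have "(\<integral>\<^sup>+ y. ennreal (levy_weight y) \<partial>L u) = ennreal (m u)"
    unfolding m_def by (rule nn_integral_eq_integral[OF levy_integrable_min[OF L]]) simp
  then show ?case using elim K by (simp add: ennreal_le_iff)
qed

lemma norm_integral_L_le:
  fixes f :: "'a \<Rightarrow> 'b::{banach, second_countable_topology}"
  assumes "\<And>y. norm (f y) \<le> C * levy_weight y"
  shows "norm (LINT y|L u. f y) \<le> C * m u"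
proof -
  have "norm (LINT y|L u. f y) \<le> (LINT y|L u. C * levy_weight y)"
    using levy_integrable_min[OF L] assms by (intro norm_integral_le_integral) auto
  then show ?thesis by (simp add: m_def)
qed

lemma meas_complex:
  fixes f :: "'a \<Rightarrow> complex"
  assumes "\<And>u. integrable (L u) f"
  shows "(\<lambda>u. LINT y|L u. f y) \<in> borel_measurable borel"
proof -
  have "(\<lambda>u. complex_of_real (LINT y|L u. Re (f y)) + \<i> * complex_of_real (LINT y|L u. Im (f y))) \<in> borel_measurable borel"
    by (intro borel_measurable_add borel_measurable_times borel_measurable_const
        measurable_compose[OF meas borel_measurable_continuous_onI[of complex_of_real]]
        integrable_Re integrable_Im assms continuous_intros)
  also have "(\<lambda>u. complex_of_real (LINT y|L u. Re (f y)) + \<i> * complex_of_real (LINT y|L u. Im (f y))) = (\<lambda>u. LINT y|L u. f y)"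
    by (simp only: integral_Re[OF assms] integral_Im[OF assms] complex_eq[symmetric])
  finally show ?thesis .
qed

lemma meas_vector:
  fixes f :: "'a \<Rightarrow> 'a"
  assumes f: "\<And>u. integrable (L u) f"
  shows "(\<lambda>u. LINT y|L u. f y) \<in> borel_measurable borel"
proof (rule iffD2[OF borel_measurable_euclidean_space], rule ballI)
  fix i :: 'a assume "i \<in> Basis"
  have "(\<lambda>u. LINT y|L u. f y \<bullet> i) \<in> borel_measurable borel"
    by (intro meas integrable_inner_left f)
  then show "(\<lambda>u. (LINT y|L u. f y) \<bullet> i) \<in> borel_measurable borel"
    using f by simp
qed

text \<open>Removes a neighbourhood of the origin, off which all the measures are finite. The limit
  in \<open>n\<close> is the indicator of y \<noteq> 0, and this loses nothing since the kernels
  vanish at the origin.\<close>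

definition far :: "nat \<Rightarrow> 'a \<Rightarrow> real" where
  "far n y = indicator {y. inverse (real (Suc n)) \<le> norm y} y"

definition near :: "'a \<Rightarrow> real" where
  "near y = indicator {y. norm y \<le> 1} y"

definition cut :: "'a \<Rightarrow> real" where
  "cut y = indicator {y. norm y \<le> R} y"

definition e :: "'a \<Rightarrow> 'a \<Rightarrow> complex" where
  "e \<xi> y = iexp (y \<bullet> \<xi>)"

definition kernel1 :: "'a \<Rightarrow> 'a \<Rightarrow> complex" where
  "kernel1 \<xi> y = e \<xi> y - 1 - \<i> * complex_of_real (y \<bullet> \<xi>) * complex_of_real (near y)"

definition kernel2 :: "'a \<Rightarrow> 'a \<Rightarrow> complex" where
  "kernel2 \<xi> y = complex_of_real (cut y) * (e \<xi> y - 1 - \<i> * complex_of_real (y \<bullet> \<xi>))"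

lemma measurables [measurable]:
  "far n \<in> borel_measurable borel" "near \<in> borel_measurable borel" "cut \<in> borel_measurable borel"
  "e \<xi> \<in> borel_measurable borel" "kernel1 \<xi> \<in> borel_measurable borel" "kernel2 \<xi> \<in> borel_measurable borel"
  unfolding far_def[abs_def] near_def[abs_def] cut_def[abs_def] e_def[abs_def] kernel1_def[abs_def] kernel2_def[abs_def]
  by measurable

lemma weights [simp]: "0 \<le> far n y" "far n y \<le> 1" "0 \<le> near y" "near y \<le> 1" "0 \<le> cut y" "cut y \<le> 1"
  "norm (e \<xi> y) = 1"
  by (auto simp: far_def near_def cut_def indicator_def e_def)

definition c :: "nat \<Rightarrow> real" where
  "c n = inverse (min 1 ((inverse (real (Suc n)))\<^sup>2))"

lemma far_le: "far n y \<le> c n * levy_weight y"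
  unfolding far_def c_def by (rule indicator_le_min_sq) simp

definition C1 :: "'a \<Rightarrow> real" where "C1 \<xi> = 2 + (norm \<xi>)\<^sup>2"
definition C2 :: "'a \<Rightarrow> real" where "C2 \<xi> = (norm \<xi>)\<^sup>2 * max 1 (R\<^sup>2)"

lemma kernel1_bound: "norm (kernel1 \<xi> y) \<le> C1 \<xi> * levy_weight y"
  using levy_kernel_bound[of y \<xi>] by (cases "norm y \<le> 1") (simp_all add: kernel1_def e_def near_def C1_def)

lemma kernel2_bound: "norm (kernel2 \<xi> y) \<le> C2 \<xi> * levy_weight y"
  unfolding kernel2_def e_def cut_def C2_def by (rule small_jump_kernel_bound[OF R])

lemma far_mult_bound:
  "norm k \<le> C * levy_weight y \<Longrightarrow> norm (complex_of_real (far n y) * k) \<le> C * levy_weight y"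
  using mult_right_mono[of "far n y" 1 "norm k"] by (simp add: norm_mult)

lemma far_tendsto: "(\<lambda>n. complex_of_real (far n y) * k) \<longlonglongrightarrow> k" if "y = 0 \<Longrightarrow> k = 0"
proof (cases "y = 0")
  case False
  then obtain N where N: "inverse (real (Suc N)) < norm y"
    using reals_Archimedean[of "norm y"] by auto
  have "far n y = 1" if "N \<le> n" for n
  proof -
    have "inverse (real (Suc n)) \<le> inverse (real (Suc N))" using that by (intro le_imp_inverse_le) auto
    then have "inverse (real (Suc n)) \<le> norm y" using N by linarith
    then show ?thesis by (simp add: far_def del: of_nat_Suc)
  qed
  then have "\<forall>\<^sub>F n in sequentially. complex_of_real (far n y) * k = k"
    by (intro eventually_sequentiallyI[of N]) simp
  then show ?thesis by (rule tendsto_eventually)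
qed (use that in simp)

lemma far_integral_tendsto:
  assumes lev: "levy_measure P" and k: "k \<in> borel_measurable borel" "\<And>y. norm (k y) \<le> C * levy_weight y"
  shows "(\<lambda>n. LINT y|P. complex_of_real (far n y) * k y) \<longlonglongrightarrow> (LINT y|P. k y)"
proof (rule integral_dominated_convergence[where w = "\<lambda>y. C * levy_weight y"])
  note sets = levy_measureD(1)[OF lev]
  show "k \<in> borel_measurable P" "(\<lambda>y. complex_of_real (far n y) * k y) \<in> borel_measurable P" for n
    by (rule borel_measurable_sets_eq[OF sets], use k(1) in measurable)+
  show "integrable P (\<lambda>y. C * levy_weight y)"
    by (rule integrable_mult_right[OF levy_integrable_min[OF lev]])
  show "AE y in P. norm (complex_of_real (far n y) * k y) \<le> C * levy_weight y" for n
    by (intro AE_I2 far_mult_bound k)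
  show "AE y in P. (\<lambda>n. complex_of_real (far n y) * k y) \<longlonglongrightarrow> k y"
    using k(2)[of 0] by (intro AE_I2 far_tendsto) auto
qed

text \<open>The exponent that remains at time \<open>u\<close> once the jumps of \<nu> up to size
  \<open>R\<close> have been split off.\<close>

definition D :: "real \<Rightarrow> 'a \<Rightarrow> complex" where
  "D u \<xi> = \<i> * complex_of_real (b u \<bullet> \<xi>) + (LINT y|L u. kernel1 \<xi> y) - (LINT y|\<nu>. kernel2 \<xi> y)"

definition Dn :: "nat \<Rightarrow> real \<Rightarrow> 'a \<Rightarrow> complex" where
  "Dn n u \<xi> = \<i> * complex_of_real (b u \<bullet> \<xi>) + (LINT y|L u. complex_of_real (far n y) * kernel1 \<xi> y) -
     (LINT y|\<nu>. complex_of_real (far n y) * kernel2 \<xi> y)"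

lemma Dn_tendsto: "(\<lambda>n. Dn n u \<xi>) \<longlonglongrightarrow> D u \<xi>"
  unfolding Dn_def D_def
  by (intro tendsto_add tendsto_diff tendsto_const far_integral_tendsto[OF L _ kernel1_bound]
      far_integral_tendsto[OF nu _ kernel2_bound] measurables)

lemma norm_inner_le:
  assumes "norm (b u) \<le> K"
  shows "norm (\<i> * complex_of_real (b u \<bullet> \<xi>)) \<le> K * norm \<xi>"
proof -
  have "\<bar>b u \<bullet> \<xi>\<bar> \<le> norm (b u) * norm \<xi>" by (rule Cauchy_Schwarz_ineq2)
  also have "\<dots> \<le> K * norm \<xi>" using assms by (intro mult_right_mono) auto
  finally show ?thesis by (simp add: norm_mult)
qed

text \<open>A majorant for \<open>D\<close> and all \<open>Dn n\<close> at almost every time in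
  [0, t], independent of time and of the truncation, as dominated convergence in
  \<open>D_integral_tendsto\<close> requires.\<close>

definition W :: "'a \<Rightarrow> real" where
  "W \<xi> = K * norm \<xi> + C1 \<xi> * K + C2 \<xi> * (LINT y|\<nu>. levy_weight y)"

lemma nu_bound:
  fixes f :: "'a \<Rightarrow> 'b::{banach, second_countable_topology}"
  assumes "\<And>y. norm (f y) \<le> C * levy_weight y"
  shows "norm (LINT y|\<nu>. f y) \<le> C * (LINT y|\<nu>. levy_weight y)"
proof -
  have "norm (LINT y|\<nu>. f y) \<le> (LINT y|\<nu>. C * levy_weight y)"
    using levy_integrable_min[OF nu] assms by (intro norm_integral_le_integral) auto
  then show ?thesis by simp
qed

lemma D_bound_aux:
  assumes k1: "\<And>y. norm (k1 y) \<le> C1 \<xi> * levy_weight y" and k2: "\<And>y. norm (k2 y) \<le> C2 \<xi> * levy_weight y"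
  shows "AE u in lborel. u \<in> {0..t} \<longrightarrow>
    norm (\<i> * complex_of_real (b u \<bullet> \<xi>) + (LINT y|L u. k1 y) - (LINT y|\<nu>. k2 y)) \<le> W \<xi>"
  using bK mK
proof eventually_elim
  case (elim u)
  show ?case
  proof
    assume u: "u \<in> {0..t}"
    have "norm (LINT y|L u. k1 y) \<le> C1 \<xi> * m u" by (rule norm_integral_L_le[OF k1])
    also have "\<dots> \<le> C1 \<xi> * K" using elim(2) u by (intro mult_left_mono) (auto simp: C1_def)
    finally show "norm (\<i> * complex_of_real (b u \<bullet> \<xi>) + (LINT y|L u. k1 y) - (LINT y|\<nu>. k2 y)) \<le> W \<xi>"
      unfolding W_def using norm_inner_le elim(1) u
      by (intro order_trans[OF norm_triangle_ineq4] add_mono order_trans[OF norm_triangle_ineq] nu_bound[OF k2]) auto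
  qed
qed

lemma D_bounds:
  "AE u in lborel. u \<in> {0..t} \<longrightarrow> norm (Dn n u \<xi>) \<le> W \<xi>"
  "AE u in lborel. u \<in> {0..t} \<longrightarrow> norm (D u \<xi>) \<le> W \<xi>"
  unfolding Dn_def D_def
  by (rule D_bound_aux far_mult_bound kernel1_bound kernel2_bound)+

lemma inner_b_measurable: "(\<lambda>u. complex_of_real (b u \<bullet> \<xi>)) \<in> borel_measurable borel"
  using b by measurable

lemma D_measurable:
  "(\<lambda>u. Dn n u \<xi>) \<in> borel_measurable borel" "(\<lambda>u. D u \<xi>) \<in> borel_measurable borel"
proof -
  have m1: "(\<lambda>u. LINT y|L u. kernel1 \<xi> y) \<in> borel_measurable borel"
    by (intro meas_complex levy_integrable[OF L _ kernel1_bound] measurables)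
  have m2: "(\<lambda>u. LINT y|L u. complex_of_real (far n y) * kernel1 \<xi> y) \<in> borel_measurable borel"
    by (intro meas_complex levy_integrable[OF L _ far_mult_bound[OF kernel1_bound]]) measurable
  show "(\<lambda>u. Dn n u \<xi>) \<in> borel_measurable borel" "(\<lambda>u. D u \<xi>) \<in> borel_measurable borel"
    unfolding Dn_def D_def
    by (intro borel_measurable_add borel_measurable_diff borel_measurable_times borel_measurable_const
        inner_b_measurable m1 m2)+
qed

lemma D_integral_tendsto:
  "(\<lambda>n. LINT u|lborel. indicator {0..t} u *\<^sub>R Dn n u \<xi>) \<longlonglongrightarrow> (LBINT u. indicator {0..t} u *\<^sub>R D u \<xi>)"
proof (rule integral_dominated_convergence[where w = "\<lambda>u. indicator {0..t} u * W \<xi>"])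
  show "(\<lambda>u. indicator {0..t} u *\<^sub>R D u \<xi>) \<in> borel_measurable lborel"
    "(\<lambda>u. indicator {0..t} u *\<^sub>R Dn n u \<xi>) \<in> borel_measurable lborel" for n
    using D_measurable by measurable
  show "integrable lborel (\<lambda>u. indicator {0..t} u * W \<xi>)"
    by (intro integrable_mult_left integrable_real_indicator) (auto simp: emeasure_lborel_Icc_eq)
  show "AE u in lborel. (\<lambda>n. indicator {0..t} u *\<^sub>R Dn n u \<xi>) \<longlonglongrightarrow> indicator {0..t} u *\<^sub>R D u \<xi>"
    by (intro AE_I2 tendsto_scaleR tendsto_const Dn_tendsto)
  show "AE u in lborel. norm (indicator {0..t} u *\<^sub>R Dn n u \<xi>) \<le> indicator {0..t} u * W \<xi>" for n
    using D_bounds(1)[of n \<xi>]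
  proof eventually_elim
    case (elim u)
    then show ?case by (cases "u \<in> {0..t}") auto
  qed
qed

text \<open>After truncation the kernels may be split into separately integrable terms.
  \<open>\<beta>\<close> gathers the drift and both compensators, \<open>Q\<close> is the transform
  of the finite nonnegative measure obtained from \<open>L u\<close> by removing its part due to
  \<nu>, and \<open>B\<close> is the mass of that measure.\<close>

definition \<beta> :: "nat \<Rightarrow> real \<Rightarrow> 'a" where
  "\<beta> n u = b u - (LINT y|L u. (far n y * near y) *\<^sub>R y) + (LINT y|\<nu>. (far n y * cut y) *\<^sub>R y)"

definition Q :: "nat \<Rightarrow> real \<Rightarrow> 'a \<Rightarrow> complex" where
  "Q n u \<xi> = (LINT y|L u. complex_of_real (far n y) * e \<xi> y) -
     (LINT y|\<nu>. complex_of_real (far n y * cut y) * e \<xi> y)"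

definition B :: "nat \<Rightarrow> real \<Rightarrow> real" where
  "B n u = (LINT y|L u. far n y) - (LINT y|\<nu>. far n y * cut y)"

lemma far_cut_le: "far n y * cut y \<le> far n y"
  using mult_left_mono[of "cut y" 1 "far n y"] by simp

lemma far_near_norm_le: "norm ((far n y * near y) *\<^sub>R y) \<le> c n * levy_weight y"
proof -
  have "norm ((far n y * near y) *\<^sub>R y) \<le> far n y * 1"
    by (cases "norm y \<le> 1") (simp_all add: near_def mult_left_le)
  then show ?thesis using far_le[of n y] by simp
qed

lemma far_cut_norm_le: "norm ((far n y * cut y) *\<^sub>R y) \<le> (R * c n) * levy_weight y"
proof -
  have "cut y * norm y \<le> R" using R by (simp add: cut_def indicator_def)
  from mult_left_mono[OF this, of "far n y"] have "norm ((far n y * cut y) *\<^sub>R y) \<le> R * far n y"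
    by (simp add: abs_mult mult_ac)
  also have "\<dots> \<le> R * (c n * levy_weight y)"
    using R by (intro mult_left_mono far_le) simp
  finally show ?thesis by (simp only: mult.assoc)
qed

lemma e_far_le: "norm (complex_of_real (far n y) * e \<xi> y) \<le> c n * levy_weight y"
  using far_le[of n y] by (simp add: norm_mult)

lemma e_far_cut_le: "norm (complex_of_real (far n y * cut y) * e \<xi> y) \<le> c n * levy_weight y"
  using far_le[of n y] far_cut_le[of n y] by (simp add: norm_mult)

lemma integrables:
  "integrable (L u) (\<lambda>y. far n y)" "integrable \<nu> (\<lambda>y. far n y * cut y)"
  "integrable (L u) (\<lambda>y. (far n y * near y) *\<^sub>R y)" "integrable \<nu> (\<lambda>y. (far n y * cut y) *\<^sub>R y)"
  "integrable (L u) (\<lambda>y. complex_of_real (far n y) * e \<xi> y)"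
  "integrable \<nu> (\<lambda>y. complex_of_real (far n y * cut y) * e \<xi> y)"
proof -
  show "integrable (L u) (\<lambda>y. far n y)"
    by (rule levy_integrable[OF L, where C = "c n"]) (use far_le in simp_all)
  show "integrable \<nu> (\<lambda>y. far n y * cut y)"
    by (rule levy_integrable[OF nu, where C = "c n"]) (use order_trans[OF far_cut_le far_le] in simp_all)
  show "integrable (L u) (\<lambda>y. (far n y * near y) *\<^sub>R y)"
    by (rule levy_integrable[OF L _ far_near_norm_le]) measurable
  show "integrable \<nu> (\<lambda>y. (far n y * cut y) *\<^sub>R y)"
    by (rule levy_integrable[OF nu _ far_cut_norm_le]) measurable
  show "integrable (L u) (\<lambda>y. complex_of_real (far n y) * e \<xi> y)"
    by (rule levy_integrable[OF L _ e_far_le]) measurable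
  show "integrable \<nu> (\<lambda>y. complex_of_real (far n y * cut y) * e \<xi> y)"
    by (rule levy_integrable[OF nu _ e_far_cut_le]) measurable
qed

lemma Dn_eq: "Dn n u \<xi> = \<i> * complex_of_real (\<beta> n u \<bullet> \<xi>) + (Q n u \<xi> - complex_of_real (B n u))"
proof -
  have i1: "integrable (L u) (\<lambda>y. complex_of_real (far n y))" "integrable \<nu> (\<lambda>y. complex_of_real (far n y * cut y))"
    using integrables(1)[of u n] integrables(2)[of n] by (simp_all only: complex_of_real_integrable_eq)
  have i2: "integrable (L u) (\<lambda>y. \<i> * complex_of_real (((far n y * near y) *\<^sub>R y) \<bullet> \<xi>))"
    "integrable \<nu> (\<lambda>y. \<i> * complex_of_real (((far n y * cut y) *\<^sub>R y) \<bullet> \<xi>))"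
    by (intro integrable_mult_right integrable_of_real integrable_inner_left integrables)+
  have "(LINT y|L u. complex_of_real (far n y) * kernel1 \<xi> y) = (LINT y|L u. complex_of_real (far n y) * e \<xi> y -
      complex_of_real (far n y) - \<i> * complex_of_real (((far n y * near y) *\<^sub>R y) \<bullet> \<xi>))"
    by (intro Bochner_Integration.integral_cong refl) (simp add: kernel1_def algebra_simps)
  also have "\<dots> = (LINT y|L u. complex_of_real (far n y) * e \<xi> y) - (LINT y|L u. complex_of_real (far n y)) -
      (LINT y|L u. \<i> * complex_of_real (((far n y * near y) *\<^sub>R y) \<bullet> \<xi>))"
    by (simp only: Bochner_Integration.integral_diff Bochner_Integration.integrable_diff integrables i1 i2)
  also have "(LINT y|L u. \<i> * complex_of_real (((far n y * near y) *\<^sub>R y) \<bullet> \<xi>)) =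
      \<i> * complex_of_real ((LINT y|L u. (far n y * near y) *\<^sub>R y) \<bullet> \<xi>)"
    unfolding integral_mult_right_zero integral_complex_of_real integral_inner_left[OF integrables(3)] ..
  finally have 1: "(LINT y|L u. complex_of_real (far n y) * kernel1 \<xi> y) =
     (LINT y|L u. complex_of_real (far n y) * e \<xi> y) - complex_of_real (LINT y|L u. far n y) -
      \<i> * complex_of_real ((LINT y|L u. (far n y * near y) *\<^sub>R y) \<bullet> \<xi>)"
    by (simp only: integral_complex_of_real)
  have "(LINT y|\<nu>. complex_of_real (far n y) * kernel2 \<xi> y) = (LINT y|\<nu>. complex_of_real (far n y * cut y) * e \<xi> y -
      complex_of_real (far n y * cut y) - \<i> * complex_of_real (((far n y * cut y) *\<^sub>R y) \<bullet> \<xi>))"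
    by (intro Bochner_Integration.integral_cong refl) (simp add: kernel2_def algebra_simps)
  also have "\<dots> = (LINT y|\<nu>. complex_of_real (far n y * cut y) * e \<xi> y) - (LINT y|\<nu>. complex_of_real (far n y * cut y)) -
      (LINT y|\<nu>. \<i> * complex_of_real (((far n y * cut y) *\<^sub>R y) \<bullet> \<xi>))"
    by (simp only: Bochner_Integration.integral_diff Bochner_Integration.integrable_diff integrables i1 i2)
  also have "(LINT y|\<nu>. \<i> * complex_of_real (((far n y * cut y) *\<^sub>R y) \<bullet> \<xi>)) =
      \<i> * complex_of_real ((LINT y|\<nu>. (far n y * cut y) *\<^sub>R y) \<bullet> \<xi>)"
    unfolding integral_mult_right_zero integral_complex_of_real integral_inner_left[OF integrables(4)] ..
  finally have 2: "(LINT y|\<nu>. complex_of_real (far n y) * kernel2 \<xi> y) =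
     (LINT y|\<nu>. complex_of_real (far n y * cut y) * e \<xi> y) - complex_of_real (LINT y|\<nu>. far n y * cut y) -
      \<i> * complex_of_real ((LINT y|\<nu>. (far n y * cut y) *\<^sub>R y) \<bullet> \<xi>)"
    by (simp only: integral_complex_of_real)
  show ?thesis
    unfolding Dn_def 1 2 \<beta>_def Q_def B_def by (simp add: inner_add_left inner_diff_left algebra_simps)
qed

lemma Q_fs: "fs_bounded (Q n u) (B n u)"
  unfolding Q_def[abs_def] B_def e_def
  by (rule fs_bounded_dominated_char[OF levy_measureD(1)[OF L] levy_measureD(1)[OF nu]
        levy_sigma_finite[OF L] levy_sigma_finite[OF nu] _ _ _ _ far_cut_le integrables(1,2)])
    (use dom in simp_all)

lemma Q_measurable: "(\<lambda>u. Q n u \<xi>) \<in> borel_measurable borel"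
  unfolding Q_def by (intro borel_measurable_diff borel_measurable_const meas_complex integrables)

lemma Q_meas: "(\<lambda>(u, \<xi>). Q n u \<xi>) \<in> borel_measurable (borel \<Otimes>\<^sub>M borel)"
proof (rule caratheodory_measurable[OF Q_measurable])
  show "continuous_on UNIV (Q n u)" for u
    unfolding Q_def[abs_def] e_def
    by (intro continuous_on_diff continuous_on_char_integral levy_measureD(1)[OF L] levy_measureD(1)[OF nu] integrables)
qed

lemma B_measurable: "B n \<in> borel_measurable borel"
  unfolding B_def[abs_def] by (intro borel_measurable_diff borel_measurable_const meas integrables)

lemma \<beta>_measurable: "\<beta> n \<in> borel_measurable borel"
  unfolding \<beta>_def[abs_def]
  by (intro borel_measurable_add borel_measurable_diff borel_measurable_const meas_vector integrables b)

lemma B_integrable: "integrable lborel (\<lambda>u. indicator {0..t} u *\<^sub>R B n u)"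
proof (rule integrable_on_interval[OF B_measurable])
  show "AE u in lborel. u \<in> {0..t} \<longrightarrow> norm (B n u) \<le> c n * K"
    using mK
  proof eventually_elim
    case (elim u)
    have "0 \<le> B n u" by (rule fs_boundedD(3)[OF Q_fs])
    moreover have "0 \<le> (LINT y|\<nu>. far n y * cut y)" by (intro integral_nonneg_AE) simp
    moreover have "norm (LINT y|L u. far n y) \<le> c n * m u"
      by (rule norm_integral_L_le) (use far_le in simp)
    moreover have "c n * m u \<le> c n * K" if "u \<in> {0..t}"
      using elim that by (intro mult_left_mono) (auto simp: c_def)
    ultimately show ?case unfolding B_def real_norm_def by linarith
  qed
qed

lemma \<beta>_integrable: "integrable lborel (\<lambda>u. indicator {0..t} u *\<^sub>R \<beta> n u)"
proof (rule integrable_on_interval[OF \<beta>_measurable])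
  show "AE u in lborel. u \<in> {0..t} \<longrightarrow> norm (\<beta> n u) \<le> K + c n * K + (R * c n) * (LINT y|\<nu>. levy_weight y)"
    using mK bK
  proof eventually_elim
    case (elim u)
    have "norm (LINT y|L u. (far n y * near y) *\<^sub>R y) \<le> c n * m u"
      by (intro norm_integral_L_le far_near_norm_le)
    moreover have "c n * m u \<le> c n * K" if "u \<in> {0..t}"
      using elim that by (intro mult_left_mono) (auto simp: c_def)
    moreover have "norm (LINT y|\<nu>. (far n y * cut y) *\<^sub>R y) \<le> (R * c n) * (LINT y|\<nu>. levy_weight y)"
      by (intro nu_bound far_cut_norm_le)
    moreover have "norm (b u) \<le> K" if "u \<in> {0..t}" using elim that by simp
    ultimately show ?case
      unfolding \<beta>_def
      by (auto intro!: order_trans[OF norm_triangle_ineq] add_mono order_trans[OF norm_triangle_ineq4] elim: order_trans)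
  qed
qed

text \<open>The constant is exactly 1 because the norm of \<open>Q\<close> is bounded by the very
  mass \<open>B\<close> that is subtracted in the exponent: after integration in time, exp
  (\<open>H\<close>) costs exp \<Theta> and the constant factor exp (-\<Theta>) repays it. The drift
  enters as a character.\<close>

lemma exp_Dn_fs: "fs_bounded (\<lambda>\<xi>. exp (LBINT u. indicator {0..t} u *\<^sub>R Dn n u \<xi>)) 1"
proof -
  define H where "H \<xi> = (LBINT u. complex_of_real (indicator {0..t} u) * Q n u \<xi>)" for \<xi>
  define \<Theta> where "\<Theta> = (LBINT u. indicator {0..t} u * B n u)"
  have Bi: "integrable lborel (\<lambda>u. indicator {0..t} u * B n u)" using B_integrable by simp
  have H: "fs_bounded H \<Theta>"
    unfolding H_def[abs_def] \<Theta>_def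
  proof (rule fs_bounded_parameter[OF sigma_finite_lborel _ _ Bi])
    show "fs_bounded (\<lambda>\<xi>. complex_of_real (indicator {0..t} u) * Q n u \<xi>) (indicator {0..t} u * B n u)" for u
      by (intro fs_bounded_cmult Q_fs) simp
    show "(\<lambda>(u, \<xi>). complex_of_real (indicator {0..t} u) * Q n u \<xi>) \<in> borel_measurable (lborel \<Otimes>\<^sub>M borel)"
      using Q_meas[of n] unfolding case_prod_beta' by measurable
  qed
  have Qi: "integrable lborel (\<lambda>u. complex_of_real (indicator {0..t} u) * Q n u \<xi>)" for \<xi>
  proof (rule Bochner_Integration.integrable_bound[OF Bi])
    show "(\<lambda>u. complex_of_real (indicator {0..t} u) * Q n u \<xi>) \<in> borel_measurable lborel"
      using Q_measurable by measurable
    show "AE u in lborel. norm (complex_of_real (indicator {0..t} u) * Q n u \<xi>) \<le> norm (indicator {0..t} u * B n u)"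
      using fs_boundedD(2)[OF Q_fs] fs_boundedD(3)[OF Q_fs] by (intro AE_I2) (simp add: norm_mult abs_mult mult_left_mono)
  qed
  have eq: "(LBINT u. indicator {0..t} u *\<^sub>R Dn n u \<xi>) =
    \<i> * complex_of_real ((LBINT u. indicator {0..t} u *\<^sub>R \<beta> n u) \<bullet> \<xi>) + (H \<xi> - complex_of_real \<Theta>)" for \<xi>
  proof -
    have 1: "integrable lborel (\<lambda>u. \<i> * complex_of_real ((indicator {0..t} u *\<^sub>R \<beta> n u) \<bullet> \<xi>))"
      by (intro integrable_mult_right integrable_of_real integrable_inner_left \<beta>_integrable)
    have 2: "integrable lborel (\<lambda>u. complex_of_real (indicator {0..t} u * B n u))"
      using Bi by (simp only: complex_of_real_integrable_eq)
    have "(LBINT u. indicator {0..t} u *\<^sub>R Dn n u \<xi>) =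
      (LBINT u. \<i> * complex_of_real ((indicator {0..t} u *\<^sub>R \<beta> n u) \<bullet> \<xi>) +
        (complex_of_real (indicator {0..t} u) * Q n u \<xi> - complex_of_real (indicator {0..t} u * B n u)))"
      by (intro Bochner_Integration.integral_cong refl) (simp add: Dn_eq scaleR_conv_of_real algebra_simps)
    also have "\<dots> = (LBINT u. \<i> * complex_of_real ((indicator {0..t} u *\<^sub>R \<beta> n u) \<bullet> \<xi>)) +
        (H \<xi> - (LBINT u. complex_of_real (indicator {0..t} u * B n u)))"
      unfolding H_def
      by (simp only: Bochner_Integration.integral_add Bochner_Integration.integral_diff Bochner_Integration.integrable_diff 1 2 Qi)
    finally show ?thesis
      unfolding \<Theta>_def integral_mult_right_zero integral_complex_of_real integral_inner_left[OF \<beta>_integrable] .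
  qed
  have "fs_bounded (\<lambda>\<xi>. iexp ((LBINT u. indicator {0..t} u *\<^sub>R \<beta> n u) \<bullet> \<xi>) *
      (exp (- complex_of_real \<Theta>) * exp (H \<xi>))) (1 * (exp (- \<Theta>) * exp \<Theta>))"
    by (intro fs_bounded_mult fs_bounded_char fs_bounded_cmult fs_bounded_exp H) (simp add: norm_exp_eq_Re)
  then show ?thesis
    unfolding eq by (simp add: exp_add exp_diff exp_minus field_simps)
qed

theorem exp_D_fs:
  "fs_bounded (\<lambda>\<xi>. exp ((LINT u:{0..t}|lborel. additive_symbol b L u \<xi>) - complex_of_real t * small_jump_symbol \<nu> R \<xi>)) 1"
proof -
  have "fs_bounded (\<lambda>\<xi>. exp (LBINT u. indicator {0..t} u *\<^sub>R D u \<xi>)) 1"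
    by (rule fs_bounded_limit[where h = "\<lambda>n \<xi>. exp (LBINT u. indicator {0..t} u *\<^sub>R Dn n u \<xi>)"])
      (intro exp_Dn_fs tendsto_exp D_integral_tendsto)+
  moreover have "(LBINT u. indicator {0..t} u *\<^sub>R D u \<xi>) =
     (LINT u:{0..t}|lborel. additive_symbol b L u \<xi>) - complex_of_real t * small_jump_symbol \<nu> R \<xi>" for \<xi>
  proof -
    have k2: "(LINT y|\<nu>. kernel2 \<xi> y) = small_jump_symbol \<nu> R \<xi>"
      unfolding small_jump_symbol_def kernel2_def e_def cut_def ..
    have k1: "\<i> * complex_of_real (b u \<bullet> \<xi>) + (LINT y|L u. kernel1 \<xi> y) = additive_symbol b L u \<xi>" for u
    proof -
      have "kernel1 \<xi> y = iexp (y \<bullet> \<xi>) - 1 - \<i> * complex_of_real (y \<bullet> \<xi>) * indicator {y. norm y \<le> 1} y" for y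
        by (simp add: kernel1_def e_def near_def indicator_def)
      then show ?thesis unfolding additive_symbol_def levy_symbol_def by simp
    qed
    have Dk: "D u \<xi> = additive_symbol b L u \<xi> - small_jump_symbol \<nu> R \<xi>" for u
      unfolding D_def k1 k2 ..
    have iD: "integrable lborel (\<lambda>u. indicator {0..t} u *\<^sub>R D u \<xi>)"
      by (rule integrable_on_interval[OF D_measurable(2) D_bounds(2)])
    have iS: "integrable lborel (\<lambda>u. indicator {0..t} u *\<^sub>R small_jump_symbol \<nu> R \<xi>)"
      by (rule integrable_on_interval[where C = "norm (small_jump_symbol \<nu> R \<xi>)"]) auto
    \<comment> \<open>Integrability in time has been established for \<open>D\<close>, so the symbol
      of the process is recovered as \<open>D\<close> plus a constant in time.\<close>
    have "(LINT u:{0..t}|lborel. additive_symbol b L u \<xi>) =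
      (LBINT u. indicator {0..t} u *\<^sub>R D u \<xi> + indicator {0..t} u *\<^sub>R small_jump_symbol \<nu> R \<xi>)"
      unfolding set_lebesgue_integral_def Dk by (simp add: scaleR_diff_right)
    also have "\<dots> = (LBINT u. indicator {0..t} u *\<^sub>R D u \<xi>) + (LBINT u. indicator {0..t} u *\<^sub>R small_jump_symbol \<nu> R \<xi>)"
      by (rule Bochner_Integration.integral_add[OF iD iS])
    also have "(LBINT u. indicator {0..t} u *\<^sub>R small_jump_symbol \<nu> R \<xi>) = complex_of_real t * small_jump_symbol \<nu> R \<xi>"
      using t by (simp add: scaleR_conv_of_real)
    finally show ?thesis by simp
  qed
  ultimately show ?thesis by simp
qed

end

section \<open>Decay of the small-jump factor\<close>

lemma small_jump_symbol_scaled: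
  "small_jump_symbol \<nu> (N * r) (\<xi> /\<^sub>R r) = (LINT y|\<nu>. complex_of_real (indicator {z. norm z \<le> N} (y /\<^sub>R r)) *
     (compensated_exp ((y /\<^sub>R r) \<bullet> \<xi>)))"
  if "0 < r"
proof -
  have "indicator {y. norm y \<le> N * r} y = (indicator {z. norm z \<le> N} (y /\<^sub>R r) :: real)" for y :: 'a
    using that by (simp add: indicator_def field_simps)
  then show ?thesis
    unfolding small_jump_symbol_def by simp
qed

lemma small_jump_integrable_scaled:
  fixes \<nu> :: "'a::euclidean_space measure"
  assumes "levy_measure \<nu>" "0 < r" "0 < N"
  shows "integrable \<nu> (\<lambda>y. complex_of_real (indicator {z. norm z \<le> N} (y /\<^sub>R r)) *
     (compensated_exp ((y /\<^sub>R r) \<bullet> \<xi>)))"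
  by (rule levy_integrable_scaled[OF assms(1,2) _ small_jump_kernel_bound[OF assms(3)]]) measurable

lemma Re_compensated_exp:
  "Re (complex_of_real w * (compensated_exp x)) = - (w * (1 - cos x))"
  by (simp add: Re_exp algebra_simps)

abbreviation cos_integral :: "'a::euclidean_space measure \<Rightarrow> real \<Rightarrow> real \<Rightarrow> 'a \<Rightarrow> real" where
  "cos_integral \<nu> N r \<xi> \<equiv> LINT y|\<nu>. indicator {z. norm z \<le> N} (y /\<^sub>R r) * (1 - cos ((y /\<^sub>R r) \<bullet> \<xi>))"

lemma Re_small_jump_symbol:
  fixes \<nu> :: "'a::euclidean_space measure"
  assumes "levy_measure \<nu>" "0 < r" "0 < N"
  shows "integrable \<nu> (\<lambda>y. indicator {z. norm z \<le> N} (y /\<^sub>R r) * (1 - cos ((y /\<^sub>R r) \<bullet> \<xi>)))"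
    and "Re (small_jump_symbol \<nu> (N * r) (\<xi> /\<^sub>R r)) =
      - (cos_integral \<nu> N r \<xi>)"
proof -
  note i = small_jump_integrable_scaled[OF assms, of \<xi>]
  have "integrable \<nu> (\<lambda>y. - (indicator {z. norm z \<le> N} (y /\<^sub>R r) * (1 - cos ((y /\<^sub>R r) \<bullet> \<xi>))))"
    using integrable_Re[OF i] unfolding Re_compensated_exp .
  from integrable_minus[OF this] show "integrable \<nu> (\<lambda>y. indicator {z. norm z \<le> N} (y /\<^sub>R r) * (1 - cos ((y /\<^sub>R r) \<bullet> \<xi>)))"
    by (simp only: minus_minus)
  show "Re (small_jump_symbol \<nu> (N * r) (\<xi> /\<^sub>R r)) =
      - (cos_integral \<nu> N r \<xi>)"
    unfolding small_jump_symbol_scaled[OF assms(2)] integral_Re[OF i, symmetric] Re_compensated_exp by simp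
qed

text \<open>In \<open>C\<close> the factor max 1 (N^2) trades |z|^2 for the Levy weight on |z| \<le>
  N, and exp (D N) bounds the exponential of the local kernel there. As \<delta> \<le> 1, the term
  in \<delta>^2 is absorbed by \<delta>; hence \<open>C\<close> is free of \<delta> and the bound is
  linear in it.\<close>

lemma small_jump_symbol_local:
  fixes \<nu> :: "'a::euclidean_space measure"
  assumes levy: "levy_measure \<nu>" and r: "0 < r" and N: "0 < N" and \<delta>: "0 < \<delta>" "\<delta> \<le> 1"
    and \<xi>\<^sub>0: "norm \<xi>\<^sub>0 \<le> \<rho>" and D: "D = 2 * hat_norm * real DIM('a)"
    and C: "C = max 1 (N\<^sup>2) * ((\<rho> * D + D\<^sup>2) * exp (D * N))"
    and \<kappa>: "(LINT y|\<nu>. levy_weight (y /\<^sub>R r)) \<le> \<kappa>"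
  shows "\<exists>\<Psi>. fs_bounded \<Psi> (C * \<delta> * \<kappa>) \<and>
    (\<forall>\<xi>. (\<forall>b\<in>Basis. \<bar>(\<xi> - \<xi>\<^sub>0) \<bullet> b\<bar> \<le> \<delta>) \<longrightarrow>
      small_jump_symbol \<nu> (N * r) (\<xi> /\<^sub>R r) - small_jump_symbol \<nu> (N * r) (\<xi>\<^sub>0 /\<^sub>R r) = \<Psi> \<xi>)"
proof (intro exI conjI allI impI)
  have D0: "0 \<le> D" using hat_norm_nonneg by (simp add: D)
  have \<rho>0: "0 \<le> \<rho>" using order_trans[OF norm_ge_zero \<xi>\<^sub>0] .
  have C0: "0 \<le> C" using D0 \<rho>0 by (simp add: C)
  let ?k = "\<lambda>z \<xi>. complex_of_real (indicator {z. norm z \<le> N} z) * local_kernel \<xi>\<^sub>0 \<delta> z \<xi>"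
  let ?\<Psi> = "\<lambda>\<xi>. LINT y|\<nu>. ?k (y /\<^sub>R r) \<xi>"
  have kb: "fs_bounded (?k z) (C * \<delta> * levy_weight z)" for z
  proof (cases "norm z \<le> N")
    case True
    have h1: "(norm \<xi>\<^sub>0 * D * \<delta> + (D * \<delta>)\<^sup>2) * exp (D * \<delta> * norm z) \<le> (\<delta> * (\<rho> * D + D\<^sup>2)) * exp (D * N)"
    proof (intro mult_mono)
      have "norm \<xi>\<^sub>0 * D * \<delta> \<le> \<rho> * D * \<delta>"
        using \<xi>\<^sub>0 D0 \<delta> by (intro mult_right_mono) auto
      moreover have "(D * \<delta>)\<^sup>2 \<le> D\<^sup>2 * \<delta>"
      proof -
        have "\<delta>\<^sup>2 \<le> \<delta>" using \<delta> by (simp add: power2_eq_square mult_left_le)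
        from mult_left_mono[OF this, of "D\<^sup>2"] show ?thesis by (simp add: power_mult_distrib)
      qed
      ultimately show "norm \<xi>\<^sub>0 * D * \<delta> + (D * \<delta>)\<^sup>2 \<le> \<delta> * (\<rho> * D + D\<^sup>2)"
        by (simp add: algebra_simps)
      have "D * \<delta> * norm z \<le> D * N"
      proof -
        have "\<delta> * norm z \<le> 1 * N" using \<delta> True by (intro mult_mono) auto
        from mult_left_mono[OF this D0] show ?thesis by (simp add: mult.assoc)
      qed
      then show "exp (D * \<delta> * norm z) \<le> exp (D * N)" by simp
      show "0 \<le> \<delta> * (\<rho> * D + D\<^sup>2)" using \<delta> \<rho>0 D0 by simp
    qed simp
    have h2: "(norm z)\<^sup>2 \<le> max 1 (N\<^sup>2) * levy_weight z"
      using cut_sq_le[OF N, of z] True by simp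
    have "(norm z)\<^sup>2 * ((norm \<xi>\<^sub>0 * D * \<delta> + (D * \<delta>)\<^sup>2) * exp (D * \<delta> * norm z)) \<le>
       (max 1 (N\<^sup>2) * levy_weight z) * ((\<delta> * (\<rho> * D + D\<^sup>2)) * exp (D * N))"
      by (rule mult_mono[OF h2 h1]) (use D0 \<delta> in auto)
    also have "\<dots> = C * \<delta> * levy_weight z"
      by (simp only: C mult_ac)
    finally show ?thesis
      using True fs_bounded_mono[OF fs_bounded_local_kernel[OF \<delta>(1) D, of \<xi>\<^sub>0 z]] by simp
  next
    case False
    then show ?thesis using C0 \<delta> by (simp add: fs_bounded_0)
  qed
  have "fs_bounded ?\<Psi> (LINT y|\<nu>. C * \<delta> * levy_weight (y /\<^sub>R r))"
  proof (rule fs_bounded_parameter[OF levy_sigma_finite[OF levy] kb])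
    have km: "(\<lambda>(z, \<xi>). ?k z \<xi>) \<in> borel_measurable (borel \<Otimes>\<^sub>M borel)"
      using local_kernel_measurable[of \<xi>\<^sub>0 \<delta>] unfolding case_prod_beta' by measurable
    have "(\<lambda>(y, \<xi>). (y /\<^sub>R r, \<xi>)) \<in> \<nu> \<Otimes>\<^sub>M borel \<rightarrow>\<^sub>M (borel :: 'a measure) \<Otimes>\<^sub>M (borel :: 'a measure)"
      by (subst measurable_cong_sets[OF sets_pair_measure_cong[OF levy_measureD(1)[OF levy] refl] refl]) measurable
    from measurable_compose[OF this km] show "(\<lambda>(y, \<xi>). ?k (y /\<^sub>R r) \<xi>) \<in> borel_measurable (\<nu> \<Otimes>\<^sub>M borel)"
      by (simp add: case_prod_beta')
    show "integrable \<nu> (\<lambda>y. C * \<delta> * levy_weight (y /\<^sub>R r))"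
      by (rule integrable_mult_right[OF levy_nn_integral_scaled(1)[OF levy r]])
  qed
  moreover have "(LINT y|\<nu>. C * \<delta> * levy_weight (y /\<^sub>R r)) \<le> C * \<delta> * \<kappa>"
    using \<kappa> C0 \<delta> by (simp add: mult_left_mono)
  ultimately show "fs_bounded ?\<Psi> (C * \<delta> * \<kappa>)"
    by (rule fs_bounded_mono)
  fix \<xi> assume \<xi>: "\<forall>b\<in>Basis. \<bar>(\<xi> - \<xi>\<^sub>0) \<bullet> b\<bar> \<le> \<delta>"
  have lk: "local_kernel \<xi>\<^sub>0 \<delta> z \<xi> = (compensated_exp (z \<bullet> \<xi>)) -
    (compensated_exp (z \<bullet> \<xi>\<^sub>0))" for z
    using \<xi> by (intro local_kernel_eq \<delta>) auto
  show "small_jump_symbol \<nu> (N * r) (\<xi> /\<^sub>R r) - small_jump_symbol \<nu> (N * r) (\<xi>\<^sub>0 /\<^sub>R r) = ?\<Psi> \<xi>"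
    unfolding small_jump_symbol_scaled[OF r] lk right_diff_distrib[of "complex_of_real _" "_ - _ - _" "_ - _ - _"]
    by (rule Bochner_Integration.integral_diff[symmetric]; rule small_jump_integrable_scaled[OF levy r N])
qed

section \<open>A partition of unity on a lattice of mesh \<delta>\<close>

definition lattice_point :: "real \<Rightarrow> ('a \<Rightarrow> int) \<Rightarrow> 'a::euclidean_space" where
  "lattice_point \<delta> k = (\<Sum>b\<in>Basis. (\<delta> * real_of_int (k b)) *\<^sub>R b)"

text \<open>A tensor product of hats around \<open>lattice_point \<delta> k\<close>. The argument is
  written in the affine form of \<open>fs_bounded_hat\<close>, which gives a norm independent of
  \<delta> and of \<open>k\<close>.\<close>

definition lattice_hat :: "real \<Rightarrow> ('a \<Rightarrow> int) \<Rightarrow> 'a::euclidean_space \<Rightarrow> complex" where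
  "lattice_hat \<delta> k \<xi> = (\<Prod>b\<in>Basis. complex_of_real (hat (1 / \<delta> * (b \<bullet> \<xi>) + (- real_of_int (k b)))))"

lemma fs_bounded_lattice_hat: "fs_bounded (lattice_hat \<delta> k :: 'a::euclidean_space \<Rightarrow> complex) (hat_norm ^ DIM('a))"
  unfolding lattice_hat_def[abs_def]
proof -
  have "fs_bounded (\<lambda>\<xi>. \<Prod>b\<in>Basis. complex_of_real (hat (1 / \<delta> * (b \<bullet> \<xi>) + (- real_of_int (k b)))))
    (\<Prod>b\<in>(Basis::'a set). hat_norm)"
    by (intro fs_bounded_prod fs_bounded_hat)
  then show "fs_bounded (\<lambda>\<xi>::'a. \<Prod>b\<in>Basis. complex_of_real (hat (1 / \<delta> * (b \<bullet> \<xi>) + (- real_of_int (k b))))) (hat_norm ^ DIM('a))"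
    by simp
qed

text \<open>The one-dimensional partitions of unity in the coordinates are multiplied and the
  product of sums is expanded.\<close>

lemma sum_lattice_hat:
  fixes \<xi> :: "'a::euclidean_space"
  assumes \<delta>: "0 < \<delta>" and \<xi>: "norm \<xi> \<le> real_of_int m * \<delta>"
  shows "(\<Sum>k\<in>PiE Basis (\<lambda>_. {-m..m}). lattice_hat \<delta> k \<xi>) = 1"
proof -
  have "(\<Sum>k\<in>PiE Basis (\<lambda>_. {-m..m}). lattice_hat \<delta> k \<xi>) =
    (\<Prod>b\<in>(Basis::'a set). \<Sum>j\<in>{-m..m}. complex_of_real (hat (1 / \<delta> * (b \<bullet> \<xi>) + (- real_of_int j))))"
    unfolding lattice_hat_def by (rule prod_sum_PiE[symmetric]) auto
  also have "\<dots> = (\<Prod>b\<in>(Basis::'a set). 1)"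
  proof (intro prod.cong refl)
    fix b :: 'a assume "b \<in> Basis"
    from order_trans[OF Basis_le_norm[OF this] \<xi>] have "\<bar>b \<bullet> \<xi>\<bar> \<le> real_of_int m * \<delta>"
      by (simp only: inner_commute[of b \<xi>])
    then have "\<bar>1 / \<delta> * (b \<bullet> \<xi>)\<bar> \<le> real_of_int m"
      using \<delta> by (simp add: pos_divide_le_eq)
    from sum_hat[OF this] show "(\<Sum>j\<in>{-m..m}. complex_of_real (hat (1 / \<delta> * (b \<bullet> \<xi>) + (- real_of_int j)))) = 1"
      by (simp flip: of_real_sum)
  qed
  finally show ?thesis by simp
qed

lemma lattice_hat_support:
  assumes \<delta>: "0 < \<delta>" and nz: "lattice_hat \<delta> k \<xi> \<noteq> 0" and b: "b \<in> Basis"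
  shows "\<bar>(\<xi> - lattice_point \<delta> k) \<bullet> b\<bar> \<le> \<delta>"
proof -
  have "hat (1 / \<delta> * (b \<bullet> \<xi>) + (- real_of_int (k b))) \<noteq> 0"
    using nz b unfolding lattice_hat_def by auto
  then have "\<bar>1 / \<delta> * (b \<bullet> \<xi>) + (- real_of_int (k b))\<bar> < 1"
    using hat_eq_0 not_le by blast
  then have "\<delta> * \<bar>1 / \<delta> * (b \<bullet> \<xi>) + (- real_of_int (k b))\<bar> \<le> \<delta> * 1"
    using \<delta> by (intro mult_left_mono) auto
  moreover have "\<delta> * \<bar>1 / \<delta> * (b \<bullet> \<xi>) + (- real_of_int (k b))\<bar> = \<bar>\<delta> * (1 / \<delta> * (b \<bullet> \<xi>) + (- real_of_int (k b)))\<bar>"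
    using \<delta> by (simp only: abs_mult abs_of_pos)
  moreover have "\<delta> * (1 / \<delta> * (b \<bullet> \<xi>) + (- real_of_int (k b))) = (\<xi> - lattice_point \<delta> k) \<bullet> b"
    using \<delta> b by (simp add: lattice_point_def inner_diff_left inner_commute[of b \<xi>] algebra_simps)
  ultimately show ?thesis by simp
qed

text \<open>On one cube, exp (t S(\<xi>)) = exp (t S(\<open>\<xi>\<^sub>0\<close>)) exp (t
  \<Psi>(\<xi>)), S being the rescaled symbol. The first factor has modulus at most exp (-c t /
  s(r)), the second has norm at most exp (c t / (2 s(r))). The lower bound is assumed from radius
  \<open>\<rho>\<^sub>1\<close> on but the support starts at twice that radius, which leaves room
  for the centres of cubes that meet the support.\<close>

lemma small_jump_decay:
  fixes \<nu> :: "'a::euclidean_space measure"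
  assumes levy: "levy_measure \<nu>" and N: "0 < N" and c: "0 < c" and s: "\<And>r. 0 < r \<Longrightarrow> 0 < s r" and \<rho>\<^sub>1: "0 < \<rho>\<^sub>1"
    and low: "\<And>r \<xi>. 0 < r \<Longrightarrow> \<rho>\<^sub>1 \<le> norm \<xi> \<Longrightarrow>
      c \<le> s r * (cos_integral \<nu> N r \<xi>)"
    and up: "\<And>r. 0 < r \<Longrightarrow> s r * (LINT y|\<nu>. levy_weight (y /\<^sub>R r)) \<le> \<kappa>"
    and g: "fs_bounded g G" and supp: "\<And>\<xi>. g \<xi> \<noteq> 0 \<Longrightarrow> 2 * \<rho>\<^sub>1 \<le> norm \<xi> \<and> norm \<xi> \<le> \<rho>\<^sub>2"
  shows "\<exists>N\<^sub>0>0. \<forall>r>0. \<forall>t\<ge>0. fs_bounded (\<lambda>\<xi>. g \<xi> * exp (complex_of_real t * small_jump_symbol \<nu> (N * r) (\<xi> /\<^sub>R r)))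
    (N\<^sub>0 * exp (- (c / 2 * t / s r)))"
proof -
  define D where "D = 2 * hat_norm * real DIM('a)"
  define \<rho> where "\<rho> = \<bar>\<rho>\<^sub>2\<bar> + \<rho>\<^sub>1"
  define C where "C = max 1 (N\<^sup>2) * ((\<rho> * D + D\<^sup>2) * exp (D * N))"
  have D0: "0 \<le> D" using hat_norm_nonneg by (simp add: D_def)
  have C0: "0 \<le> C" using D0 \<rho>\<^sub>1 by (simp add: C_def \<rho>_def)
  have \<kappa>0: "0 \<le> \<kappa>"
  proof -
    have "0 \<le> (LINT y|\<nu>. min 1 ((norm (y /\<^sub>R 1))\<^sup>2))" by (intro integral_nonneg_AE) simp
    then have "0 \<le> s 1 * (LINT y|\<nu>. min 1 ((norm (y /\<^sub>R 1))\<^sup>2))"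
      using s[of 1] by (intro mult_nonneg_nonneg) auto
    then show ?thesis using up[OF zero_less_one] by (rule order_trans)
  qed
  \<comment> \<open>The first entry is what \<open>small_jump_symbol_local\<close> asks for. The
    second keeps a centre within distance \<open>\<rho>\<^sub>1\<close> of the points of its cube,
    in the l1 norm. The third lets the variation of the symbol use up at most half of
    \<open>c\<close>; the added 1 keeps the denominator positive.\<close>
  define \<delta> where "\<delta> = min 1 (min (\<rho>\<^sub>1 / real DIM('a)) (c / (2 * (C * \<kappa> + 1))))"
  have CK: "0 < C * \<kappa> + 1" using C0 \<kappa>0 by (simp add: add_nonneg_pos)
  have \<delta>: "0 < \<delta>" "\<delta> \<le> 1" using \<rho>\<^sub>1 c CK by (auto simp: \<delta>_def)
  have \<delta>\<rho>: "real DIM('a) * \<delta> \<le> \<rho>\<^sub>1"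
  proof -
    have "\<delta> \<le> \<rho>\<^sub>1 / real DIM('a)" by (simp add: \<delta>_def)
    then show ?thesis by (simp add: pos_le_divide_eq mult.commute)
  qed
  have \<delta>c: "C * \<delta> * \<kappa> \<le> c / 2"
  proof -
    have "\<delta> \<le> c / (2 * (C * \<kappa> + 1))" by (simp add: \<delta>_def)
    then have "\<delta> * (2 * (C * \<kappa> + 1)) \<le> c" using CK by (simp add: pos_le_divide_eq)
    then show ?thesis using \<delta> by (simp add: algebra_simps)
  qed
  \<comment> \<open>Enough lattice points in each coordinate for the hats to sum to 1 on the support
    of \<open>g\<close>.\<close>
  define m where "m = \<lceil>\<bar>\<rho>\<^sub>2\<bar> / \<delta>\<rceil>"
  have m: "norm \<xi> \<le> real_of_int m * \<delta>" if "g \<xi> \<noteq> 0" for \<xi>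
  proof -
    have "\<bar>\<rho>\<^sub>2\<bar> / \<delta> \<le> real_of_int m" unfolding m_def by linarith
    then have "\<bar>\<rho>\<^sub>2\<bar> \<le> real_of_int m * \<delta>" using \<delta> by (simp add: pos_divide_le_eq)
    then show ?thesis using supp[OF that] by linarith
  qed
  let ?I = "PiE (Basis :: 'a set) (\<lambda>_. {-m..m})"
  let ?A = "G * hat_norm ^ DIM('a)"
  have A0: "0 \<le> ?A" using fs_boundedD(3)[OF g] hat_norm_nonneg by simp
  \<comment> \<open>One \<open>?A\<close> per cube; the extra 1 makes the constant positive even if
    the sum is 0.\<close>
  define N\<^sub>0 where "N\<^sub>0 = (\<Sum>k\<in>?I. ?A) + 1"
  have N\<^sub>0: "0 < N\<^sub>0" unfolding N\<^sub>0_def using A0 by (intro add_nonneg_pos sum_nonneg) auto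
  have main: "fs_bounded (\<lambda>\<xi>. g \<xi> * exp (complex_of_real t * small_jump_symbol \<nu> (N * r) (\<xi> /\<^sub>R r)))
    (N\<^sub>0 * exp (- (c / 2 * t / s r)))" if r: "0 < r" and t: "0 \<le> t" for r t
  proof -
    let ?S = "\<lambda>\<xi>. small_jump_symbol \<nu> (N * r) (\<xi> /\<^sub>R r)"
    let ?E = "exp (- (c / 2 * t / s r))"
    have piece: "fs_bounded (\<lambda>\<xi>. g \<xi> * lattice_hat \<delta> k \<xi> * exp (complex_of_real t * ?S \<xi>)) (?A * ?E)" for k
    \<comment> \<open>A hat that misses the support of \<open>g\<close> contributes 0. It has to be
      set apart because its centre may lie where no lower bound is available.\<close>
    proof (cases "\<exists>\<xi>. g \<xi> * lattice_hat \<delta> k \<xi> \<noteq> 0")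
      case False
      then have "g \<xi> * lattice_hat \<delta> k \<xi> = 0" for \<xi> by blast
      then show ?thesis using A0 by (simp only: mult_zero_left) (rule fs_bounded_0, simp)
    next
      case True
      then obtain \<eta> where \<eta>: "g \<eta> \<noteq> 0" "lattice_hat \<delta> k \<eta> \<noteq> 0" by auto
      let ?\<xi>0 = "lattice_point \<delta> k :: 'a"
      have "norm (\<eta> - ?\<xi>0) \<le> (\<Sum>b\<in>Basis. \<bar>(\<eta> - ?\<xi>0) \<bullet> b\<bar>)" by (rule norm_le_l1)
      also have "\<dots> \<le> (\<Sum>b\<in>(Basis::'a set). \<delta>)"
        by (intro sum_mono lattice_hat_support[OF \<delta>(1) \<eta>(2)])
      also have "\<dots> \<le> \<rho>\<^sub>1" using \<delta>\<rho> by simp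
      finally have near: "norm (\<eta> - ?\<xi>0) \<le> \<rho>\<^sub>1" .
      have low\<xi>0: "\<rho>\<^sub>1 \<le> norm ?\<xi>0"
        using supp[OF \<eta>(1)] near norm_triangle_ineq2[of \<eta> ?\<xi>0] by linarith
      have up\<xi>0: "norm ?\<xi>0 \<le> \<rho>"
        using supp[OF \<eta>(1)] near norm_triangle_ineq3[of \<eta> ?\<xi>0] unfolding \<rho>_def by linarith
      have "(LINT y|\<nu>. levy_weight (y /\<^sub>R r)) \<le> \<kappa> / s r"
        using up[OF r] s[OF r] by (simp add: pos_le_divide_eq mult.commute)
      from small_jump_symbol_local[OF levy r N \<delta> up\<xi>0 D_def C_def this]
      obtain \<Psi> where \<Psi>: "fs_bounded \<Psi> (C * \<delta> * (\<kappa> / s r))"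
        and \<Psi>_eq: "\<And>\<xi>. (\<And>b. b \<in> Basis \<Longrightarrow> \<bar>(\<xi> - ?\<xi>0) \<bullet> b\<bar> \<le> \<delta>) \<Longrightarrow> ?S \<xi> - ?S ?\<xi>0 = \<Psi> \<xi>"
        by blast
      have "c / s r \<le> cos_integral \<nu> N r ?\<xi>0"
        using low[OF r low\<xi>0] s[OF r] by (simp add: pos_divide_le_eq mult.commute)
      then have "t * Re (?S ?\<xi>0) \<le> t * (- (c / s r))"
        unfolding Re_small_jump_symbol(2)[OF levy r N] using t by (intro mult_left_mono) auto
      then have e0: "norm (exp (complex_of_real t * ?S ?\<xi>0)) \<le> exp (t * (- (c / s r)))"
        by (simp add: norm_exp_eq_Re)
      have "fs_bounded (\<lambda>\<xi>. g \<xi> * lattice_hat \<delta> k \<xi> * (exp (complex_of_real t * ?S ?\<xi>0) * exp (complex_of_real t * \<Psi> \<xi>)))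
        (?A * (exp (t * (- (c / s r))) * exp (t * (C * \<delta> * (\<kappa> / s r)))))"
        using t e0 by (intro fs_bounded_mult g fs_bounded_lattice_hat fs_bounded_cmult fs_bounded_exp \<Psi>) auto
      also have "(\<lambda>\<xi>. g \<xi> * lattice_hat \<delta> k \<xi> * (exp (complex_of_real t * ?S ?\<xi>0) * exp (complex_of_real t * \<Psi> \<xi>))) =
        (\<lambda>\<xi>. g \<xi> * lattice_hat \<delta> k \<xi> * exp (complex_of_real t * ?S \<xi>))"
      proof
        fix \<xi>
        show "g \<xi> * lattice_hat \<delta> k \<xi> * (exp (complex_of_real t * ?S ?\<xi>0) * exp (complex_of_real t * \<Psi> \<xi>)) =
          g \<xi> * lattice_hat \<delta> k \<xi> * exp (complex_of_real t * ?S \<xi>)"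
        proof (cases "lattice_hat \<delta> k \<xi> = 0")
          case False
          from \<Psi>_eq[OF lattice_hat_support[OF \<delta>(1) False]] have "?S \<xi> = ?S ?\<xi>0 + \<Psi> \<xi>"
            by (simp add: algebra_simps)
          then show ?thesis by (simp only: distrib_left exp_add)
        qed simp
      qed
      finally have fs: "fs_bounded (\<lambda>\<xi>. g \<xi> * lattice_hat \<delta> k \<xi> * exp (complex_of_real t * ?S \<xi>))
        (?A * (exp (t * (- (c / s r))) * exp (t * (C * \<delta> * (\<kappa> / s r)))))" .
      have "t / s r * (- c + C * \<delta> * \<kappa>) \<le> t / s r * (- (c / 2))"
        using t s[OF r] \<delta>c by (intro mult_left_mono) auto
      then have "exp (t * (- (c / s r))) * exp (t * (C * \<delta> * (\<kappa> / s r))) \<le> ?E"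
        unfolding exp_add[symmetric] by (simp add: algebra_simps)
      from mult_left_mono[OF this A0] show ?thesis
        by (rule fs_bounded_mono[OF fs])
    qed
    have "fs_bounded (\<lambda>\<xi>. \<Sum>k\<in>?I. g \<xi> * lattice_hat \<delta> k \<xi> * exp (complex_of_real t * ?S \<xi>)) (\<Sum>k\<in>?I. ?A * ?E)"
      by (intro fs_bounded_sum piece)
    also have "(\<lambda>\<xi>. \<Sum>k\<in>?I. g \<xi> * lattice_hat \<delta> k \<xi> * exp (complex_of_real t * ?S \<xi>)) =
      (\<lambda>\<xi>. g \<xi> * exp (complex_of_real t * ?S \<xi>))"
    proof
      fix \<xi>
      have "(\<Sum>k\<in>?I. g \<xi> * lattice_hat \<delta> k \<xi> * exp (complex_of_real t * ?S \<xi>)) =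
        g \<xi> * (\<Sum>k\<in>?I. lattice_hat \<delta> k \<xi>) * exp (complex_of_real t * ?S \<xi>)"
        by (simp only: sum_distrib_left sum_distrib_right)
      then show "(\<Sum>k\<in>?I. g \<xi> * lattice_hat \<delta> k \<xi> * exp (complex_of_real t * ?S \<xi>)) = g \<xi> * exp (complex_of_real t * ?S \<xi>)"
        using sum_lattice_hat[OF \<delta>(1) m, of \<xi>] by (cases "g \<xi> = 0") simp_all
    qed
    finally show ?thesis
    proof (rule fs_bounded_mono)
      have "(\<Sum>k\<in>?I. ?A * ?E) = (\<Sum>k\<in>?I. ?A) * ?E" by (rule sum_distrib_right[symmetric])
      also have "\<dots> \<le> N\<^sub>0 * ?E" unfolding N\<^sub>0_def by (intro mult_right_mono) auto
      finally show "(\<Sum>k\<in>?I. ?A * ?E) \<le> N\<^sub>0 * ?E" .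
    qed
  qed
  then show ?thesis using N\<^sub>0 by blast
qed

section \<open>The additive process\<close>

lemma additive_process_measurable:
  assumes "additive_process M F Z a \<Lambda>" "0 \<le> t"
  shows "Z t \<in> borel_measurable M"
  using assms by (intro measurable_from_subalg[of M "F t"]) (simp_all add: additive_process_def usual_filtration_def)

lemma additive_process_char:
  fixes Z :: "real \<Rightarrow> 'w \<Rightarrow> 'a::euclidean_space"
  assumes process: "additive_process M F Z a \<Lambda>" and levy: "levy_measure \<nu>"
    and dominates: "\<And>t f. 0 \<le> t \<Longrightarrow> f \<in> borel_measurable borel \<Longrightarrow> (\<integral>\<^sup>+ y. f y \<partial>\<nu>) \<le> (\<integral>\<^sup>+ y. f y \<partial>\<Lambda> t)"
    and R: "0 < R" and t: "0 \<le> t"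
  shows "\<exists>E. fs_bounded E 1 \<and> (\<forall>\<xi>. (LINT \<omega>|M. iexp (\<xi> \<bullet> Z t \<omega>)) =
    E \<xi> * exp (complex_of_real t * small_jump_symbol \<nu> R \<xi>))"
proof -
  \<comment> \<open>Freezing the triplet at its initial value for negative times yields a family on
    the whole real line and changes nothing on [0, t].\<close>
  let ?L = "\<lambda>u. \<Lambda> (max 0 u)" and ?b = "\<lambda>u. a (max 0 u)"
  have triplet: "bounded_triplet a \<Lambda>" using process by (simp add: additive_process_def)
  have mx: "max 0 \<in> borel \<rightarrow>\<^sub>M restrict_space borel {0::real..}"
    by (rule measurable_restrict_space2) auto
  \<comment> \<open>\<open>bounded_triplet\<close> speaks of positive horizons, whereas
    \<open>t\<close> may be 0.\<close>
  have "0 < max 1 t" by simp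
  then obtain K where K: "AE u in lborel. u \<in> {0..max 1 t} \<longrightarrow> norm (a u) \<le> K"
    "AE u in lborel. u \<in> {0..max 1 t} \<longrightarrow> (\<integral>\<^sup>+ y. ennreal (levy_weight y) \<partial>\<Lambda> u) \<le> ennreal K"
    using triplet unfolding bounded_triplet_def by blast
  have lev: "levy_measure (\<Lambda> u)" if "0 \<le> u" for u
    using triplet that unfolding bounded_triplet_def measurable_levy_family_def by blast
  interpret dominating_family ?L ?b \<nu> t R "max 0 K"
  proof
    show "levy_measure (?L u)" for u by (rule lev) simp
    show "(\<integral>\<^sup>+ y. f y \<partial>\<nu>) \<le> (\<integral>\<^sup>+ y. f y \<partial>?L u)" if "f \<in> borel_measurable borel" for f u
      using that by (intro dominates) auto
    show "(\<lambda>u. LINT y|?L u. f y) \<in> borel_measurable borel" if "\<And>u. integrable (?L u) f" for f :: "'a \<Rightarrow> real"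
    proof -
      have "integrable (\<Lambda> u) f" if "0 \<le> u" for u
        using \<open>\<And>u. integrable (?L u) f\<close>[of u] that by (simp add: max_absorb2)
      then have "(\<lambda>u. LINT y|\<Lambda> u. f y) \<in> borel_measurable (restrict_space borel {0..})"
        using triplet unfolding bounded_triplet_def measurable_levy_family_def by blast
      from measurable_compose[OF mx this] show ?thesis .
    qed
    show "?b \<in> borel_measurable borel"
      using measurable_compose[OF mx] triplet unfolding bounded_triplet_def by blast
    show "AE u in lborel. u \<in> {0..t} \<longrightarrow> norm (?b u) \<le> max 0 K"
      using K(1) by eventually_elim (auto simp: max_absorb2 intro: max.coboundedI2)
    show "AE u in lborel. u \<in> {0..t} \<longrightarrow> (\<integral>\<^sup>+ y. ennreal (levy_weight y) \<partial>?L u) \<le> ennreal (max 0 K)"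
      using K(2)
    proof eventually_elim
      case (elim u)
      show ?case
      proof
        assume u: "u \<in> {0..t}"
        then have "(\<integral>\<^sup>+ y. ennreal (levy_weight y) \<partial>\<Lambda> u) \<le> ennreal K" using elim by auto
        also have "\<dots> \<le> ennreal (max 0 K)" by (intro ennreal_leI) simp
        finally show "(\<integral>\<^sup>+ y. ennreal (levy_weight y) \<partial>?L u) \<le> ennreal (max 0 K)"
          using u by (simp add: max_absorb2)
      qed
    qed
  qed (use levy t R in auto)
  let ?E = "\<lambda>\<xi>. exp ((LINT u:{0..t}|lborel. additive_symbol ?b ?L u \<xi>) - complex_of_real t * small_jump_symbol \<nu> R \<xi>)"
  have "(LINT \<omega>|M. iexp (\<xi> \<bullet> Z t \<omega>)) = ?E \<xi> * exp (complex_of_real t * small_jump_symbol \<nu> R \<xi>)" for \<xi>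
  proof -
    note [measurable] = additive_process_measurable[OF process t] additive_process_measurable[OF process order_refl]
    have "AE \<omega> in M. Z 0 \<omega> = 0" using process by (simp add: additive_process_def)
    then have "(LINT \<omega>|M. iexp (\<xi> \<bullet> Z t \<omega>)) = (LINT \<omega>|M. iexp (\<xi> \<bullet> (Z t \<omega> - Z 0 \<omega>)))"
      by (intro integral_cong_AE) auto
    also have "\<dots> = exp (LINT u:{0..t}|lborel. additive_symbol a \<Lambda> u \<xi>)"
      using process t by (simp add: additive_process_def)
    also have "(LINT u:{0..t}|lborel. additive_symbol a \<Lambda> u \<xi>) = (LINT u:{0..t}|lborel. additive_symbol ?b ?L u \<xi>)"
      unfolding set_lebesgue_integral_def
      by (intro Bochner_Integration.integral_cong refl) (auto simp: additive_symbol_def indicator_def max_absorb2)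
    finally show ?thesis by (simp flip: exp_add)
  qed
  then show ?thesis using exp_D_fs by blast
qed

text \<open>Under the inverse transform, translation of the argument by \<open>X\<close> is
  multiplication by a character; Fubini averages the characters into the characteristic
  function.\<close>

lemma expectation_inv_fourier:
  fixes X :: "'w \<Rightarrow> 'a::euclidean_space"
  assumes "prob_space M" and X: "X \<in> borel_measurable M"
    and int: "integrable lborel (fourier \<phi>)" and inv: "\<And>x. inv_fourier (fourier \<phi>) x = \<phi> x"
  shows "(LINT \<omega>|M. \<phi> (x + X \<omega>)) = inv_fourier (\<lambda>\<xi>. fourier \<phi> \<xi> * (LINT \<omega>|M. iexp (\<xi> \<bullet> X \<omega>))) x"
proof -
  interpret prob_space M by fact
  let ?m = "complex_of_real (inverse (gauss_mass TYPE('a)))"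
  note [measurable] = X borel_measurable_integrable[OF int]
  have "(LINT \<omega>|M. \<phi> (x + X \<omega>)) =
    (LINT \<omega>|M. ?m * (LBINT \<xi>. iexp (x \<bullet> \<xi>) * (fourier \<phi> \<xi> * iexp (\<xi> \<bullet> X \<omega>))))"
  proof (intro Bochner_Integration.integral_cong refl)
    fix \<omega>
    have eq: "iexp ((x + X \<omega>) \<bullet> \<xi>) * fourier \<phi> \<xi> =
      iexp (x \<bullet> \<xi>) * (fourier \<phi> \<xi> * iexp (\<xi> \<bullet> X \<omega>))" for \<xi>
      by (simp add: inner_add_left exp_add distrib_left inner_commute[of \<xi>])
    show "\<phi> (x + X \<omega>) = ?m * (LBINT \<xi>. iexp (x \<bullet> \<xi>) * (fourier \<phi> \<xi> * iexp (\<xi> \<bullet> X \<omega>)))"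
      using inv[of "x + X \<omega>"] unfolding inv_fourier_eq eq by (rule sym)
  qed
  also have "\<dots> = ?m * (LINT \<omega>|M. LINT \<xi>|lborel. iexp (x \<bullet> \<xi>) * (fourier \<phi> \<xi> * iexp (\<xi> \<bullet> X \<omega>)))"
    by (rule integral_mult_right_zero)
  also have "(LINT \<omega>|M. LINT \<xi>|lborel. iexp (x \<bullet> \<xi>) * (fourier \<phi> \<xi> * iexp (\<xi> \<bullet> X \<omega>))) =
    (LINT \<xi>|lborel. LINT \<omega>|M. iexp (x \<bullet> \<xi>) * (fourier \<phi> \<xi> * iexp (\<xi> \<bullet> X \<omega>)))"
  proof (rule Fubini_product_bound[symmetric, where B = "\<lambda>_. 1" and G = "\<lambda>\<xi>. norm (fourier \<phi> \<xi>)", OF sigma_finite_measure_axioms sigma_finite_lborel])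
    show "integrable lborel (\<lambda>\<xi>. norm (fourier \<phi> \<xi>))" using int by simp
    show "norm (iexp (x \<bullet> \<xi>) * (fourier \<phi> \<xi> * iexp (\<xi> \<bullet> X \<omega>))) \<le> 1 * norm (fourier \<phi> \<xi>)" for \<omega> \<xi>
      by (simp add: norm_mult)
  qed simp_all
  finally show ?thesis
    unfolding inv_fourier_eq integral_mult_right_zero .
qed

lemma compact_support_annulus:
  fixes g :: "'a::euclidean_space \<Rightarrow> complex"
  assumes "g \<in> smooth_compact_support (ball 0 R - ball 0 \<rho>)" "g \<xi> \<noteq> 0"
  shows "\<rho> \<le> norm \<xi>" "norm \<xi> < R"
proof -
  have "\<xi> \<in> closure {x. g x \<noteq> 0}" using subsetD[OF closure_subset, of \<xi> "{x. g x \<noteq> 0}"] assms(2) by simp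
  moreover have "closure {x. g x \<noteq> 0} \<subseteq> ball 0 R - ball 0 \<rho>"
    using assms(1) by (simp add: smooth_compact_support_def)
  ultimately have "\<xi> \<in> ball 0 R - ball 0 \<rho>" by blast
  then show "\<rho> \<le> norm \<xi>" "norm \<xi> < R" by auto
qed

lemma dilated_small_jump_integral:
  fixes \<nu> :: "'a::euclidean_space measure"
  assumes levy: "levy_measure \<nu>" and r: "0 < r" and N: "0 < N"
  shows "(\<integral>\<^sup>+ y \<in> {y. norm y \<le> N}. ennreal (1 - cos (y \<bullet> \<xi>)) \<partial>dilated r \<nu>) =
    ennreal (cos_integral \<nu> N r \<xi>)"
proof -
  have m: "(\<lambda>y. y /\<^sub>R r) \<in> measurable \<nu> borel"
    by (rule borel_measurable_sets_eq[OF levy_measureD(1)[OF levy]]) measurable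
  have "(\<integral>\<^sup>+ y \<in> {y. norm y \<le> N}. ennreal (1 - cos (y \<bullet> \<xi>)) \<partial>dilated r \<nu>) =
    (\<integral>\<^sup>+ y. ennreal (1 - cos ((y /\<^sub>R r) \<bullet> \<xi>)) * indicator {y. norm y \<le> N} (y /\<^sub>R r) \<partial>\<nu>)"
    unfolding dilated_def by (rule nn_integral_distr[OF m]) measurable
  also have "\<dots> = (\<integral>\<^sup>+ y. ennreal (indicator {z. norm z \<le> N} (y /\<^sub>R r) * (1 - cos ((y /\<^sub>R r) \<bullet> \<xi>))) \<partial>\<nu>)"
    by (intro nn_integral_cong) (auto simp: indicator_def)
  also have "\<dots> = ennreal (cos_integral \<nu> N r \<xi>)"
    by (intro nn_integral_eq_integral Re_small_jump_symbol(1)[OF levy r N]) auto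
  finally show ?thesis .
qed

text \<open>Rescaling \<open>r\<close> by \<open>|\<xi>| / c\<close> reduces a general \<open>\<xi>\<close> to the sphere of radius \<open>c\<close>, at the
  cost of a larger truncation radius.\<close>

lemma scaled_lower_bound:
  fixes \<nu> :: "'a::euclidean_space measure"
  assumes triple: "scaling_triple s sL sU" and levy: "levy_measure \<nu>" and N: "0 < N" and c: "0 < c" and \<rho>: "0 < \<rho>"
    and inf_pos: "(INF (r, \<xi>) \<in> {0<..} \<times> {\<xi>. norm \<xi> = c}.
          ennreal (s r) * (\<integral>\<^sup>+ y \<in> {y. norm y \<le> N}. ennreal (1 - cos (y \<bullet> \<xi>)) \<partial>dilated r \<nu>)) > 0"
  shows "\<exists>N'>0. \<exists>c'>0. \<forall>r>0. \<forall>\<xi>. \<rho> \<le> norm \<xi> \<longrightarrow>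
      c' \<le> s r * (cos_integral \<nu> N' r \<xi>)"
proof -
  have s_pos: "0 < s r" "0 < sL r" "0 < sU r" if "0 < r" for r
    using triple that unfolding scaling_triple_def by auto
  have s_le: "sL (R / r) \<le> s R / s r" "s R / s r \<le> sU (R / r)" if "0 < r" "r \<le> R" for r R
    using triple that unfolding scaling_triple_def by blast+
  have monoL: "sL x \<le> sL y" and monoU: "sU x \<le> sU y" if "0 < x" "x \<le> y" for x y
    using triple that unfolding scaling_triple_def mono_on_def by auto
  \<comment> \<open>A number strictly between 0 and the infimum is finite, so the comparison can be
    continued in the reals.\<close>
  from dense[OF inf_pos] obtain e where e: "0 < e"
    "e < (INF (r, \<xi>) \<in> {0<..} \<times> {\<xi>. norm \<xi> = c}.
          ennreal (s r) * (\<integral>\<^sup>+ y \<in> {y. norm y \<le> N}. ennreal (1 - cos (y \<bullet> \<xi>)) \<partial>dilated r \<nu>))" by blast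
  then obtain c0 where c0: "e = ennreal c0" "0 \<le> c0" by (cases e) auto
  have c0_pos: "0 < c0" using e(1) c0 by simp
  let ?I = "cos_integral \<nu>"
  have sphere: "c0 \<le> s r * ?I N r \<xi>" if "0 < r" "norm \<xi> = c" for r \<xi>
  proof -
    have I0: "0 \<le> ?I N r \<xi>" by (intro integral_nonneg_AE) auto
    have "(INF (r, \<xi>) \<in> {0<..} \<times> {\<xi>. norm \<xi> = c}.
          ennreal (s r) * (\<integral>\<^sup>+ y \<in> {y. norm y \<le> N}. ennreal (1 - cos (y \<bullet> \<xi>)) \<partial>dilated r \<nu>)) \<le>
        ennreal (s r) * (\<integral>\<^sup>+ y \<in> {y. norm y \<le> N}. ennreal (1 - cos (y \<bullet> \<xi>)) \<partial>dilated r \<nu>)"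
      by (rule INF_lower2[of "(r, \<xi>)"]) (use that in auto)
    from less_imp_le[OF order_less_le_trans[OF e(2) this]]
    have "ennreal c0 \<le> ennreal (s r) * ennreal (?I N r \<xi>)"
      unfolding c0(1) dilated_small_jump_integral[OF levy that(1) N] .
    then have "ennreal c0 \<le> ennreal (s r * ?I N r \<xi>)"
      using s_pos(1)[OF that(1)] by (simp add: ennreal_mult')
    then show ?thesis
      using s_pos(1)[OF that(1)] I0 by (simp add: ennreal_le_iff)
  qed
  \<comment> \<open>For R = r c / |\<xi>|, a jump with |y| / R \<le> N has |y| / r \<le> N c /
    |\<xi>|, which is at most N c / \<rho>.\<close>
  define N' where "N' = N * c / \<rho>"
  \<comment> \<open>Bounds s(R) / s(r) for R = r c / |\<xi>|. If R \<ge> r, the ratio R / r is at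
    most c / \<rho> and the upper scaling function applies; if R < r, the lower one is used at r /
    R, which is at least 1.\<close>
  define B where "B = max (sU (c / \<rho>)) (1 / sL 1)"
  have B: "0 < B" using s_pos[of 1] by (simp add: B_def less_max_iff_disj)
  have "c0 / B \<le> s r * ?I N' r \<xi>" if r: "0 < r" and \<xi>: "\<rho> \<le> norm \<xi>" for r \<xi>
  proof -
    have n: "0 < norm \<xi>" using \<rho> \<xi> by linarith
    define R where "R = r * c / norm \<xi>"
    have R: "0 < R" using r c n by (simp add: R_def)
    let ?\<eta> = "(c / norm \<xi>) *\<^sub>R \<xi>"
    have "norm ?\<eta> = c" using c n by simp
    from sphere[OF R this] have 1: "c0 \<le> s R * ?I N R ?\<eta>" .
    have sR: "s R \<le> B * s r"
    proof (cases "r \<le> R")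
      case True
      have "R / r = c / norm \<xi>" using r by (simp add: R_def)
      then have "R / r \<le> c / \<rho>" using c \<rho> \<xi> by (simp add: frac_le)
      then have "sU (R / r) \<le> sU (c / \<rho>)" using r R by (intro monoU) auto
      then have "s R / s r \<le> B" using s_le(2)[OF r True] by (simp add: B_def)
      then show ?thesis using s_pos(1)[OF r] by (simp add: pos_divide_le_eq)
    next
      case False
      then have "R \<le> r" by simp
      have "sL 1 \<le> sL (r / R)" using R \<open>R \<le> r\<close> by (intro monoL) auto
      also have "\<dots> \<le> s r / s R" by (rule s_le(1)[OF R \<open>R \<le> r\<close>])
      finally have "s R \<le> 1 / sL 1 * s r"
        using s_pos(1)[OF R] s_pos(2)[of 1] by (simp add: field_simps)
      also have "\<dots> \<le> B * s r" using s_pos(1)[OF r] by (intro mult_right_mono) (auto simp: B_def)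
      finally show ?thesis .
    qed
    have 2: "?I N R ?\<eta> \<le> ?I N' r \<xi>"
    proof (rule integral_mono)
      show "integrable \<nu> (\<lambda>y. indicator {z. norm z \<le> N} (y /\<^sub>R R) * (1 - cos ((y /\<^sub>R R) \<bullet> ?\<eta>)))"
        by (rule Re_small_jump_symbol(1)[OF levy R N])
      show "integrable \<nu> (\<lambda>y. indicator {z. norm z \<le> N'} (y /\<^sub>R r) * (1 - cos ((y /\<^sub>R r) \<bullet> \<xi>)))"
        by (rule Re_small_jump_symbol(1)[OF levy r]) (use N c \<rho> in \<open>simp add: N'_def\<close>)
      fix y :: 'a
      have eq: "(y /\<^sub>R R) \<bullet> ?\<eta> = (y /\<^sub>R r) \<bullet> \<xi>"
        using r c n by (simp add: R_def field_simps)
      have "norm (y /\<^sub>R r) \<le> N'" if "norm (y /\<^sub>R R) \<le> N"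
      proof -
        have "norm (y /\<^sub>R r) = norm (y /\<^sub>R R) * (c / norm \<xi>)"
          using r c n by (simp add: R_def field_simps)
        also have "\<dots> \<le> N * (c / \<rho>)"
          using that c \<rho> \<xi> N by (intro mult_mono frac_le) auto
        finally show ?thesis by (simp add: N'_def)
      qed
      then show "indicator {z. norm z \<le> N} (y /\<^sub>R R) * (1 - cos ((y /\<^sub>R R) \<bullet> ?\<eta>)) \<le>
          indicator {z. norm z \<le> N'} (y /\<^sub>R r) * (1 - cos ((y /\<^sub>R r) \<bullet> \<xi>))"
        unfolding eq by (intro mult_right_mono) (auto simp: indicator_def)
    qed
    have "0 \<le> ?I N R ?\<eta>" by (intro integral_nonneg_AE) auto
    then have "s R * ?I N R ?\<eta> \<le> (B * s r) * ?I N' r \<xi>"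
      using B s_pos(1)[OF r] by (intro mult_mono sR 2) auto
    then have "c0 \<le> B * (s r * ?I N' r \<xi>)" using 1 by (simp add: mult.assoc)
    then show ?thesis using B by (simp add: pos_divide_le_eq mult.commute)
  qed
  moreover have "0 < N'" using N c \<rho> by (simp add: N'_def)
  moreover have "0 < c0 / B" using c0_pos B by simp
  ultimately show ?thesis by blast
qed

section \<open>The upper bound in real form and for the symmetrized measure\<close>

lemma sup_bound_imp:
  fixes \<nu> :: "'a::euclidean_space measure"
  assumes levy: "levy_measure \<nu>" and s: "\<And>r. 0 < r \<Longrightarrow> 0 < s r"
    and sup_finite: "(SUP r \<in> {0<..}. ennreal (s r) * (\<integral>\<^sup>+ y. ennreal (levy_weight (y /\<^sub>R r)) \<partial>\<nu>)) < \<infinity>"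
  shows "\<exists>\<kappa>. \<forall>r>0. s r * (LINT y|\<nu>. levy_weight (y /\<^sub>R r)) \<le> \<kappa>"
proof -
  let ?S = "SUP r \<in> {0<..}. ennreal (s r) * (\<integral>\<^sup>+ y. ennreal (levy_weight (y /\<^sub>R r)) \<partial>\<nu>)"
  define \<kappa> where "\<kappa> = enn2real ?S"
  have \<kappa>: "?S = ennreal \<kappa>" "0 \<le> \<kappa>"
    unfolding \<kappa>_def using sup_finite by (simp_all only: ennreal_enn2real infinity_ennreal_def enn2real_nonneg)
  have "s r * (LINT y|\<nu>. levy_weight (y /\<^sub>R r)) \<le> \<kappa>" if r: "0 < r" for r
  proof -
    have "ennreal (s r) * (\<integral>\<^sup>+ y. ennreal (levy_weight (y /\<^sub>R r)) \<partial>\<nu>) \<le> ?S"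
      by (rule SUP_upper) (use r in simp)
    then have "ennreal (s r) * ennreal (LINT y|\<nu>. levy_weight (y /\<^sub>R r)) \<le> ennreal \<kappa>"
      unfolding \<kappa>(1) levy_nn_integral_scaled(2)[OF levy r] .
    then show ?thesis
      using s[OF r] \<kappa>(2) by (simp add: ennreal_le_iff flip: ennreal_mult')
  qed
  then show ?thesis by blast
qed

text \<open>The Levy weight is even, so \<nu> and its reflection contribute equally; r = 1 gives the
  Levy condition.\<close>

lemma levy_measure_symmetrized:
  fixes \<nu> :: "'a::euclidean_space measure"
  assumes levy: "levy_measure \<nu>"
  shows "levy_measure (symmetrized \<nu>)"
    and "0 < r \<Longrightarrow> (\<integral>\<^sup>+ y. ennreal (levy_weight (y /\<^sub>R r)) \<partial>symmetrized \<nu>) =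
      (\<integral>\<^sup>+ y. ennreal (levy_weight (y /\<^sub>R r)) \<partial>\<nu>)"
proof -
  note D = levy_measureD[OF levy]
  have half: "(x + x) / 2 = x" for x :: ennreal
    by (cases x) (auto simp: ennreal_plus[symmetric] divide_ennreal ennreal_top_divide simp flip: ennreal_numeral simp del: ennreal_plus)
  show eq: "(\<integral>\<^sup>+ y. ennreal (levy_weight (y /\<^sub>R r)) \<partial>symmetrized \<nu>) =
      (\<integral>\<^sup>+ y. ennreal (levy_weight (y /\<^sub>R r)) \<partial>\<nu>)" if "0 < r" for r
    by (subst nn_integral_symmetrized[OF D(1)]) (auto simp: half)
  show "levy_measure (symmetrized \<nu>)"
    unfolding levy_measure_def
    using eq[of 1] D by (simp add: emeasure_symmetrized[OF D(1)])
qed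

theorem proposition3p7:
  fixes s sL sU :: "real \<Rightarrow> real"
    and M :: "'w measure" and F :: "real \<Rightarrow> 'w measure"
    and Z :: "real \<Rightarrow> 'w \<Rightarrow> 'a::euclidean_space"
    and a :: "real \<Rightarrow> 'a" and \<Lambda> :: "real \<Rightarrow> 'a measure"
    and \<nu> :: "'a measure" and N\<^sub>\<nu> c :: real
  assumes triple: "scaling_triple s sL sU"
    and process: "additive_process M F Z a \<Lambda>"
    and levy: "levy_measure \<nu>"
    and N_pos: "0 < N\<^sub>\<nu>" and c_pos: "0 < c"
    and dominates: "\<And>t f. 0 \<le> t \<Longrightarrow> f \<in> borel_measurable borel \<Longrightarrow>
          (\<integral>\<^sup>+ y. f y \<partial>\<Lambda> t) \<ge> (\<integral>\<^sup>+ y. f y \<partial>\<nu>)"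
    and inf_pos: "(INF (r, \<xi>) \<in> {0<..} \<times> {\<xi>. norm \<xi> = c}.
          ennreal (s r) *
            (\<integral>\<^sup>+ y \<in> {y. norm y \<le> N\<^sub>\<nu>}. ennreal (1 - cos (y \<bullet> \<xi>)) \<partial>dilated r \<nu>)) > 0"
    and sup_finite: "(SUP r \<in> {0<..}.
          ennreal (s r) * (\<integral>\<^sup>+ y. ennreal (min 1 ((norm (y /\<^sub>R r))\<^sup>2)) \<partial>\<nu>)) < \<infinity>"
  shows "(\<forall>T>0. \<forall>\<phi>\<in>schwartz.
            fourier \<phi> \<in> smooth_compact_support
              (ball 0 (scaling_const sL) - ball 0 (inverse (scaling_const sL))) \<longrightarrow>
            (\<exists>N\<^sub>0>0. \<exists>N\<^sub>1>0. \<forall>r\<in>{0<..<1}. \<forall>t\<in>{0..T}.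
               (\<integral>\<^sup>+ x. ennreal (norm (LINT \<omega>|M. \<phi> (x + Z t \<omega> /\<^sub>R r))) \<partial>lborel)
                 \<le> ennreal (N\<^sub>0 * exp (- (N\<^sub>1 * t / s r))))) \<and>
         (levy_measure (symmetrized \<nu>) \<and>
          distr (symmetrized \<nu>) borel uminus = symmetrized \<nu> \<and>
          (SUP r \<in> {0<..}. ennreal (s r) *
             (\<integral>\<^sup>+ y. ennreal (min 1 ((norm (y /\<^sub>R r))\<^sup>2)) \<partial>symmetrized \<nu>)) < \<infinity> \<and>
          (\<forall>\<phi>\<in>schwartz.
            fourier \<phi> \<in> smooth_compact_support
              (ball 0 (scaling_const sL) - ball 0 (inverse (scaling_const sL))) \<longrightarrow>
            (\<exists>N\<^sub>2>0. \<forall>r\<in>{0<..<1}.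
               (\<integral>\<^sup>+ x. ennreal (norm (levy_operator (symmetrized \<nu>) r \<phi> x)) \<partial>lborel)
                 \<le> ennreal (N\<^sub>2 / s r))))"
proof -
  let ?c = "scaling_const sL"
  have c: "0 < ?c" by (simp add: scaling_const_def)
  have s: "0 < s r" if "0 < r" for r
    using triple that unfolding scaling_triple_def by auto
  have sym: "levy_measure (symmetrized \<nu>)" by (rule levy_measure_symmetrized[OF levy])
  have symd: "distr (symmetrized \<nu>) borel uminus = symmetrized \<nu>"
    by (rule symmetrized_symmetric[OF levy_measureD(1)[OF levy]])
  have sym_sup: "(SUP r \<in> {0<..}. ennreal (s r) *
      (\<integral>\<^sup>+ y. ennreal (levy_weight (y /\<^sub>R r)) \<partial>symmetrized \<nu>)) < \<infinity>"
  proof -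
    have "(SUP r \<in> {0<..}. ennreal (s r) * (\<integral>\<^sup>+ y. ennreal (levy_weight (y /\<^sub>R r)) \<partial>symmetrized \<nu>)) =
      (SUP r \<in> {0<..}. ennreal (s r) * (\<integral>\<^sup>+ y. ennreal (levy_weight (y /\<^sub>R r)) \<partial>\<nu>))"
      by (intro SUP_cong refl) (simp only: greaterThan_iff levy_measure_symmetrized(2)[OF levy])
    then show ?thesis using sup_finite by simp
  qed
  have decay: "\<exists>N\<^sub>0>0. \<exists>N\<^sub>1>0. \<forall>r\<in>{0<..<1}. \<forall>t\<in>{0..T}.
      (\<integral>\<^sup>+ x. ennreal (norm (LINT \<omega>|M. \<phi> (x + Z t \<omega> /\<^sub>R r))) \<partial>lborel) \<le> ennreal (N\<^sub>0 * exp (- (N\<^sub>1 * t / s r)))"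
    if \<phi>: "\<phi> \<in> schwartz" and supp: "fourier \<phi> \<in> smooth_compact_support (ball 0 ?c - ball 0 (inverse ?c))" for T \<phi>
  proof -
    \<comment> \<open>Half the inner radius of the annulus, since \<open>small_jump_decay\<close>
      wants the lower bound to hold from half the inner radius of the support on.\<close>
    let ?\<rho> = "inverse ?c / 2"
    have \<rho>: "0 < ?\<rho>" using c by simp
    from fs_bounded_fourier[OF schwartz_imp(3)[OF \<phi>]] obtain G where G: "fs_bounded (fourier \<phi>) G" by blast
    have int: "integrable lborel (fourier \<phi>)"
      by (rule fs_bounded_integrable_support[OF G, of ?c]) (use compact_support_annulus[OF supp] in fastforce)
    obtain K where K: "\<And>x. norm (\<phi> x) \<le> K" using schwartz_imp(2)[OF \<phi>] by blast
    have inv: "inv_fourier (fourier \<phi>) x = \<phi> x" for x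
      by (rule fourier_inversion[OF schwartz_imp(3)[OF \<phi>] schwartz_imp(1)[OF \<phi>] K int])
    obtain N c' where N: "0 < N" and c': "0 < c'"
      and low: "\<And>r \<xi>. 0 < r \<Longrightarrow> ?\<rho> \<le> norm \<xi> \<Longrightarrow>
        c' \<le> s r * (cos_integral \<nu> N r \<xi>)"
      using scaled_lower_bound[OF triple levy N_pos c_pos \<rho> inf_pos] by blast
    obtain \<kappa> where \<kappa>: "\<And>r. 0 < r \<Longrightarrow> s r * (LINT y|\<nu>. levy_weight (y /\<^sub>R r)) \<le> \<kappa>"
      using sup_bound_imp[OF levy s sup_finite] by blast
    have supp': "2 * ?\<rho> \<le> norm \<xi> \<and> norm \<xi> \<le> ?c" if "fourier \<phi> \<xi> \<noteq> 0" for \<xi>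
      using compact_support_annulus[OF supp that] by simp
    obtain N\<^sub>0 where N\<^sub>0: "0 < N\<^sub>0" and dec: "\<And>r t. 0 < r \<Longrightarrow> 0 \<le> t \<Longrightarrow>
        fs_bounded (\<lambda>\<xi>. fourier \<phi> \<xi> * exp (complex_of_real t * small_jump_symbol \<nu> (N * r) (\<xi> /\<^sub>R r)))
          (N\<^sub>0 * exp (- (c' / 2 * t / s r)))"
      using small_jump_decay[OF levy N c' s \<rho> low \<kappa> G supp'] by blast
    have "(\<integral>\<^sup>+ x. ennreal (norm (LINT \<omega>|M. \<phi> (x + Z t \<omega> /\<^sub>R r))) \<partial>lborel) \<le>
        ennreal (gauss_mass TYPE('a) * N\<^sub>0 * exp (- (c' / 2 * t / s r)))" if r: "0 < r" and t: "0 \<le> t" for r t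
    proof -
      \<comment> \<open>Truncating the jumps of \<nu> at N r means truncating at \<open>N\<close>
        after division by \<open>r\<close>, which matches the lower bound.\<close>
      have "0 < N * r" using N r by simp
      from additive_process_char[OF process levy dominates this t]
      obtain E where E: "fs_bounded E 1" and ch: "\<And>\<xi>. (LINT \<omega>|M. iexp (\<xi> \<bullet> Z t \<omega>)) =
          E \<xi> * exp (complex_of_real t * small_jump_symbol \<nu> (N * r) \<xi>)" by blast
      have ch': "(LINT \<omega>|M. iexp (\<xi> \<bullet> (Z t \<omega> /\<^sub>R r))) =
          E (\<xi> /\<^sub>R r) * exp (complex_of_real t * small_jump_symbol \<nu> (N * r) (\<xi> /\<^sub>R r))" for \<xi>
        using ch[of "\<xi> /\<^sub>R r"] by simp
      let ?h = "\<lambda>\<xi>. fourier \<phi> \<xi> * (LINT \<omega>|M. iexp (\<xi> \<bullet> (Z t \<omega> /\<^sub>R r)))"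
      have "fs_bounded (\<lambda>\<xi>. fourier \<phi> \<xi> * exp (complex_of_real t * small_jump_symbol \<nu> (N * r) (\<xi> /\<^sub>R r)) * E (\<xi> /\<^sub>R r))
          (N\<^sub>0 * exp (- (c' / 2 * t / s r)) * 1)"
        by (intro fs_bounded_mult dec fs_bounded_scale[OF E] r t)
      then have h: "fs_bounded ?h (N\<^sub>0 * exp (- (c' / 2 * t / s r)))"
        unfolding ch' by (simp only: mult_ac mult_1_right mult_1_left)
      have hint: "integrable lborel ?h"
        by (rule fs_bounded_integrable_support[OF h, of ?c]) (use compact_support_annulus[OF supp] in fastforce)
      have Zm: "Z t \<in> borel_measurable M" by (rule additive_process_measurable[OF process t])
      have ps: "prob_space M" using process by (simp add: additive_process_def)
      have "(LINT \<omega>|M. \<phi> (x + Z t \<omega> /\<^sub>R r)) = inv_fourier ?h x" for x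
        by (rule expectation_inv_fourier[OF ps _ int inv]) (use Zm in measurable)
      then show ?thesis
        using fs_bounded_inv_fourier[OF h hint] by (simp only: mult.assoc)
    qed
    moreover have "0 < gauss_mass TYPE('a) * N\<^sub>0" using N\<^sub>0 by simp
    moreover have "0 < c' / 2" using c' by simp
    ultimately show ?thesis
      by (intro exI[of _ "gauss_mass TYPE('a) * N\<^sub>0"] exI[of _ "c' / 2"] conjI ballI) auto
  qed
  have operator: "\<exists>N\<^sub>2>0. \<forall>r\<in>{0<..<1}.
      (\<integral>\<^sup>+ x. ennreal (norm (levy_operator (symmetrized \<nu>) r \<phi> x)) \<partial>lborel) \<le> ennreal (N\<^sub>2 / s r)"
    if \<phi>: "\<phi> \<in> schwartz" and supp: "fourier \<phi> \<in> smooth_compact_support (ball 0 ?c - ball 0 (inverse ?c))" for \<phi>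
  proof -
    from fs_bounded_fourier[OF schwartz_imp(3)[OF \<phi>]] obtain G where G: "fs_bounded (fourier \<phi>) G" by blast
    obtain \<kappa> where \<kappa>: "\<And>r. 0 < r \<Longrightarrow> s r * (LINT y|symmetrized \<nu>. levy_weight (y /\<^sub>R r)) \<le> \<kappa>"
      using sup_bound_imp[OF sym s sym_sup] by blast
    have supp': "fourier \<phi> \<xi> = 0" if "?c \<le> norm \<xi>" for \<xi>
      using compact_support_annulus(2)[OF supp, of \<xi>] that by force
    define D where "D = 2 * hat_norm * real DIM('a)"
    define A where "A = gauss_mass TYPE('a) * ((2 + (D * ?c)\<^sup>2 * exp (D * ?c)) * \<kappa> * G)"
    \<comment> \<open>\<open>\<bar>A\<bar> + 1\<close> instead of \<open>A\<close> guarantees a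
      positive constant, even when \<open>A\<close> is 0.\<close>
    have bound: "(\<integral>\<^sup>+ x. ennreal (norm (levy_operator (symmetrized \<nu>) r \<phi> x)) \<partial>lborel) \<le> ennreal ((\<bar>A\<bar> + 1) / s r)"
      if r: "0 < r" for r
    proof -
      have "(LINT y|symmetrized \<nu>. levy_weight (y /\<^sub>R r)) \<le> \<kappa> / s r"
        using \<kappa>[OF r] s[OF r] by (simp add: pos_le_divide_eq mult.commute)
      from levy_operator_bound[OF sym symd r c D_def G supp' this]
      have "(\<integral>\<^sup>+ x. ennreal (norm (levy_operator (symmetrized \<nu>) r \<phi> x)) \<partial>lborel) \<le> ennreal (A / s r)"
        by (simp add: A_def)
      also have "\<dots> \<le> ennreal ((\<bar>A\<bar> + 1) / s r)"
        using s[OF r] by (intro ennreal_leI divide_right_mono) auto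
      finally show ?thesis .
    qed
    show ?thesis
      by (intro exI[of _ "\<bar>A\<bar> + 1"] conjI ballI bound) auto
  qed
  show ?thesis
    using decay operator sym symd sym_sup by blast
qed

end
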